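(* Let $\mu \in \mathcal{P}(\mathcal{H}_* )$ be a unimodular probability measure with $\deg(\mu) < \infty$. Then the following hold. 1. There exists a Borel allocation $\Theta: \mathcal{H}_{**} \to [0,1]$ which is balanced with respect to $\mu$. 2. Let $\Theta$ be a Borel allocation which is balanced with respect to $\mu$. Then for every $t \in \mathbb{R}$, $$\int (\partial \Theta - t)^+ \, d\mu = \max_{f: \mathcal{H}_* \to [0,1] \text{ Borel}} \left( \int \tilde{f}_{\min} \, d\vec{\mu} - t \int f \, d\mu \right),$$ where $\tilde{f}_{\min}: \mathcal{H}_{**} \to [0,1]$ is defined by $\tilde{f}_{\min}(H,e,i) := \frac{1}{|e|} \min_{j \in e} f(H,j)$. 3. The following are equivalent for a Borel allocation $\Theta: \mathcal{H}_{**} \to [0,1]$: (a) $\Theta$ is balanced with respect to $\mu$; (b) $\Theta$ minimizes $\int f \circ \partial \Theta \, d\mu$ among all Borel allocations, for some strictly convex function $f: [0,\infty) \to [0,\infty)$; (c) $\Theta$ minimizes $\int f \circ \partial\Theta \, d\mu$ among all Borel allocations, for every convex function $f: [0,\infty) \to [0,\infty)$. 4. Assume $\Theta_0$ is a Borel allocation balanced with respect to $\mu$ and $\Theta$ is any other Borel allocation on $\mathcal{H}_{**}$. Then $\Theta$ is balanced with respect to $\mu$ if and only if $\partial\Theta_0 = \partial\Theta$ $\mu$-almost surely. 5. Let $\{H_n\}_{n\ge1}$ be a sequence of finite hypergraphs with local weak limit $\mu$. Let $\mathcal{L}_{H_n} := \frac{1}{|V(H_n)|}\sum_{i \in V(H_n)}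 \delta_{\partial\theta_n(i)}$, where $\theta_n$ is any balanced allocation on $H_n$, and let $\mathcal{L}$ be the pushforward of $\mu$ under $\partial\Theta$, where $\Theta$ is any Borel allocation balanced with respect to $\mu$. Then $\mathcal{L}_{H_n}$ converges weakly to $\mathcal{L}$.
   Context: A hypergraph $H = \langle V, E\rangle$ consists of a countable vertex set $V(H)$ and a set $E(H)$ of finite nonempty subsets of $V(H)$, called edges (so $H$ is simple); it is always assumed locally finite: $\deg_H(i) := |\{e \in E(H): i \in e\}| < \infty$ for all $i \in V(H)$. There is no uniform bound on degrees or edge sizes. A path of length $n$ from $i$ to $j$ is a sequence $i_0,e_1,i_1,\dots,e_n,i_n$ with $i_0=i$, $i_n=j$ and $i_{k},i_{k+1}\in e_{k+1}$ for $0\le k<n$; $d_H(i,j)$ is the length of a shortest path ($d_H(i,i)=0$). $H$ is connected if any two vertices are joined by a path. For a finite hypergraph $H$: an allocation on $H$ is a map $\theta$ assigning to each pair $(e,i)$ with $i\in e\in E(H)$ a number $\theta(e,i)\in[0,1]$ with $\sum_{j\in e}\theta(e,j)=1$ for all $e$; $\partial\theta(i) := \sum_{e \ni i}\theta(e,i)$; $\theta$ is balanced if for all $e\in E(H)$ and $i,j\in e$, $\partial\theta(i)>\partial\theta(j)$ implies $\theta(e,i)=0$. It is known that balanced allocations exist on every finite hypergraph and that all of them have the same load vector $\partial\theta$. Rooted hypergraphs. A vertex rooted hypergraph $(H,i)$ is a hypergraph with a distinguished vertex $i$; an edge-vertex rooted hypergraph $(H,e,i)$ has a distinguished edge $e$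 and vertex $i\in e$. Isomorphisms are vertex bijections $\phi$ that induce a bijection of edge sets (with $\phi(e)=\{\phi(j):j\in e\}$) and preserve the roots (the root vertex, and the root edge if present). $\mathcal{H}_*$ (resp. $\mathcal{H}_{**}$) is the set of isomorphism classes $[H,i]$ (resp. $[H,e,i]$) of connected vertex rooted (resp. edge-vertex rooted) hypergraphs. For integer $m\ge1$, $(H,i)\equiv_m(H',i')$ means that the hypergraph with vertex set $\{j : d_H(i,j)\le m\}$ and all edges of $H$ contained in this set, rooted at $i$, is isomorphic to the corresponding rooted hypergraph for $(H',i')$; similarly for edge-vertex rooted hypergraphs, with the isomorphism also mapping root edge to root edge. The distance between two classes is $1/(1+m^* )$, where $m^*$ is the supremum of $m\ge1$ with $\equiv_m$ between representatives ($m^*=0$ if there is none, distance $0$ if $m^*=\infty$). With these metrics $\mathcal{H}_*$ and $\mathcal{H}_{**}$ are Polish; $\mathcal{P}(\cdot)$ denotes Borel probability measures. Functions of classes are written as functions of representatives. For $f:\mathcal{H}_{**}\to\mathbb{R}$: $\partial f(H,i) := \sum_{e\ni i} f(H,e,i)$ (a function on $\mathcal{H}_*$) and $\nabla f(H,e,i) := \frac1{|e|}\sum_{j\in e} f(H,e,j)$ (a function on $\mathcal{H}_{**}$). For $\mu\in\mathcal{P}(\mathcal{H}_* )$, $\deg(\mu):=\int\deg_H(i)\,d\mu$, and $\vec\mu$ is the Borel measure on $\mathcal{H}_{**}$ with $\int f\,d\vec\mu=\int\partial f\,d\mu$ for all Borel $f:\mathcal{H}_{**}\to[0,\infty)$.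 $\mu$ is unimodular if $\int f\,d\vec\mu=\int\nabla f\,d\vec\mu$ for all Borel $f:\mathcal{H}_{**}\to[0,\infty)$. A Borel allocation is a Borel function $\Theta:\mathcal{H}_{**}\to[0,1]$ with $\sum_{j\in e}\Theta(H,e,j)=1$ for all $[H,e,i]\in\mathcal{H}_{**}$. It is balanced with respect to $\mu$ if for $\vec\mu$-almost every $[H,e,i]$: for all $j_1,j_2\in e$, $\partial\Theta(H,j_1)>\partial\Theta(H,j_2)$ implies $\Theta(H,e,j_1)=0$. For a finite hypergraph $H$, $u_H:=\frac1{|V(H)|}\sum_{i\in V(H)}\delta_{[H(i),i]}\in\mathcal{P}(\mathcal{H}_* )$, where $H(i)$ is the connected component of $i$. A sequence $H_n$ has local weak limit $\mu$ if $u_{H_n}$ converges weakly to $\mu$. For real $x$, $x^+=\max\{x,0\}$.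
   Formalization: In 3(b), "Θ minimizes ∫ f∘∂Θ dμ for some strictly convex f" is taken with a finite minimum: the integral at Θ must be finite, since otherwise every Borel allocation could have infinite cost and minimize without being balanced. *)

theory Defs
  imports "HOL-Probability.Probability"
begin

section \<open>Hypergraphs\<close>

record 'v pre_hypergraph =
  verts :: "'v set"
  edges :: "'v set set"

locale hypergraph =
  fixes H :: "'v pre_hypergraph"
  assumes countable_verts: "countable (verts H)"
    and edge_subset: "e \<in> edges H \<Longrightarrow> e \<subseteq> verts H"
    and edge_finite: "e \<in> edges H \<Longrightarrow> finite e"
    and edge_nonempty: "e \<in> edges H \<Longrightarrow> e \<noteq> {}"
    and locally_finite: "i \<in> verts H \<Longrightarrow> finite {e \<in> edges H. i \<in> e}"

definition hpath :: "'v pre_hypergraph \<Rightarrow> nat \<Rightarrow> 'v \<Rightarrow> 'v \<Rightarrow> bool" where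
  "hpath H n i j \<longleftrightarrow> i \<in> verts H \<and>
     (\<exists>v e. v 0 = i \<and> v n = j \<and>
        (\<forall>k<n. e (Suc k) \<in> edges H \<and> v k \<in> e (Suc k) \<and> v (Suc k) \<in> e (Suc k)))"

text \<open>The distance is \<open>\<infinity>\<close> between vertices that are not joined by a path.\<close>

definition hdist :: "'v pre_hypergraph \<Rightarrow> 'v \<Rightarrow> 'v \<Rightarrow> enat" where
  "hdist H i j = Inf {enat n | n. hpath H n i j}"

definition hconnected :: "'v pre_hypergraph \<Rightarrow> bool" where
  "hconnected H \<longleftrightarrow> (\<forall>i\<in>verts H. \<forall>j\<in>verts H. \<exists>n. hpath H n i j)"

definition hrestrict :: "'v pre_hypergraph \<Rightarrow> 'v set \<Rightarrow> 'v pre_hypergraph" where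
  "hrestrict H S = \<lparr>verts = S, edges = {e \<in> edges H. e \<subseteq> S}\<rparr>"

definition hnbhd :: "'v pre_hypergraph \<Rightarrow> 'v \<Rightarrow> nat \<Rightarrow> 'v set" where
  "hnbhd H i m = {j \<in> verts H. hdist H i j \<le> enat m}"

definition hball :: "'v pre_hypergraph \<Rightarrow> 'v \<Rightarrow> nat \<Rightarrow> 'v pre_hypergraph" where
  "hball H i m = hrestrict H (hnbhd H i m)"

definition component :: "'v pre_hypergraph \<Rightarrow> 'v \<Rightarrow> 'v pre_hypergraph" where
  "component H i = hrestrict H {j \<in> verts H. \<exists>n. hpath H n i j}"

definition hmap :: "('v \<Rightarrow> 'w) \<Rightarrow> 'v pre_hypergraph \<Rightarrow> 'w pre_hypergraph" where
  "hmap \<phi> H = \<lparr>verts = \<phi> ` verts H, edges = (`) \<phi> ` edges H\<rparr>"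

definition hiso :: "('v \<Rightarrow> 'w) \<Rightarrow> 'v pre_hypergraph \<Rightarrow> 'w pre_hypergraph \<Rightarrow> bool" where
  "hiso \<phi> H K \<longleftrightarrow> bij_betw \<phi> (verts H) (verts K) \<and> bij_betw ((`) \<phi>) (edges H) (edges K)"


section \<open>Balanced allocations on finite hypergraphs\<close>

definition finite_hypergraph :: "'v pre_hypergraph \<Rightarrow> bool" where
  "finite_hypergraph H \<longleftrightarrow> hypergraph H \<and> finite (verts H) \<and> verts H \<noteq> {}"

text \<open>The values \<open>\<theta> e i\<close> for pairs other than \<open>i \<in> e \<in> edges H\<close> are irrelevant.\<close>

definition allocation :: "'v pre_hypergraph \<Rightarrow> ('v set \<Rightarrow> 'v \<Rightarrow> real) \<Rightarrow> bool" where
  "allocation H \<theta> \<longleftrightarrow>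
     (\<forall>e\<in>edges H. (\<forall>i\<in>e. 0 \<le> \<theta> e i \<and> \<theta> e i \<le> 1) \<and> (\<Sum>j\<in>e. \<theta> e j) = 1)"

definition load :: "'v pre_hypergraph \<Rightarrow> ('v set \<Rightarrow> 'v \<Rightarrow> real) \<Rightarrow> 'v \<Rightarrow> real" where
  "load H \<theta> i = (\<Sum>e\<in>{e \<in> edges H. i \<in> e}. \<theta> e i)"

definition balanced_allocation :: "'v pre_hypergraph \<Rightarrow> ('v set \<Rightarrow> 'v \<Rightarrow> real) \<Rightarrow> bool" where
  "balanced_allocation H \<theta> \<longleftrightarrow> allocation H \<theta> \<and>
     (\<forall>e\<in>edges H. \<forall>i\<in>e. \<forall>j\<in>e. load H \<theta> i > load H \<theta> j \<longrightarrow> \<theta> e i = 0)"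


section \<open>Rooted hypergraphs\<close>

fun vrooted :: "'v pre_hypergraph \<times> 'v \<Rightarrow> bool" where
  "vrooted (H, i) \<longleftrightarrow> hypergraph H \<and> hconnected H \<and> i \<in> verts H"

fun erooted :: "'v pre_hypergraph \<times> 'v set \<times> 'v \<Rightarrow> bool" where
  "erooted (H, e, i) \<longleftrightarrow> hypergraph H \<and> hconnected H \<and> e \<in> edges H \<and> i \<in> e"

fun viso :: "'v pre_hypergraph \<times> 'v \<Rightarrow> 'w pre_hypergraph \<times> 'w \<Rightarrow> bool" where
  "viso (H, i) (K, j) \<longleftrightarrow> (\<exists>\<phi>. hiso \<phi> H K \<and> \<phi> i = j)"

fun eiso :: "'v pre_hypergraph \<times> 'v set \<times> 'v \<Rightarrow> 'w pre_hypergraph \<times> 'w set \<times> 'w \<Rightarrow> bool" where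
  "eiso (H, e, i) (K, f, j) \<longleftrightarrow> (\<exists>\<phi>. hiso \<phi> H K \<and> \<phi> ` e = f \<and> \<phi> i = j)"

text \<open>The relations \<open>\<equiv>\<^sub>m\<close>, for \<open>m \<ge> 1\<close>.\<close>

fun veq :: "nat \<Rightarrow> 'v pre_hypergraph \<times> 'v \<Rightarrow> 'w pre_hypergraph \<times> 'w \<Rightarrow> bool" where
  "veq m (H, i) (K, j) \<longleftrightarrow> viso (hball H i m, i) (hball K j m, j)"

fun eeq :: "nat \<Rightarrow> 'v pre_hypergraph \<times> 'v set \<times> 'v \<Rightarrow> 'w pre_hypergraph \<times> 'w set \<times> 'w \<Rightarrow> bool" where
  "eeq m (H, e, i) (K, f, j) \<longleftrightarrow> eiso (hball H i m, e, i) (hball K j m, f, j)"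

lemma hpath_0: "hpath H 0 i j \<longleftrightarrow> i \<in> verts H \<and> i = j"
  by (auto simp: hpath_def)

lemma hpath_Suc:
  "hpath H (Suc n) i j \<longleftrightarrow> (\<exists>k e. hpath H n i k \<and> e \<in> edges H \<and> k \<in> e \<and> j \<in> e)"
proof
  assume "hpath H (Suc n) i j"
  then obtain v e where *: "i \<in> verts H" "v 0 = i" "v (Suc n) = j"
    "\<forall>k<Suc n. e (Suc k) \<in> edges H \<and> v k \<in> e (Suc k) \<and> v (Suc k) \<in> e (Suc k)"
    by (auto simp: hpath_def)
  then have "hpath H n i (v n)" unfolding hpath_def by (metis less_Suc_eq)
  with * show "\<exists>k e. hpath H n i k \<and> e \<in> edges H \<and> k \<in> e \<and> j \<in> e" by blast
next
  assume "\<exists>k e. hpath H n i k \<and> e \<in> edges H \<and> k \<in> e \<and> j \<in> e"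
  then obtain k f v e where *: "i \<in> verts H" "v 0 = i" "v n = k" "f \<in> edges H" "k \<in> f" "j \<in> f"
    "\<forall>k<n. e (Suc k) \<in> edges H \<and> v k \<in> e (Suc k) \<and> v (Suc k) \<in> e (Suc k)"
    by (auto simp: hpath_def)
  show "hpath H (Suc n) i j"
    unfolding hpath_def
    by (intro conjI exI[of _ "v(Suc n := j)"] exI[of _ "e(Suc n := f)"])
       (use * in \<open>auto simp: less_Suc_eq\<close>)
qed

lemma hdist_le: "hdist H i j \<le> enat m \<longleftrightarrow> (\<exists>n\<le>m. hpath H n i j)"
proof
  assume a: "hdist H i j \<le> enat m"
  then have "{enat n | n. hpath H n i j} \<noteq> {}"
    unfolding hdist_def by (metis Inf_empty infinity_ileE top_enat_def)
  then have "hdist H i j \<in> {enat n | n. hpath H n i j}"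
    unfolding hdist_def Inf_enat_def by (metis (mono_tags, lifting) LeastI_ex ex_in_conv)
  with a show "\<exists>n\<le>m. hpath H n i j" by auto
next
  assume "\<exists>n\<le>m. hpath H n i j"
  then obtain n where n: "n \<le> m" "hpath H n i j" by auto
  then have "hdist H i j \<le> enat n" unfolding hdist_def by (intro Inf_lower) auto
  also have "\<dots> \<le> enat m" using n by simp
  finally show "hdist H i j \<le> enat m" .
qed

lemma hnbhd_iff: "j \<in> hnbhd H i m \<longleftrightarrow> j \<in> verts H \<and> (\<exists>n\<le>m. hpath H n i j)"
  by (simp add: hnbhd_def hdist_le)

lemma hnbhd_subset: "hnbhd H i m \<subseteq> verts H"
  by (auto simp: hnbhd_def)

lemma verts_hball [simp]: "verts (hball H i m) = hnbhd H i m"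
  and edges_hball [simp]: "edges (hball H i m) = {e \<in> edges H. e \<subseteq> hnbhd H i m}"
  by (simp_all add: hball_def hrestrict_def)

lemma hnbhd_0: "i \<in> verts H \<Longrightarrow> hnbhd H i 0 = {i}"
  by (auto simp: hnbhd_iff hpath_0)

lemma (in hypergraph) hnbhd_Suc:
  assumes "i \<in> verts H"
  shows "hnbhd H i (Suc m) = hnbhd H i m \<union> \<Union>{e \<in> edges H. e \<inter> hnbhd H i m \<noteq> {}}" (is "?L = ?R")
proof (intro equalityI subsetI)
  fix j assume "j \<in> ?L"
  then obtain n where n: "n \<le> Suc m" "hpath H n i j" "j \<in> verts H" by (auto simp: hnbhd_iff)
  show "j \<in> ?R"
  proof (cases "n \<le> m")
    case True then show ?thesis using n by (auto simp: hnbhd_iff)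
  next
    case False
    then have "n = Suc m" using n by simp
    with n obtain k e where e: "hpath H m i k" "e \<in> edges H" "k \<in> e" "j \<in> e" by (auto simp: hpath_Suc)
    then have "k \<in> hnbhd H i m" using edge_subset by (auto simp: hnbhd_iff)
    with e show ?thesis by blast
  qed
next
  fix j assume "j \<in> ?R"
  then consider "j \<in> hnbhd H i m" | e k where "e \<in> edges H" "j \<in> e" "k \<in> e" "k \<in> hnbhd H i m"
    by blast
  then show "j \<in> ?L"
  proof cases
    case 1 then show ?thesis by (auto simp: hnbhd_iff intro: le_SucI)
  next
    case (2 e k)
    then obtain n where "n \<le> m" "hpath H n i k" by (auto simp: hnbhd_iff)
    then have "hpath H (Suc n) i j" "Suc n \<le> Suc m" using 2 by (auto simp: hpath_Suc)
    moreover have "j \<in> verts H" using 2 edge_subset by auto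
    ultimately show ?thesis by (auto simp: hnbhd_iff)
  qed
qed

lemma hnbhd_mono: "k \<le> m \<Longrightarrow> hnbhd H i k \<subseteq> hnbhd H i m"
  by (auto simp: hnbhd_def intro: order_trans)

lemma (in hypergraph) finite_hnbhd:
  assumes "i \<in> verts H" shows "finite (hnbhd H i m)"
proof (induction m)
  case 0 then show ?case using hnbhd_0[OF assms] by simp
next
  case (Suc m)
  have "{e \<in> edges H. e \<inter> hnbhd H i m \<noteq> {}} = (\<Union>j\<in>hnbhd H i m. {e \<in> edges H. j \<in> e})"
    by blast
  then have "finite {e \<in> edges H. e \<inter> hnbhd H i m \<noteq> {}}"
    using Suc locally_finite by (auto simp: hnbhd_def)
  then have "finite (\<Union>{e \<in> edges H. e \<inter> hnbhd H i m \<noteq> {}})"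
    using edge_finite by (intro finite_Union) auto
  then show ?case unfolding hnbhd_Suc[OF assms] using Suc by (intro finite_UnI)
qed

lemma (in hypergraph) edge_subset_hnbhd_1:
  assumes "e \<in> edges H" "i \<in> e" "m \<ge> 1" shows "e \<subseteq> hnbhd H i m"
proof -
  have i: "i \<in> verts H" using assms edge_subset by auto
  have "e \<subseteq> hnbhd H i (Suc 0)" unfolding hnbhd_Suc[OF i] hnbhd_0[OF i] using assms by blast
  then show ?thesis using hnbhd_mono[of "Suc 0" m H i] assms by auto
qed

lemma hiso_refl: "hiso (\<lambda>x. x) H H"
  by (simp add: hiso_def bij_betw_def inj_on_def)

lemma hiso_id: "hiso id H H"
  using hiso_refl by (simp add: id_def)

lemma image_image_cancel: "(\<And>e. e \<in> F \<Longrightarrow> g ` f ` e = e) \<Longrightarrow> (`) g ` (`) f ` F = F"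
  unfolding image_image[of "(`) g" "(`) f"] by (simp cong: image_cong_simp)

lemma hiso_comp:
  assumes "hiso \<phi> H K" "hiso \<psi> K L"
  shows "hiso (\<psi> \<circ> \<phi>) H L"
proof -
  have "(`) (\<psi> \<circ> \<phi>) = (`) \<psi> \<circ> (`) \<phi>" by (auto simp: fun_eq_iff)
  then show ?thesis
    using assms bij_betw_trans[of \<phi> "verts H" "verts K" \<psi> "verts L"]
      bij_betw_trans[of "(`) \<phi>" "edges H" "edges K" "(`) \<psi>" "edges L"]
    unfolding hiso_def by simp
qed

lemma hisoI:
  assumes "bij_betw \<phi> (verts H) (verts K)" "(`) \<phi> ` edges H = edges K" "\<And>e. e \<in> edges H \<Longrightarrow> e \<subseteq> verts H"
  shows "hiso \<phi> H K"
proof -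
  have "inj_on ((`) \<phi>) (edges H)"
    by (rule inj_on_subset[OF inj_on_image_Pow[of \<phi> "verts H"]])
       (use assms in \<open>auto simp: bij_betw_def\<close>)
  then show ?thesis using assms by (simp add: hiso_def bij_betw_def)
qed

lemma hiso_inv:
  assumes "hiso \<phi> H K" "\<And>e. e \<in> edges H \<Longrightarrow> e \<subseteq> verts H"
  shows "hiso (inv_into (verts H) \<phi>) K H" "\<And>A. A \<subseteq> verts H \<Longrightarrow> inv_into (verts H) \<phi> ` \<phi> ` A = A"
proof -
  have b: "bij_betw \<phi> (verts H) (verts K)" and e: "(`) \<phi> ` edges H = edges K"
    using assms by (auto simp: hiso_def bij_betw_def)
  show 2: "\<And>A. A \<subseteq> verts H \<Longrightarrow> inv_into (verts H) \<phi> ` \<phi> ` A = A"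
    using b by (simp add: bij_betw_def inv_into_image_cancel)
  have *: "(`) (inv_into (verts H) \<phi>) ` edges K = edges H"
    unfolding e[symmetric] by (rule image_image_cancel) (rule 2, rule assms(2))
  have "\<And>e. e \<in> edges K \<Longrightarrow> e \<subseteq> verts K"
    unfolding e[symmetric] using assms(2) b by (auto simp: bij_betw_def)
  then show "hiso (inv_into (verts H) \<phi>) K H"
    using bij_betw_inv_into[OF b] * by (intro hisoI)
qed

text \<open>A common form of both kinds of rooted isomorphism, with a set \<open>F\<close> of root edges; it is used
  only in the proofs below.\<close>

definition giso where
  "giso \<phi> H F i K G j \<longleftrightarrow> hiso \<phi> H K \<and> (`) \<phi> ` F = G \<and> \<phi> i = j"

lemma viso_giso: "viso (H, i) (K, j) \<longleftrightarrow> (\<exists>\<phi>. giso \<phi> H {} i K {} j)"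
  by (simp add: giso_def)

lemma eiso_giso: "eiso (H, e, i) (K, f, j) \<longleftrightarrow> (\<exists>\<phi>. giso \<phi> H {e} i K {f} j)"
  by (simp add: giso_def)

lemma giso_refl: "giso id H F i H F i"
  by (simp add: giso_def hiso_id)

lemma giso_comp:
  assumes "giso \<phi> H F i K G j" "giso \<psi> K G j L I k"
  shows "giso (\<psi> \<circ> \<phi>) H F i L I k"
proof -
  have "(`) (\<psi> \<circ> \<phi>) ` F = (`) \<psi> ` (`) \<phi> ` F"
    unfolding image_image[of "(`) \<psi>"] by (simp add: image_image comp_def)
  moreover have "hiso (\<psi> \<circ> \<phi>) H L" using assms by (intro hiso_comp[of \<phi> H K]) (auto simp: giso_def)
  ultimately show ?thesis using assms by (simp add: giso_def)
qed

lemma giso_inv: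
  assumes "giso \<phi> H F i K G j" "\<And>e. e \<in> edges H \<Longrightarrow> e \<subseteq> verts H" "i \<in> verts H"
    "\<And>e. e \<in> F \<Longrightarrow> e \<subseteq> verts H"
  shows "giso (inv_into (verts H) \<phi>) K G j H F i"
proof -
  have 1: "hiso \<phi> H K" "(`) \<phi> ` F = G" "\<phi> i = j" using assms(1) by (auto simp: giso_def)
  have 2: "hiso (inv_into (verts H) \<phi>) K H" "\<And>A. A \<subseteq> verts H \<Longrightarrow> inv_into (verts H) \<phi> ` \<phi> ` A = A"
    using hiso_inv[OF 1(1)] assms(2) by blast+
  have "(`) (inv_into (verts H) \<phi>) ` G = F"
    unfolding 1(2)[symmetric] by (rule image_image_cancel, rule 2(2), rule assms(4))
  moreover have "inv_into (verts H) \<phi> j = i"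
    unfolding 1(3)[symmetric] using 1(1) assms(3) by (intro inv_into_f_f) (auto simp: hiso_def bij_betw_def)
  ultimately show ?thesis unfolding giso_def using 2(1) by blast
qed

lemma hiso_hnbhd:
  assumes H: "hypergraph H" and K: "hypergraph K" and i: "i \<in> verts H" and j: "j \<in> verts K"
    and iso: "hiso \<phi> (hball H i m) (hball K j m)" and ij: "\<phi> i = j"
  shows "k \<le> m \<Longrightarrow> \<phi> ` hnbhd H i k = hnbhd K j k"
proof (induction k)
  case 0 then show ?case using ij hnbhd_0[OF i] hnbhd_0[OF j] by simp
next
  case (Suc k)
  then have IH: "\<phi> ` hnbhd H i k = hnbhd K j k" by simp
  interpret H: hypergraph H by fact
  interpret K: hypergraph K by fact
  have inj: "inj_on \<phi> (hnbhd H i m)" and im: "(`) \<phi> ` edges (hball H i m) = edges (hball K j m)"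
    using iso by (auto simp: hiso_def bij_betw_def)
  have sub: "hnbhd H i k \<subseteq> hnbhd H i m" using Suc by (intro hnbhd_mono) simp
  have 1: "e \<in> edges (hball H i m)" if "e \<in> edges H" "e \<inter> hnbhd H i k \<noteq> {}" for e
  proof -
    have "e \<subseteq> hnbhd H i (Suc k)" unfolding H.hnbhd_Suc[OF i] using that by blast
    then show ?thesis using that hnbhd_mono[OF Suc.prems, of H i] by auto
  qed
  have 2: "e \<in> edges (hball K j m)" if "e \<in> edges K" "e \<inter> hnbhd K j k \<noteq> {}" for e
  proof -
    have "e \<subseteq> hnbhd K j (Suc k)" unfolding K.hnbhd_Suc[OF j] using that by blast
    then show ?thesis using that hnbhd_mono[OF Suc.prems, of K j] by auto
  qed
  have meets: "\<phi> ` e \<inter> hnbhd K j k \<noteq> {} \<longleftrightarrow> e \<inter> hnbhd H i k \<noteq> {}" if "e \<subseteq> hnbhd H i m" for e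
  proof -
    have *: "\<phi> ` e \<inter> hnbhd K j k = \<phi> ` (e \<inter> hnbhd H i k)"
      unfolding IH[symmetric] by (rule inj_on_image_Int[OF inj that sub, symmetric])
    show ?thesis unfolding * image_is_empty ..
  qed
  have "(`) \<phi> ` {e \<in> edges H. e \<inter> hnbhd H i k \<noteq> {}} = {e \<in> edges K. e \<inter> hnbhd K j k \<noteq> {}}" (is "?A = ?B")
  proof (intro equalityI subsetI)
    fix f assume "f \<in> ?A"
    then obtain e where e: "f = \<phi> ` e" "e \<in> edges H" "e \<inter> hnbhd H i k \<noteq> {}" by auto
    have e1: "e \<in> edges (hball H i m)" using 1 e by blast
    then have "f \<in> edges (hball K j m)" using im e by blast
    moreover have "f \<inter> hnbhd K j k \<noteq> {}" unfolding e(1) using meets[of e] e1 e(3) by simp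
    ultimately show "f \<in> ?B" by simp
  next
    fix f assume f: "f \<in> ?B"
    then have "f \<in> edges (hball K j m)" using 2 by blast
    then obtain e where e: "f = \<phi> ` e" "e \<in> edges (hball H i m)" unfolding im[symmetric] by blast
    then have "e \<inter> hnbhd H i k \<noteq> {}" using meets[of e] f by simp
    then show "f \<in> ?A" using e by auto
  qed
  then have "\<phi> ` \<Union>{e \<in> edges H. e \<inter> hnbhd H i k \<noteq> {}} = \<Union>{e \<in> edges K. e \<inter> hnbhd K j k \<noteq> {}}"
    by (simp add: image_Union)
  then show ?case
    unfolding H.hnbhd_Suc[OF i] K.hnbhd_Suc[OF j] image_Un IH by simp
qed

lemma hiso_hball_mono:
  assumes H: "hypergraph H" and K: "hypergraph K" and i: "i \<in> verts H" and j: "j \<in> verts K"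
    and iso: "hiso \<phi> (hball H i m) (hball K j m)" and ij: "\<phi> i = j" and km: "k \<le> m"
  shows "hiso \<phi> (hball H i k) (hball K j k)"
proof (rule hisoI)
  have inj: "inj_on \<phi> (hnbhd H i m)" and im: "(`) \<phi> ` edges (hball H i m) = edges (hball K j m)"
    using iso by (auto simp: hiso_def bij_betw_def)
  note img = hiso_hnbhd[OF H K i j iso ij km]
  note subH = hnbhd_mono[OF km, of H i] and subK = hnbhd_mono[OF km, of K j]
  show "bij_betw \<phi> (verts (hball H i k)) (verts (hball K j k))"
    using img inj_on_subset[OF inj subH] by (simp add: bij_betw_def)
  show "(`) \<phi> ` edges (hball H i k) = edges (hball K j k)" (is "?A = ?B")
  proof (intro equalityI subsetI)
    fix f assume "f \<in> ?A"
    then obtain e where e: "f = \<phi> ` e" "e \<in> edges H" "e \<subseteq> hnbhd H i k" by auto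
    then have "e \<in> edges (hball H i m)" using subH by auto
    then have "f \<in> edges (hball K j m)" using im e by blast
    then show "f \<in> ?B" using e img by auto
  next
    fix f assume f: "f \<in> ?B"
    then have "f \<in> edges (hball K j m)" using subK by auto
    then obtain e where e: "f = \<phi> ` e" "e \<in> edges (hball H i m)" unfolding im[symmetric] by blast
    have "\<phi> ` e \<subseteq> \<phi> ` hnbhd H i k" using f e img by simp
    then have "e \<subseteq> hnbhd H i k" using inj_on_image_subset_iff[OF inj _ subH, of e] e by simp
    then show "f \<in> ?A" using e by auto
  qed
qed simp

lemma giso_hball_mono:
  assumes "hypergraph H" "hypergraph K" "i \<in> verts H" "j \<in> verts K"
    "giso \<phi> (hball H i m) F i (hball K j m) G j" "k \<le> m"
  shows "giso \<phi> (hball H i k) F i (hball K j k) G j"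
  using assms hiso_hball_mono[of H K i j \<phi> m k] by (simp add: giso_def)

lemma hiso_hpath:
  assumes "hiso \<phi> H K" "hpath H n i j" shows "hpath K n (\<phi> i) (\<phi> j)"
  using assms(2)
proof (induction n arbitrary: j)
  case 0 then show ?case using assms(1) by (auto simp: hpath_0 hiso_def bij_betw_def)
next
  case (Suc n)
  then obtain k e where "hpath H n i k" "e \<in> edges H" "k \<in> e" "j \<in> e" by (auto simp: hpath_Suc)
  moreover from this have "\<phi> ` e \<in> edges K" using assms(1) by (auto simp: hiso_def bij_betw_def)
  ultimately show ?case unfolding hpath_Suc using Suc.IH[of k] by blast
qed

lemma hiso_imp_hiso_hball:
  assumes H: "hypergraph H" and iso: "hiso \<phi> H K" and i: "i \<in> verts H"
  shows "hiso \<phi> (hball H i m) (hball K (\<phi> i) m)"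
proof (rule hisoI)
  interpret H: hypergraph H by fact
  have b: "bij_betw \<phi> (verts H) (verts K)" and e: "(`) \<phi> ` edges H = edges K"
    using iso by (auto simp: hiso_def bij_betw_def)
  have inj: "inj_on \<phi> (verts H)" using b by (simp add: bij_betw_def)
  have inviso: "hiso (inv_into (verts H) \<phi>) K H"
    using hiso_inv(1)[OF iso] H.edge_subset by blast
  have path: "hpath K n (\<phi> i) (\<phi> j) \<longleftrightarrow> hpath H n i j" if "j \<in> verts H" for n j
    using hiso_hpath[OF iso, of n i j] hiso_hpath[OF inviso, of n "\<phi> i" "\<phi> j"]
    unfolding inv_into_f_f[OF inj i] inv_into_f_f[OF inj that] by blast
  have d: "hdist K (\<phi> i) (\<phi> j) = hdist H i j" if "j \<in> verts H" for j
    by (simp only: hdist_def path[OF that])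
  have img: "\<phi> ` hnbhd H i m = hnbhd K (\<phi> i) m"
  proof (intro equalityI subsetI)
    fix y assume "y \<in> hnbhd K (\<phi> i) m"
    then have y: "y \<in> verts K" "hdist K (\<phi> i) y \<le> enat m" by (auto simp: hnbhd_def)
    then obtain x where x: "x \<in> verts H" "y = \<phi> x" using b by (auto simp: bij_betw_def)
    then have "x \<in> hnbhd H i m" using y d[of x] by (simp add: hnbhd_def)
    then show "y \<in> \<phi> ` hnbhd H i m" using x by blast
  next
    fix y assume "y \<in> \<phi> ` hnbhd H i m"
    then obtain x where x: "x \<in> verts H" "hdist H i x \<le> enat m" "y = \<phi> x" by (auto simp: hnbhd_def)
    then show "y \<in> hnbhd K (\<phi> i) m" using d[of x] b by (auto simp: hnbhd_def bij_betw_def)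
  qed
  have sub: "hnbhd H i m \<subseteq> verts H" by (rule hnbhd_subset)
  show "bij_betw \<phi> (verts (hball H i m)) (verts (hball K (\<phi> i) m))"
    using img inj_on_subset[OF inj sub] by (simp add: bij_betw_def)
  have "f \<subseteq> hnbhd H i m \<longleftrightarrow> \<phi> ` f \<subseteq> hnbhd K (\<phi> i) m" if "f \<in> edges H" for f
    unfolding img[symmetric] using inj_on_image_subset_iff[OF inj _ sub, of f] H.edge_subset[OF that] by simp
  then have "{e \<in> (`) \<phi> ` edges H. e \<subseteq> hnbhd K (\<phi> i) m} = (`) \<phi> ` {e \<in> edges H. e \<subseteq> hnbhd H i m}"
    by blast
  then show "(`) \<phi> ` edges (hball H i m) = edges (hball K (\<phi> i) m)"
    unfolding edges_hball e[symmetric] by (rule sym)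
qed simp

lemma giso_imp_giso_hball:
  assumes "hypergraph H" "giso \<phi> H F i K G j" "i \<in> verts H"
  shows "giso \<phi> (hball H i m) F i (hball K j m) G j"
  using assms hiso_imp_hiso_hball[of H \<phi> K i m] by (auto simp: giso_def)

lemma hconnected_hnbhd:
  assumes "hconnected H" "i \<in> verts H"
  shows "verts H = (\<Union>m. hnbhd H i m)"
proof (intro equalityI subsetI)
  fix j assume j: "j \<in> verts H"
  then obtain n where "hpath H n i j" using assms by (auto simp: hconnected_def)
  then have "j \<in> hnbhd H i n" using j by (auto simp: hnbhd_iff)
  then show "j \<in> (\<Union>m. hnbhd H i m)" by blast
qed (auto simp: hnbhd_def)

text \<open>A compactness argument: isomorphisms of all finite balls yield a global isomorphism.\<close>

lemma giso_compactness:
  assumes H: "hypergraph H" "hconnected H" "i \<in> verts H" and K: "hypergraph K" "hconnected K" "j \<in> verts K"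
    and F: "\<And>e. e \<in> F \<Longrightarrow> e \<subseteq> hnbhd H i 1"
    and iso: "\<And>m. m \<ge> 1 \<Longrightarrow> \<exists>\<phi>. giso \<phi> (hball H i m) F i (hball K j m) G j"
  shows "\<exists>\<phi>. giso \<phi> H F i K G j"
proof -
  interpret H: hypergraph H by fact
  interpret K: hypergraph K by fact
  define \<Phi> where "\<Phi> m = (SOME \<phi>. giso \<phi> (hball H i (Suc m)) F i (hball K j (Suc m)) G j)" for m
  have \<Phi>: "giso (\<Phi> m) (hball H i (Suc m)) F i (hball K j (Suc m)) G j" for m
    using someI_ex[OF iso[of "Suc m"]] by (simp add: \<Phi>_def)
  let ?S = "hnbhd H i" and ?T = "hnbhd K j"
  define R where "R k m = restrict (\<Phi> m) (?S k)" for k m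
  have fin: "finite (R k ` A)" if "\<And>m. m \<in> A \<Longrightarrow> k \<le> Suc m" for k A
  proof (rule finite_subset)
    show "R k ` A \<subseteq> ?S k \<rightarrow>\<^sub>E ?T k"
    proof
      fix g assume "g \<in> R k ` A"
      then obtain m where m: "g = R k m" "m \<in> A" by blast
      have "hiso (\<Phi> m) (hball H i (Suc m)) (hball K j (Suc m))" "\<Phi> m i = j"
        using \<Phi>[of m] unfolding giso_def by blast+
      then have "\<Phi> m ` ?S k = ?T k"
        using hiso_hnbhd[OF H(1) K(1) H(3) K(3)] that[OF m(2)] by blast
      then show "g \<in> ?S k \<rightarrow>\<^sub>E ?T k" unfolding m(1) R_def unfolding restrict_PiE_iff by blast
    qed
    show "finite (?S k \<rightarrow>\<^sub>E ?T k)"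
      by (intro finite_PiE H.finite_hnbhd K.finite_hnbhd H K)
  qed
  have "\<exists>\<psi>. \<forall>k. infinite {m. k \<le> m \<and> R k m = \<psi> k} \<and> restrict (\<psi> (Suc k)) (?S k) = \<psi> k"
  proof (rule dependent_nat_choice)
    have "infinite {m. (0::nat) \<le> m}" by (simp add: infinite_nat_iff_unbounded)
    then obtain a where "a \<in> {m. 0 \<le> m}" "infinite {m \<in> {m. 0 \<le> m}. R 0 m = R 0 a}"
      using pigeonhole_infinite[of "{m. (0::nat) \<le> m}" "R 0"] fin[of "{m. 0 \<le> m}" 0] by auto
    then show "\<exists>x. infinite {m. 0 \<le> m \<and> R 0 m = x}" by auto
  next
    fix x k assume inf: "infinite {m. k \<le> m \<and> R k m = x}"
    have "{m. k \<le> m \<and> R k m = x} \<subseteq> insert k {m. Suc k \<le> m \<and> R k m = x}" by (auto simp: Suc_le_eq)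
    then have "infinite {m. Suc k \<le> m \<and> R k m = x}" (is "infinite ?A")
      using inf by (meson finite.insertI finite_subset)
    then obtain a where a: "a \<in> ?A" "infinite {m \<in> ?A. R (Suc k) m = R (Suc k) a}"
      using pigeonhole_infinite[of ?A "R (Suc k)"] fin[of ?A "Suc k"] by auto
    have "infinite {m. Suc k \<le> m \<and> R (Suc k) m = R (Suc k) a}"
      by (rule infinite_super[OF _ a(2)]) auto
    moreover have "restrict (R (Suc k) a) (?S k) = x"
    proof -
      have "?S (Suc k) \<inter> ?S k = ?S k" using hnbhd_mono[of k "Suc k" H i] by auto
      then have "restrict (R (Suc k) a) (?S k) = R k a" by (simp add: R_def restrict_restrict)
      with a show ?thesis by simp
    qed
    ultimately show "\<exists>y. infinite {m. Suc k \<le> m \<and> R (Suc k) m = y} \<and> restrict y (?S k) = x" by blast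
  qed
  then obtain \<psi> where \<psi>: "\<And>k. infinite {m. k \<le> m \<and> R k m = \<psi> k}"
    and ext: "\<And>k. restrict (\<psi> (Suc k)) (?S k) = \<psi> k" by blast
  define d where "d x = (LEAST k. x \<in> ?S k)" for x
  define \<phi> where "\<phi> x = \<psi> (d x) x" for x
  have step: "x \<in> ?S k \<Longrightarrow> \<psi> (k + l) x = \<psi> k x" for x k l
  proof (induction l)
    case (Suc l)
    then have "x \<in> ?S (k + l)" using hnbhd_mono[of k "k + l" H i] by auto
    then have "\<psi> (Suc (k + l)) x = \<psi> (k + l) x" using ext[of "k + l"] by (metis restrict_apply')
    then show ?case using Suc by simp
  qed simp
  have \<phi>: "\<phi> x = \<psi> k x" if "x \<in> ?S k" for x k
  proof -
    have "x \<in> ?S (d x)" "d x \<le> k" unfolding d_def using that by (rule LeastI, rule Least_le)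
    then show ?thesis unfolding \<phi>_def using step[of x "d x" "k - d x"] by simp
  qed
  have rep: "\<exists>m\<ge>k. \<forall>x\<in>?S k. \<phi> x = \<Phi> m x" for k
  proof -
    obtain m where "k \<le> m" "R k m = \<psi> k" using \<psi>[of k] not_finite_existsD by auto
    then show ?thesis using \<phi> by (metis R_def restrict_apply')
  qed
  have loc: "inj_on \<phi> (?S k)" "\<phi> ` ?S k = ?T k"
    "(`) \<phi> ` edges (hball H i k) = edges (hball K j k)" for k
  proof -
    obtain m where m: "k \<le> m" "\<And>x. x \<in> ?S k \<Longrightarrow> \<phi> x = \<Phi> m x" using rep by blast
    have h: "hiso (\<Phi> m) (hball H i k) (hball K j k)"
      using hiso_hball_mono[of H K i j "\<Phi> m" "Suc m" k] \<Phi>[of m] H K m by (simp add: giso_def)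
    have "\<phi> ` e = \<Phi> m ` e" if "e \<subseteq> ?S k" for e using m that by (intro image_cong) auto
    then have "(`) \<phi> ` edges (hball H i k) = (`) (\<Phi> m) ` edges (hball H i k)"
      by (rule image_cong[OF refl]) simp
    then show "(`) \<phi> ` edges (hball H i k) = edges (hball K j k)"
      using h by (simp add: hiso_def bij_betw_def)
    show "inj_on \<phi> (?S k)" using h inj_on_cong[of "?S k" \<phi> "\<Phi> m"] m by (simp add: hiso_def bij_betw_def)
    show "\<phi> ` ?S k = ?T k" using h m by (simp add: hiso_def bij_betw_def)
  qed
  have VH: "verts H = (\<Union>m. ?S m)" and VK: "verts K = (\<Union>m. ?T m)"
    by (rule hconnected_hnbhd[OF H(2,3)], rule hconnected_hnbhd[OF K(2,3)])
  have cover: "\<exists>k. A \<subseteq> hnbhd L l k" if "finite A" "A \<subseteq> (\<Union>m. hnbhd L l m)"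
    for A :: "'c set" and L l
    using that
  proof (induction A)
    case (insert x A)
    then obtain k1 where k1: "A \<subseteq> hnbhd L l k1" by blast
    from insert obtain k2 where k2: "x \<in> hnbhd L l k2" by blast
    have "hnbhd L l k1 \<subseteq> hnbhd L l (max k1 k2)" "hnbhd L l k2 \<subseteq> hnbhd L l (max k1 k2)"
      by (intro hnbhd_mono; simp)+
    with k1 k2 have "insert x A \<subseteq> hnbhd L l (max k1 k2)" by blast
    then show ?case ..
  qed simp
  have "hiso \<phi> H K"
  proof (rule hisoI)
    have "inj_on \<phi> (verts H)"
    proof (rule inj_onI)
      fix x y assume xy: "x \<in> verts H" "y \<in> verts H" "\<phi> x = \<phi> y"
      then obtain k where "{x, y} \<subseteq> ?S k" using cover[of "{x, y}" H i, folded VH] by auto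
      then show "x = y" using loc(1)[of k] xy(3) by (auto dest: inj_onD)
    qed
    moreover have "\<phi> ` verts H = verts K" unfolding VH VK image_UN loc(2) ..
    ultimately show "bij_betw \<phi> (verts H) (verts K)" by (simp add: bij_betw_def)
    show "(`) \<phi> ` edges H = edges K"
    proof (intro equalityI subsetI)
      fix f assume "f \<in> (`) \<phi> ` edges H"
      then obtain e where e: "f = \<phi> ` e" "e \<in> edges H" by auto
      then obtain k where "e \<subseteq> ?S k"
        using cover[OF H.edge_finite, of e H i, folded VH] H.edge_subset[of e] by blast
      then have "e \<in> edges (hball H i k)" using e by simp
      then have "f \<in> (`) \<phi> ` edges (hball H i k)" unfolding e(1) by (rule imageI)
      then show "f \<in> edges K" unfolding loc(3) by simp
    next
      fix f assume f: "f \<in> edges K"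
      then obtain k where "f \<subseteq> ?T k"
        using cover[OF K.edge_finite, of f K j, folded VK] K.edge_subset[of f] by blast
      then have "f \<in> edges (hball K j k)" using f by simp
      then have "f \<in> (`) \<phi> ` edges (hball H i k)" by (simp only: loc(3))
      then show "f \<in> (`) \<phi> ` edges H" unfolding edges_hball by blast
    qed
  qed (use H.edge_subset in blast)
  moreover have "(`) \<phi> ` F = G"
  proof -
    obtain m where m: "\<And>x. x \<in> ?S 1 \<Longrightarrow> \<phi> x = \<Phi> m x" using rep by blast
    have "\<phi> ` e = \<Phi> m ` e" if "e \<in> F" for e using m F[OF that] by (intro image_cong) auto
    then have "(`) \<phi> ` F = (`) (\<Phi> m) ` F" by (rule image_cong[OF refl])
    then show ?thesis using \<Phi>[of m] by (simp add: giso_def)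
  qed
  moreover have "\<phi> i = j"
  proof -
    obtain m where m: "\<And>x. x \<in> ?S 1 \<Longrightarrow> \<phi> x = \<Phi> m x" using rep by blast
    have "i \<in> ?S 1" using hnbhd_0[OF H(3)] hnbhd_mono[of 0 1 H i] by auto
    then show ?thesis using m[of i] \<Phi>[of m] by (simp add: giso_def)
  qed
  ultimately show ?thesis by (auto simp: giso_def)
qed


section \<open>The spaces of rooted hypergraphs\<close>

lemma verts_hmap [simp]: "verts (hmap \<phi> H) = \<phi> ` verts H"
  and edges_hmap [simp]: "edges (hmap \<phi> H) = (`) \<phi> ` edges H"
  by (simp_all add: hmap_def)

lemma hiso_hmap:
  assumes "hypergraph H" "inj_on \<phi> (verts H)" shows "hiso \<phi> H (hmap \<phi> H)"
  by (rule hisoI) (use assms hypergraph.edge_subset[OF assms(1)] in \<open>auto simp: bij_betw_def\<close>)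

lemma hypergraph_hiso:
  assumes "hypergraph H" "hiso \<phi> H K" shows "hypergraph K"
proof -
  interpret H: hypergraph H by fact
  have b: "bij_betw \<phi> (verts H) (verts K)" and e: "edges K = (`) \<phi> ` edges H"
    using assms by (auto simp: hiso_def bij_betw_def)
  have inj: "inj_on \<phi> (verts H)" and V: "verts K = \<phi> ` verts H" using b by (auto simp: bij_betw_def)
  show ?thesis
  proof
    show "countable (verts K)" unfolding V by (intro countable_image H.countable_verts)
    show "f \<subseteq> verts K" "finite f" "f \<noteq> {}" if "f \<in> edges K" for f
    proof -
      from that obtain e where "e \<in> edges H" "f = \<phi> ` e" unfolding e by blast
      then show "f \<subseteq> verts K" "finite f" "f \<noteq> {}"
        using H.edge_subset[of e] H.edge_finite[of e] H.edge_nonempty[of e] V by auto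
    qed
    fix j assume "j \<in> verts K"
    then obtain i where i: "i \<in> verts H" "j = \<phi> i" unfolding V by blast
    have "{f \<in> edges K. j \<in> f} \<subseteq> (`) \<phi> ` {e \<in> edges H. i \<in> e}"
    proof
      fix f assume "f \<in> {f \<in> edges K. j \<in> f}"
      then obtain e where e: "e \<in> edges H" "f = \<phi> ` e" "\<phi> i \<in> \<phi> ` e" unfolding e i(2) by blast
      then have "i \<in> e" using inj_on_image_mem_iff[OF inj i(1) H.edge_subset[OF e(1)]] by blast
      with e show "f \<in> (`) \<phi> ` {e \<in> edges H. i \<in> e}" by blast
    qed
    then show "finite {f \<in> edges K. j \<in> f}"
      by (rule finite_subset) (intro finite_imageI H.locally_finite i)
  qed
qed

lemma hconnected_hiso:
  assumes "hconnected H" "hiso \<phi> H K" shows "hconnected K"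
  unfolding hconnected_def
proof (intro ballI)
  have V: "verts K = \<phi> ` verts H" using assms by (auto simp: hiso_def bij_betw_def)
  fix i j assume "i \<in> verts K" "j \<in> verts K"
  then obtain i' j' where ij: "i' \<in> verts H" "j' \<in> verts H" "i = \<phi> i'" "j = \<phi> j'" unfolding V by blast
  then obtain n where "hpath H n i' j'" using assms(1) unfolding hconnected_def by blast
  then show "\<exists>n. hpath K n i j" unfolding ij using hiso_hpath[OF assms(2)] by blast
qed

text \<open>Again a common form of both kinds of rooted hypergraphs, used only in proofs.\<close>

definition grooted where
  "grooted H F i \<longleftrightarrow> hypergraph H \<and> hconnected H \<and> i \<in> verts H \<and> (\<forall>e\<in>F. e \<subseteq> hnbhd H i 1)"

definition geq where
  "geq m H F i K G j \<longleftrightarrow> (\<exists>\<phi>. giso \<phi> (hball H i m) F i (hball K j m) G j)"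

lemma vrooted_grooted: "vrooted (H, i) \<longleftrightarrow> grooted H {} i"
  by (simp add: grooted_def)

lemma erooted_grooted: "erooted (H, e, i) \<Longrightarrow> grooted H {e} i"
  using hypergraph.edge_subset_hnbhd_1[of H e i 1] hnbhd_subset[of H i 1] by (auto simp: grooted_def)

lemma geq_veq: "veq m (H, i) (K, j) \<longleftrightarrow> geq m H {} i K {} j"
  unfolding geq_def veq.simps viso_giso ..

lemma geq_eeq: "eeq m (H, e, i) (K, f, j) \<longleftrightarrow> geq m H {e} i K {f} j"
  unfolding geq_def eeq.simps eiso_giso ..

lemma geq_refl: "geq m H F i H F i"
  unfolding geq_def by (rule exI, rule giso_refl)

lemma geq_trans: "geq m H F i K G j \<Longrightarrow> geq m K G j L I k \<Longrightarrow> geq m H F i L I k"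
  unfolding geq_def by (meson giso_comp)

lemma geq_sym:
  assumes "grooted H F i" "1 \<le> m" "geq m H F i K G j" shows "geq m K G j H F i"
proof -
  have i: "i \<in> verts H" and F: "\<And>e. e \<in> F \<Longrightarrow> e \<subseteq> hnbhd H i 1"
    using assms(1) unfolding grooted_def by blast+
  have "i \<in> hnbhd H i m" using hnbhd_0[OF i] hnbhd_mono[of 0 m H i] by simp
  moreover have "e \<subseteq> hnbhd H i m" if "e \<in> F" for e using F[OF that] hnbhd_mono[OF assms(2), of H i] by simp
  moreover obtain \<phi> where "giso \<phi> (hball H i m) F i (hball K j m) G j" using assms(3) unfolding geq_def by blast
  ultimately have "giso (inv_into (verts (hball H i m)) \<phi>) (hball K j m) G j (hball H i m) F i"
    by (intro giso_inv) auto
  then show ?thesis unfolding geq_def by blast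
qed

lemma geq_mono:
  assumes "grooted H F i" "grooted K G j" "geq m H F i K G j" "k \<le> m" shows "geq k H F i K G j"
  using assms giso_hball_mono[of H K i j _ m F G k] unfolding geq_def grooted_def by blast

lemma giso_geq:
  assumes "grooted H F i" "giso \<phi> H F i K G j" shows "geq m H F i K G j"
  using assms giso_imp_giso_hball[of H \<phi> F i K G j m] unfolding geq_def grooted_def by blast

lemma geq_all:
  assumes "grooted H F i" "grooted K G j" "\<And>m. m \<ge> 1 \<Longrightarrow> geq m H F i K G j"
  shows "\<exists>\<phi>. giso \<phi> H F i K G j"
proof (rule giso_compactness)
  show "hypergraph H" "hconnected H" "i \<in> verts H" "hypergraph K" "hconnected K" "j \<in> verts K"
    using assms(1,2) unfolding grooted_def by blast+
  show "e \<subseteq> hnbhd H i 1" if "e \<in> F" for e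
    using assms(1) that unfolding grooted_def by blast
  show "\<exists>\<phi>. giso \<phi> (hball H i m) F i (hball K j m) G j" if "m \<ge> 1" for m
    using assms(3)[OF that] unfolding geq_def .
qed

lemma giso_sym:
  assumes "grooted H F i" "giso \<phi> H F i K G j" shows "giso (inv_into (verts H) \<phi>) K G j H F i"
proof (rule giso_inv[OF assms(2)])
  have H: "hypergraph H" and F: "\<forall>e\<in>F. e \<subseteq> hnbhd H i 1" using assms(1) unfolding grooted_def by blast+
  show "i \<in> verts H" using assms(1) unfolding grooted_def by blast
  show "e \<subseteq> verts H" if "e \<in> edges H" for e using that by (rule hypergraph.edge_subset[OF H])
  show "e \<subseteq> verts H" if "e \<in> F" for e using that F hnbhd_subset[of H i 1] by blast
qed

lemma viso_sym:
  assumes "vrooted x" "viso x y" shows "viso y x"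
proof -
  obtain H i K j where xy: "x = (H, i)" "y = (K, j)" by (cases x, cases y)
  obtain \<phi> where "giso \<phi> H {} i K {} j" using assms(2) unfolding xy viso_giso by blast
  from giso_sym[OF _ this] assms(1) show ?thesis unfolding xy viso_giso vrooted_grooted by blast
qed

lemma eiso_sym:
  assumes "erooted x" "eiso x y" shows "eiso y x"
proof -
  obtain H e i K f j where xy: "x = (H, e, i)" "y = (K, f, j)" by (cases x, cases y)
  obtain \<phi> where "giso \<phi> H {e} i K {f} j" using assms(2) unfolding xy eiso_giso by blast
  from giso_sym[OF erooted_grooted[OF assms(1)[unfolded xy]] this] show ?thesis unfolding xy eiso_giso by blast
qed

lemma viso_trans:
  assumes "viso x y" "viso y z" shows "viso x z"
proof -
  obtain H i K j L k where xyz: "x = (H, i)" "y = (K, j)" "z = (L, k)" by (cases x, cases y, cases z)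
  obtain \<phi> \<psi> where "giso \<phi> H {} i K {} j" "giso \<psi> K {} j L {} k"
    using assms unfolding xyz viso_giso by blast
  from giso_comp[OF this] show ?thesis unfolding xyz viso_giso by blast
qed

lemma eiso_trans:
  assumes "eiso x y" "eiso y z" shows "eiso x z"
proof -
  obtain H e i K f j L g k where xyz: "x = (H, e, i)" "y = (K, f, j)" "z = (L, g, k)"
    by (cases x, cases y, cases z)
  obtain \<phi> \<psi> where "giso \<phi> H {e} i K {f} j" "giso \<psi> K {f} j L {g} k"
    using assms unfolding xyz eiso_giso by blast
  from giso_comp[OF this] show ?thesis unfolding xyz eiso_giso by blast
qed

definition vrel :: "nat pre_hypergraph \<times> nat \<Rightarrow> nat pre_hypergraph \<times> nat \<Rightarrow> bool" where
  "vrel x y \<longleftrightarrow> vrooted x \<and> vrooted y \<and> viso x y"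

definition erel :: "nat pre_hypergraph \<times> nat set \<times> nat \<Rightarrow> nat pre_hypergraph \<times> nat set \<times> nat \<Rightarrow> bool" where
  "erel x y \<longleftrightarrow> erooted x \<and> erooted y \<and> eiso x y"

lemma part_equivp_vrel: "part_equivp vrel"
proof (rule part_equivpI)
  define H :: "nat pre_hypergraph" where "H = \<lparr>verts = {0}, edges = {}\<rparr>"
  have "hypergraph H" by standard (auto simp: H_def)
  moreover have "hconnected H" using hpath_0[of H 0 0] by (auto simp: hconnected_def H_def)
  ultimately have "vrooted (H, 0)" by (simp add: H_def)
  moreover have "viso (H, 0) (H, 0)" unfolding viso_giso by (rule exI, rule giso_refl)
  ultimately show "\<exists>x. vrel x x" unfolding vrel_def by blast
  show "symp vrel" by (rule sympI, unfold vrel_def) (blast intro: viso_sym)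
  show "transp vrel" by (rule transpI, unfold vrel_def) (blast intro: viso_trans)
qed

lemma part_equivp_erel: "part_equivp erel"
proof (rule part_equivpI)
  define H :: "nat pre_hypergraph" where "H = \<lparr>verts = {0}, edges = {{0}}\<rparr>"
  have "hypergraph H" by standard (auto simp: H_def)
  moreover have "hconnected H" using hpath_0[of H 0 0] by (auto simp: hconnected_def H_def)
  ultimately have "erooted (H, {0}, 0)" by (simp add: H_def)
  moreover have "eiso (H, {0}, 0) (H, {0}, 0)" unfolding eiso_giso by (rule exI, rule giso_refl)
  ultimately show "\<exists>x. erel x x" unfolding erel_def by blast
  show "symp erel" by (rule sympI, unfold erel_def) (blast intro: eiso_sym)
  show "transp erel" by (rule transpI, unfold erel_def) (blast intro: eiso_trans)
qed

text \<open>
  \<open>\<H>\<^sub>*\<close> and \<open>\<H>\<^sub>*\<^sub>*\<close>. As vertex sets are countable, every isomorphism class has representatives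
  whose vertices are natural numbers.
\<close>

quotient_type hstar = "nat pre_hypergraph \<times> nat" / partial: vrel
  by (rule part_equivp_vrel)

quotient_type hsstar = "nat pre_hypergraph \<times> nat set \<times> nat" / partial: erel
  by (rule part_equivp_erel)

text \<open>The classes \<open>[H, i]\<close> and \<open>[H, e, i]\<close>, for an arbitrary type of vertices; by \<open>vclass_eq_iff\<close> and
  \<open>eclass_eq_iff\<close> two classes are equal iff the rooted hypergraphs are isomorphic.\<close>

definition vclass :: "'v pre_hypergraph \<Rightarrow> 'v \<Rightarrow> hstar" where
  "vclass H i = (let \<phi> = to_nat_on (verts H) in abs_hstar (hmap \<phi> H, \<phi> i))"

definition eclass :: "'v pre_hypergraph \<Rightarrow> 'v set \<Rightarrow> 'v \<Rightarrow> hsstar" where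
  "eclass H e i = (let \<phi> = to_nat_on (verts H) in abs_hsstar (hmap \<phi> H, \<phi> ` e, \<phi> i))"

lemma vrooted_hiso:
  assumes "vrooted (H, i)" "hiso \<phi> H K" shows "vrooted (K, \<phi> i)"
  using assms hypergraph_hiso[OF _ assms(2)] hconnected_hiso[OF _ assms(2)]
  by (auto simp: hiso_def bij_betw_def)

lemma erooted_hiso:
  assumes "erooted (H, e, i)" "hiso \<phi> H K" shows "erooted (K, \<phi> ` e, \<phi> i)"
  using assms hypergraph_hiso[OF _ assms(2)] hconnected_hiso[OF _ assms(2)]
  by (auto simp: hiso_def bij_betw_def)

lemma vrooted_rep: "vrooted (rep_hstar x)"
  using Quotient_rep_reflp[OF Quotient_hstar, of x] by (simp add: vrel_def)

lemma erooted_rep: "erooted (rep_hsstar x)"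
  using Quotient_rep_reflp[OF Quotient_hsstar, of x] by (simp add: erel_def)

lemma hiso_to_nat_on:
  assumes "hypergraph H" shows "hiso (to_nat_on (verts H)) H (hmap (to_nat_on (verts H)) H)"
  using assms hypergraph.countable_verts[OF assms] by (intro hiso_hmap inj_on_to_nat_on)

lemma rep_vclass:
  assumes "vrooted (H, i)" shows "viso (H, i) (rep_hstar (vclass H i))"
proof -
  let ?\<phi> = "to_nat_on (verts H)" and ?x = "rep_hstar (vclass H i)"
  have h: "hiso ?\<phi> H (hmap ?\<phi> H)" using assms by (intro hiso_to_nat_on) simp
  have r: "vrooted (hmap ?\<phi> H, ?\<phi> i)" by (rule vrooted_hiso[OF assms h])
  have 1: "giso ?\<phi> H {} i (hmap ?\<phi> H) {} (?\<phi> i)" using h by (simp add: giso_def)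
  have "viso (hmap ?\<phi> H, ?\<phi> i) (hmap ?\<phi> H, ?\<phi> i)" unfolding viso_giso by (rule exI, rule giso_refl)
  then have "vrel (hmap ?\<phi> H, ?\<phi> i) (hmap ?\<phi> H, ?\<phi> i)" using r unfolding vrel_def by blast
  then have "vrel ?x (hmap ?\<phi> H, ?\<phi> i)"
    unfolding vclass_def Let_def by (rule Quotient_rep_abs[OF Quotient_hstar])
  then have "vrel (hmap ?\<phi> H, ?\<phi> i) ?x" using part_equivp_symp[OF part_equivp_vrel] by blast
  then obtain K j where x: "?x = (K, j)" and "viso (hmap ?\<phi> H, ?\<phi> i) (K, j)"
    by (cases ?x) (auto simp: vrel_def)
  then obtain \<psi> where 2: "giso \<psi> (hmap ?\<phi> H) {} (?\<phi> i) K {} j" unfolding viso_giso by blast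
  show ?thesis unfolding x viso_giso by (rule exI, rule giso_comp[OF 1 2])
qed

lemma rep_eclass:
  assumes "erooted (H, e, i)" shows "eiso (H, e, i) (rep_hsstar (eclass H e i))"
proof -
  let ?\<phi> = "to_nat_on (verts H)" and ?x = "rep_hsstar (eclass H e i)"
  have h: "hiso ?\<phi> H (hmap ?\<phi> H)" using assms by (intro hiso_to_nat_on) simp
  have r: "erooted (hmap ?\<phi> H, ?\<phi> ` e, ?\<phi> i)" by (rule erooted_hiso[OF assms h])
  have 1: "giso ?\<phi> H {e} i (hmap ?\<phi> H) {?\<phi> ` e} (?\<phi> i)" using h by (simp add: giso_def)
  have "eiso (hmap ?\<phi> H, ?\<phi> ` e, ?\<phi> i) (hmap ?\<phi> H, ?\<phi> ` e, ?\<phi> i)" unfolding eiso_giso by (rule exI, rule giso_refl)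
  then have "erel (hmap ?\<phi> H, ?\<phi> ` e, ?\<phi> i) (hmap ?\<phi> H, ?\<phi> ` e, ?\<phi> i)" using r unfolding erel_def by blast
  then have "erel ?x (hmap ?\<phi> H, ?\<phi> ` e, ?\<phi> i)"
    unfolding eclass_def Let_def by (rule Quotient_rep_abs[OF Quotient_hsstar])
  then have "erel (hmap ?\<phi> H, ?\<phi> ` e, ?\<phi> i) ?x" using part_equivp_symp[OF part_equivp_erel] by blast
  then obtain K f j where x: "?x = (K, f, j)" and "eiso (hmap ?\<phi> H, ?\<phi> ` e, ?\<phi> i) (K, f, j)"
    by (cases ?x) (auto simp: erel_def)
  then obtain \<psi> where 2: "giso \<psi> (hmap ?\<phi> H) {?\<phi> ` e} (?\<phi> i) K {f} j" unfolding eiso_giso by blast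
  show ?thesis unfolding x eiso_giso by (rule exI, rule giso_comp[OF 1 2])
qed

lemma hstar_eqI: "viso (rep_hstar x) (rep_hstar y) \<Longrightarrow> x = y"
  using Quotient_rel_rep[OF Quotient_hstar, of x y] vrooted_rep[of x] vrooted_rep[of y]
  by (simp add: vrel_def)

lemma hsstar_eqI: "eiso (rep_hsstar x) (rep_hsstar y) \<Longrightarrow> x = y"
  using Quotient_rel_rep[OF Quotient_hsstar, of x y] erooted_rep[of x] erooted_rep[of y]
  by (simp add: erel_def)

lemma vclass_eq_iff:
  assumes "vrooted (H, i)" "vrooted (K, j)"
  shows "vclass H i = vclass K j \<longleftrightarrow> viso (H, i) (K, j)"
proof
  note 1 = rep_vclass[OF assms(1)] and 2 = rep_vclass[OF assms(2)]
  show "viso (H, i) (K, j)" if "vclass H i = vclass K j"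
    using viso_trans[OF 1[unfolded that] viso_sym[OF assms(2) 2]] .
  show "vclass H i = vclass K j" if "viso (H, i) (K, j)"
    by (rule hstar_eqI, rule viso_trans[OF viso_sym[OF assms(1) 1] viso_trans[OF that 2]])
qed

lemma eclass_eq_iff:
  assumes "erooted (H, e, i)" "erooted (K, f, j)"
  shows "eclass H e i = eclass K f j \<longleftrightarrow> eiso (H, e, i) (K, f, j)"
proof
  note 1 = rep_eclass[OF assms(1)] and 2 = rep_eclass[OF assms(2)]
  show "eiso (H, e, i) (K, f, j)" if "eclass H e i = eclass K f j"
    using eiso_trans[OF 1[unfolded that] eiso_sym[OF assms(2) 2]] .
  show "eclass H e i = eclass K f j" if "eiso (H, e, i) (K, f, j)"
    by (rule hsstar_eqI, rule eiso_trans[OF eiso_sym[OF assms(1) 1] eiso_trans[OF that 2]])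
qed

lemma vclass_rep: "rep_hstar x = (H, i) \<Longrightarrow> vclass H i = x"
  using rep_vclass[of H i] vrooted_rep[of x] hstar_eqI[of x "vclass H i"] by simp

lemma eclass_rep: "rep_hsstar x = (H, e, i) \<Longrightarrow> eclass H e i = x"
  using rep_eclass[of H e i] erooted_rep[of x] hsstar_eqI[of x "eclass H e i"] by simp


subsection \<open>The local metrics\<close>

text \<open>\<open>agree_dist P\<close> is \<open>1 / (1 + m\<^sup>*)\<close>, where \<open>m\<^sup>*\<close> is the supremum of all \<open>m \<ge> 1\<close> with \<open>P m\<close>.\<close>

definition agree_dist :: "(nat \<Rightarrow> bool) \<Rightarrow> real" where
  "agree_dist P = (case Sup {enat m | m. m \<ge> 1 \<and> P m} of enat k \<Rightarrow> 1 / (1 + real k) | \<infinity> \<Rightarrow> 0)"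

lemma agree_Sup_le:
  assumes "\<forall>k m. 1 \<le> k \<longrightarrow> k \<le> m \<longrightarrow> P m \<longrightarrow> P k"
  shows "enat n \<le> Sup {enat m | m. m \<ge> 1 \<and> P m} \<longleftrightarrow> (\<forall>m. 1 \<le> m \<and> m \<le> n \<longrightarrow> P m)"
proof
  let ?A = "{enat m | m. m \<ge> 1 \<and> P m}"
  assume n: "enat n \<le> Sup ?A"
  show "\<forall>m. 1 \<le> m \<and> m \<le> n \<longrightarrow> P m"
  proof (intro allI impI)
    fix m assume m: "1 \<le> m \<and> m \<le> n"
    then have "m - 1 < n" by linarith
    then have "enat (m - 1) < enat n" by simp
    with n have "enat (m - 1) < Sup ?A" by order
    then obtain l where "l \<ge> 1" "P l" "m - 1 < l" unfolding less_Sup_iff by auto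
    moreover from this m have "m \<le> l" by linarith
    ultimately show "P m" using assms m by blast
  qed
next
  assume *: "\<forall>m. 1 \<le> m \<and> m \<le> n \<longrightarrow> P m"
  show "enat n \<le> Sup {enat m | m. m \<ge> 1 \<and> P m}"
  proof (cases "n = 0")
    case True then show ?thesis by (simp add: enat_0)
  next
    case False
    then show ?thesis using * by (intro Sup_upper) auto
  qed
qed

lemma agree_dist_le:
  assumes "\<forall>k m. 1 \<le> k \<longrightarrow> k \<le> m \<longrightarrow> P m \<longrightarrow> P k"
  shows "agree_dist P \<le> 1 / (1 + real n) \<longleftrightarrow> (\<forall>m. 1 \<le> m \<and> m \<le> n \<longrightarrow> P m)"
  unfolding agree_Sup_le[of P n, OF assms, symmetric] agree_dist_def
  by (cases "Sup {enat m | m. m \<ge> 1 \<and> P m}") (auto simp: field_simps)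

lemma agree_dist_cases: "agree_dist P = 0 \<or> (\<exists>n. agree_dist P = 1 / (1 + real n))"
  unfolding agree_dist_def by (cases "Sup {enat m | m. m \<ge> 1 \<and> P m}") auto

lemma agree_dist_nonneg: "0 \<le> agree_dist P"
  using agree_dist_cases[of P] by auto

lemma agree_dist_eq_0:
  assumes "\<forall>k m. 1 \<le> k \<longrightarrow> k \<le> m \<longrightarrow> P m \<longrightarrow> P k"
  shows "agree_dist P = 0 \<longleftrightarrow> (\<forall>m\<ge>1. P m)"
proof
  assume 0: "agree_dist P = 0"
  show "\<forall>m\<ge>1. P m"
  proof (intro allI impI)
    fix m :: nat assume "m \<ge> 1"
    moreover have "agree_dist P \<le> 1 / (1 + real m)" unfolding 0 by simp
    ultimately show "P m" unfolding agree_dist_le[of P m, OF assms] by blast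
  qed
next
  assume *: "\<forall>m\<ge>1. P m"
  show "agree_dist P = 0"
  proof (rule ccontr)
    assume "agree_dist P \<noteq> 0"
    then obtain n where n: "agree_dist P = 1 / (1 + real n)" using agree_dist_cases by blast
    have "agree_dist P \<le> 1 / (1 + real (Suc n))" unfolding agree_dist_le[of P "Suc n", OF assms] using * by blast
    then show False unfolding n by (simp add: field_simps)
  qed
qed

lemma agree_dist_ultra:
  assumes P: "\<forall>k m. 1 \<le> k \<longrightarrow> k \<le> m \<longrightarrow> P m \<longrightarrow> P k"
    and Q: "\<forall>k m. 1 \<le> k \<longrightarrow> k \<le> m \<longrightarrow> Q m \<longrightarrow> Q k"
    and R: "\<forall>k m. 1 \<le> k \<longrightarrow> k \<le> m \<longrightarrow> R m \<longrightarrow> R k"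
    and QR: "\<And>m. 1 \<le> m \<Longrightarrow> Q m \<Longrightarrow> R m \<Longrightarrow> P m"
  shows "agree_dist P \<le> max (agree_dist Q) (agree_dist R)"
proof -
  have *: "agree_dist P \<le> 1 / (1 + real n)" if "max (agree_dist Q) (agree_dist R) \<le> 1 / (1 + real n)" for n
    using that QR unfolding max.bounded_iff agree_dist_le[of P n, OF P] agree_dist_le[of Q n, OF Q]
      agree_dist_le[of R n, OF R] by blast
  have "max (agree_dist Q) (agree_dist R) = 0 \<or> (\<exists>n. max (agree_dist Q) (agree_dist R) = 1 / (1 + real n))"
    using agree_dist_cases[of Q] agree_dist_cases[of R] by (auto simp: max_def)
  then show ?thesis
  proof
    assume 0: "max (agree_dist Q) (agree_dist R) = 0"
    then have "agree_dist Q = 0" "agree_dist R = 0"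
      using agree_dist_nonneg[of Q] agree_dist_nonneg[of R] by (auto simp: max_def split: if_splits)
    then have "\<forall>m\<ge>1. P m" using QR agree_dist_eq_0[of Q, OF Q] agree_dist_eq_0[of R, OF R] by blast
    then have "agree_dist P = 0" using agree_dist_eq_0[of P, OF P] by blast
    then show ?thesis unfolding 0 by simp
  next
    assume "\<exists>n. max (agree_dist Q) (agree_dist R) = 1 / (1 + real n)"
    then obtain n where "max (agree_dist Q) (agree_dist R) = 1 / (1 + real n)" by blast
    with *[of n] show ?thesis by simp
  qed
qed

lemma agree_dist_cong: "(\<And>m. 1 \<le> m \<Longrightarrow> P m \<longleftrightarrow> Q m) \<Longrightarrow> agree_dist P = agree_dist Q"
proof -
  assume "\<And>m. 1 \<le> m \<Longrightarrow> P m \<longleftrightarrow> Q m"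
  then have "{enat m | m. m \<ge> 1 \<and> P m} = {enat m | m. m \<ge> 1 \<and> Q m}" by blast
  then show ?thesis by (simp only: agree_dist_def)
qed

lemma veq_refl: "veq m x x"
  by (cases x) (simp only: geq_veq geq_refl)

lemma veq_sym:
  assumes "vrooted x" "1 \<le> m" "veq m x y" shows "veq m y x"
proof -
  obtain H i K j where xy: "x = (H, i)" "y = (K, j)" by (cases x, cases y)
  show ?thesis using geq_sym[OF assms(1)[unfolded xy vrooted_grooted] assms(2) assms(3)[unfolded xy geq_veq]] unfolding xy geq_veq .
qed

lemma veq_trans:
  assumes "veq m x y" "veq m y z" shows "veq m x z"
proof -
  obtain H i K j L l where xy: "x = (H, i)" "y = (K, j)" "z = (L, l)" by (cases x, cases y, cases z)
  show ?thesis using geq_trans[OF assms[unfolded xy geq_veq]] unfolding xy geq_veq .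
qed

lemma veq_mono:
  assumes "vrooted x" "vrooted y" "k \<le> m" "veq m x y" shows "veq k x y"
proof -
  obtain H i K j where xy: "x = (H, i)" "y = (K, j)" by (cases x, cases y)
  show ?thesis using geq_mono[OF assms(1)[unfolded xy vrooted_grooted] assms(2)[unfolded xy vrooted_grooted] assms(4)[unfolded xy geq_veq] assms(3)] unfolding xy geq_veq .
qed

lemma viso_veq:
  assumes "vrooted x" "viso x y" shows "veq m x y"
proof -
  obtain H i K j where xy: "x = (H, i)" "y = (K, j)" by (cases x, cases y)
  obtain \<phi> where "giso \<phi> H {} i K {} j" using assms(2) unfolding xy viso_giso by blast
  from giso_geq[OF assms(1)[unfolded xy vrooted_grooted] this] show ?thesis unfolding xy geq_veq .
qed

lemma veq_all:
  assumes "vrooted x" "vrooted y" "\<And>m. m \<ge> 1 \<Longrightarrow> veq m x y" shows "viso x y"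
proof -
  obtain H i K j where xy: "x = (H, i)" "y = (K, j)" by (cases x, cases y)
  have "\<exists>\<phi>. giso \<phi> H {} i K {} j"
  proof (rule geq_all[OF assms(1)[unfolded xy vrooted_grooted] assms(2)[unfolded xy vrooted_grooted]])
    fix m :: nat assume "m \<ge> 1"
    then show "geq m H {} i K {} j" using assms(3)[of m] unfolding xy geq_veq by blast
  qed
  then show ?thesis unfolding xy viso_giso .
qed

lemma eeq_refl: "eeq m x x"
  by (cases x) (simp only: geq_eeq geq_refl)

lemma eeq_sym:
  assumes "erooted x" "1 \<le> m" "eeq m x y" shows "eeq m y x"
proof -
  obtain H e i K f j where xy: "x = (H, e, i)" "y = (K, f, j)" by (cases x, cases y)
  show ?thesis using geq_sym[OF erooted_grooted[OF assms(1)[unfolded xy]] assms(2) assms(3)[unfolded xy geq_eeq]] unfolding xy geq_eeq .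
qed

lemma eeq_trans:
  assumes "eeq m x y" "eeq m y z" shows "eeq m x z"
proof -
  obtain H e i K f j L g l where xy: "x = (H, e, i)" "y = (K, f, j)" "z = (L, g, l)" by (cases x, cases y, cases z)
  show ?thesis using geq_trans[OF assms[unfolded xy geq_eeq]] unfolding xy geq_eeq .
qed

lemma eeq_mono:
  assumes "erooted x" "erooted y" "k \<le> m" "eeq m x y" shows "eeq k x y"
proof -
  obtain H e i K f j where xy: "x = (H, e, i)" "y = (K, f, j)" by (cases x, cases y)
  show ?thesis using geq_mono[OF erooted_grooted[OF assms(1)[unfolded xy]] erooted_grooted[OF assms(2)[unfolded xy]] assms(4)[unfolded xy geq_eeq] assms(3)] unfolding xy geq_eeq .
qed

lemma eiso_eeq:
  assumes "erooted x" "eiso x y" shows "eeq m x y"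
proof -
  obtain H e i K f j where xy: "x = (H, e, i)" "y = (K, f, j)" by (cases x, cases y)
  obtain \<phi> where "giso \<phi> H {e} i K {f} j" using assms(2) unfolding xy eiso_giso by blast
  from giso_geq[OF erooted_grooted[OF assms(1)[unfolded xy]] this] show ?thesis unfolding xy geq_eeq .
qed

lemma eeq_all:
  assumes "erooted x" "erooted y" "\<And>m. m \<ge> 1 \<Longrightarrow> eeq m x y" shows "eiso x y"
proof -
  obtain H e i K f j where xy: "x = (H, e, i)" "y = (K, f, j)" by (cases x, cases y)
  have "\<exists>\<phi>. giso \<phi> H {e} i K {f} j"
  proof (rule geq_all[OF erooted_grooted[OF assms(1)[unfolded xy]] erooted_grooted[OF assms(2)[unfolded xy]]])
    fix m :: nat assume "m \<ge> 1"
    then show "geq m H {e} i K {f} j" using assms(3)[of m] unfolding xy geq_eeq by blast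
  qed
  then show ?thesis unfolding xy eiso_giso .
qed

instantiation hstar :: metric_space
begin

definition dist_hstar :: "hstar \<Rightarrow> hstar \<Rightarrow> real" where
  "dist_hstar x y = agree_dist (\<lambda>m. veq m (rep_hstar x) (rep_hstar y))"

definition uniformity_hstar :: "(hstar \<times> hstar) filter" where
  "uniformity_hstar = (INF e\<in>{0<..}. principal {(x, y). dist x y < e})"

definition open_hstar :: "hstar set \<Rightarrow> bool" where
  "open_hstar U \<longleftrightarrow> (\<forall>x\<in>U. eventually (\<lambda>(x', y). x' = x \<longrightarrow> y \<in> U) uniformity)"

instance
proof
  have mono: "veq k (rep_hstar x) (rep_hstar y)" if "1 \<le> k" "k \<le> m" "veq m (rep_hstar x) (rep_hstar y)"
    for k m x y using that veq_mono vrooted_rep by blast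
  show "dist x y = 0 \<longleftrightarrow> x = y" for x y :: hstar
  proof -
    have "dist x y = 0 \<longleftrightarrow> (\<forall>m\<ge>1. veq m (rep_hstar x) (rep_hstar y))"
      unfolding dist_hstar_def by (rule agree_dist_eq_0) (blast intro: mono)
    also have "\<dots> \<longleftrightarrow> x = y"
      by (auto intro!: veq_refl hstar_eqI veq_all vrooted_rep)
    finally show ?thesis .
  qed
  show "dist x y \<le> dist x z + dist y z" for x y z :: hstar
  proof -
    have "dist x y \<le> max (dist x z) (dist y z)"
      unfolding dist_hstar_def
    proof (rule agree_dist_ultra)
      fix m :: nat assume "1 \<le> m" "veq m (rep_hstar x) (rep_hstar z)" "veq m (rep_hstar y) (rep_hstar z)"
      then show "veq m (rep_hstar x) (rep_hstar y)" using veq_trans[OF _ veq_sym[OF vrooted_rep]] by blast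
    qed (blast intro: mono)+
    moreover have "0 \<le> dist x z" "0 \<le> dist y z" by (auto simp: dist_hstar_def agree_dist_nonneg)
    ultimately show ?thesis by linarith
  qed
qed (simp_all add: uniformity_hstar_def open_hstar_def)

end

instantiation hsstar :: metric_space
begin

definition dist_hsstar :: "hsstar \<Rightarrow> hsstar \<Rightarrow> real" where
  "dist_hsstar x y = agree_dist (\<lambda>m. eeq m (rep_hsstar x) (rep_hsstar y))"

definition uniformity_hsstar :: "(hsstar \<times> hsstar) filter" where
  "uniformity_hsstar = (INF e\<in>{0<..}. principal {(x, y). dist x y < e})"

definition open_hsstar :: "hsstar set \<Rightarrow> bool" where
  "open_hsstar U \<longleftrightarrow> (\<forall>x\<in>U. eventually (\<lambda>(x', y). x' = x \<longrightarrow> y \<in> U) uniformity)"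

instance
proof
  have mono: "eeq k (rep_hsstar x) (rep_hsstar y)" if "1 \<le> k" "k \<le> m" "eeq m (rep_hsstar x) (rep_hsstar y)"
    for k m x y using that eeq_mono erooted_rep by blast
  show "dist x y = 0 \<longleftrightarrow> x = y" for x y :: hsstar
  proof -
    have "dist x y = 0 \<longleftrightarrow> (\<forall>m\<ge>1. eeq m (rep_hsstar x) (rep_hsstar y))"
      unfolding dist_hsstar_def by (rule agree_dist_eq_0) (blast intro: mono)
    also have "\<dots> \<longleftrightarrow> x = y"
      by (auto intro!: eeq_refl hsstar_eqI eeq_all erooted_rep)
    finally show ?thesis .
  qed
  show "dist x y \<le> dist x z + dist y z" for x y z :: hsstar
  proof -
    have "dist x y \<le> max (dist x z) (dist y z)"
      unfolding dist_hsstar_def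
    proof (rule agree_dist_ultra)
      fix m :: nat assume "1 \<le> m" "eeq m (rep_hsstar x) (rep_hsstar z)" "eeq m (rep_hsstar y) (rep_hsstar z)"
      then show "eeq m (rep_hsstar x) (rep_hsstar y)" using eeq_trans[OF _ eeq_sym[OF erooted_rep]] by blast
    qed (blast intro: mono)+
    moreover have "0 \<le> dist x z" "0 \<le> dist y z" by (auto simp: dist_hsstar_def agree_dist_nonneg)
    ultimately show ?thesis by linarith
  qed
qed (simp_all add: uniformity_hsstar_def open_hsstar_def)

end

lemma dist_vclass:
  assumes "vrooted (H, i)" "vrooted (K, j)"
  shows "dist (vclass H i) (vclass K j) = agree_dist (\<lambda>m. veq m (H, i) (K, j))"
  unfolding dist_hstar_def
proof (rule agree_dist_cong)
  fix m :: nat assume m: "1 \<le> m"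
  have 1: "veq m (H, i) (rep_hstar (vclass H i))" and 2: "veq m (K, j) (rep_hstar (vclass K j))"
    by (rule viso_veq[OF assms(1) rep_vclass[OF assms(1)]], rule viso_veq[OF assms(2) rep_vclass[OF assms(2)]])
  note r1 = veq_sym[OF assms(1) m 1] and r2 = veq_sym[OF assms(2) m 2]
  show "veq m (rep_hstar (vclass H i)) (rep_hstar (vclass K j)) \<longleftrightarrow> veq m (H, i) (K, j)"
    using veq_trans[OF r1 veq_trans[OF _ 2]] veq_trans[OF 1 veq_trans[OF _ r2]] by blast
qed

lemma dist_eclass:
  assumes "erooted (H, e, i)" "erooted (K, f, j)"
  shows "dist (eclass H e i) (eclass K f j) = agree_dist (\<lambda>m. eeq m (H, e, i) (K, f, j))"
  unfolding dist_hsstar_def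
proof (rule agree_dist_cong)
  fix m :: nat assume m: "1 \<le> m"
  have 1: "eeq m (H, e, i) (rep_hsstar (eclass H e i))" and 2: "eeq m (K, f, j) (rep_hsstar (eclass K f j))"
    by (rule eiso_eeq[OF assms(1) rep_eclass[OF assms(1)]], rule eiso_eeq[OF assms(2) rep_eclass[OF assms(2)]])
  note r1 = eeq_sym[OF assms(1) m 1] and r2 = eeq_sym[OF assms(2) m 2]
  show "eeq m (rep_hsstar (eclass H e i)) (rep_hsstar (eclass K f j)) \<longleftrightarrow> eeq m (H, e, i) (K, f, j)"
    using eeq_trans[OF r1 eeq_trans[OF _ 2]] eeq_trans[OF 1 eeq_trans[OF _ r2]] by blast
qed


section \<open>Functions on rooted hypergraphs and unimodularity\<close>

text \<open>The operators \<open>\<partial>\<close> and \<open>\<nabla>\<close>; see \<open>del_vclass\<close> and \<open>nabla_eclass\<close> for their values on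
  arbitrary representatives.\<close>

definition del :: "(hsstar \<Rightarrow> 'a::comm_monoid_add) \<Rightarrow> hstar \<Rightarrow> 'a" where
  "del f x = (case rep_hstar x of (H, i) \<Rightarrow> \<Sum>e\<in>{e \<in> edges H. i \<in> e}. f (eclass H e i))"

definition nabla :: "(hsstar \<Rightarrow> real) \<Rightarrow> hsstar \<Rightarrow> real" where
  "nabla f x = (case rep_hsstar x of (H, e, i) \<Rightarrow> (1 / real (card e)) * (\<Sum>j\<in>e. f (eclass H e j)))"

definition fmin :: "(hstar \<Rightarrow> real) \<Rightarrow> hsstar \<Rightarrow> real" where
  "fmin f x = (case rep_hsstar x of (H, e, i) \<Rightarrow> (1 / real (card e)) * (MIN j\<in>e. f (vclass H j)))"

definition hdeg :: "hstar \<Rightarrow> nat" where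
  "hdeg x = (case rep_hstar x of (H, i) \<Rightarrow> card {e \<in> edges H. i \<in> e})"

lemma eclass_hiso:
  assumes "erooted (H, e, i)" "hiso \<phi> H K" shows "eclass K (\<phi> ` e) (\<phi> i) = eclass H e i"
proof -
  have "eiso (H, e, i) (K, \<phi> ` e, \<phi> i)" using assms(2) by auto
  with eclass_eq_iff[OF assms(1) erooted_hiso[OF assms]] show ?thesis by metis
qed

lemma vclass_hiso:
  assumes "vrooted (H, i)" "hiso \<phi> H K" shows "vclass K (\<phi> i) = vclass H i"
proof -
  have "viso (H, i) (K, \<phi> i)" using assms(2) by auto
  with vclass_eq_iff[OF assms(1) vrooted_hiso[OF assms]] show ?thesis by metis
qed

lemma hiso_incident:
  assumes "hypergraph H" "i \<in> verts H" "hiso \<phi> H K"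
  shows "bij_betw ((`) \<phi>) {e \<in> edges H. i \<in> e} {f \<in> edges K. \<phi> i \<in> f}"
proof -
  have b: "inj_on \<phi> (verts H)" and e: "bij_betw ((`) \<phi>) (edges H) (edges K)"
    using assms(3) by (auto simp: hiso_def bij_betw_def)
  have m: "\<phi> i \<in> \<phi> ` e \<longleftrightarrow> i \<in> e" if "e \<in> edges H" for e
    using inj_on_image_mem_iff[OF b assms(2) hypergraph.edge_subset[OF assms(1) that]] .
  have "(`) \<phi> ` {e \<in> edges H. i \<in> e} = {f \<in> edges K. \<phi> i \<in> f}"
  proof (intro equalityI subsetI)
    fix f assume f: "f \<in> {f \<in> edges K. \<phi> i \<in> f}"
    then have "f \<in> (`) \<phi> ` edges H" using e by (auto simp: bij_betw_def)
    then obtain x where "x \<in> edges H" "f = \<phi> ` x" by blast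
    then show "f \<in> (`) \<phi> ` {e \<in> edges H. i \<in> e}" using m[of x] f by blast
  next
    fix f assume "f \<in> (`) \<phi> ` {e \<in> edges H. i \<in> e}"
    then obtain x where x: "x \<in> edges H" "i \<in> x" "f = \<phi> ` x" by blast
    then have "f \<in> edges K" using e by (auto simp: bij_betw_def)
    with x show "f \<in> {f \<in> edges K. \<phi> i \<in> f}" by blast
  qed
  moreover have "inj_on ((`) \<phi>) {e \<in> edges H. i \<in> e}"
    using e by (auto simp: bij_betw_def intro: inj_on_subset[of _ "edges H"])
  ultimately show ?thesis by (simp add: bij_betw_def)
qed

lemma rep_vclassE:
  assumes "vrooted (H, i)"
  obtains K \<phi> where "rep_hstar (vclass H i) = (K, \<phi> i)" "hiso \<phi> H K"
proof -
  obtain K j where x: "rep_hstar (vclass H i) = (K, j)" by (cases "rep_hstar (vclass H i)")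
  obtain \<phi> where "hiso \<phi> H K" "\<phi> i = j" using rep_vclass[OF assms] unfolding x viso.simps by blast
  with x that show ?thesis by blast
qed

lemma rep_eclassE:
  assumes "erooted (H, e, i)"
  obtains K \<phi> where "rep_hsstar (eclass H e i) = (K, \<phi> ` e, \<phi> i)" "hiso \<phi> H K"
proof -
  obtain K f j where x: "rep_hsstar (eclass H e i) = (K, f, j)" by (cases "rep_hsstar (eclass H e i)")
  obtain \<phi> where "hiso \<phi> H K" "\<phi> ` e = f" "\<phi> i = j"
    using rep_eclass[OF assms] unfolding x eiso.simps by blast
  with x that show ?thesis by blast
qed

lemma del_vclass:
  assumes "vrooted (H, i)"
  shows "del f (vclass H i) = (\<Sum>e\<in>{e \<in> edges H. i \<in> e}. f (eclass H e i))"
proof -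
  obtain K \<phi> where x: "rep_hstar (vclass H i) = (K, \<phi> i)" and h: "hiso \<phi> H K"
    using rep_vclassE[OF assms] .
  have "del f (vclass H i) = (\<Sum>f'\<in>{f' \<in> edges K. \<phi> i \<in> f'}. f (eclass K f' (\<phi> i)))"
    by (simp add: del_def x)
  also have "\<dots> = (\<Sum>e\<in>{e \<in> edges H. i \<in> e}. f (eclass K (\<phi> ` e) (\<phi> i)))"
    using assms by (intro sum.reindex_bij_betw[symmetric] hiso_incident[OF _ _ h]) auto
  also have "\<dots> = (\<Sum>e\<in>{e \<in> edges H. i \<in> e}. f (eclass H e i))"
  proof (rule sum.cong[OF refl])
    fix e assume "e \<in> {e \<in> edges H. i \<in> e}"
    then have "erooted (H, e, i)" using assms by simp
    then show "f (eclass K (\<phi> ` e) (\<phi> i)) = f (eclass H e i)" using eclass_hiso[OF _ h] by simp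
  qed
  finally show ?thesis .
qed

lemma hdeg_vclass:
  assumes "vrooted (H, i)" shows "hdeg (vclass H i) = card {e \<in> edges H. i \<in> e}"
proof -
  obtain K \<phi> where x: "rep_hstar (vclass H i) = (K, \<phi> i)" and h: "hiso \<phi> H K"
    using rep_vclassE[OF assms] .
  have "bij_betw ((`) \<phi>) {e \<in> edges H. i \<in> e} {f \<in> edges K. \<phi> i \<in> f}"
    using assms by (intro hiso_incident[OF _ _ h]) auto
  then show ?thesis by (simp add: hdeg_def x bij_betw_same_card)
qed

lemma hiso_edge:
  assumes "hypergraph H" "hiso \<phi> H K" "e \<in> edges H"
  shows "bij_betw \<phi> e (\<phi> ` e)" "card (\<phi> ` e) = card e"
proof -
  have "inj_on \<phi> e"
    using assms(2) hypergraph.edge_subset[OF assms(1,3)] by (auto simp: hiso_def bij_betw_def intro: inj_on_subset)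
  then show "bij_betw \<phi> e (\<phi> ` e)" "card (\<phi> ` e) = card e" by (simp_all add: bij_betw_def card_image)
qed

lemma nabla_eclass:
  assumes "erooted (H, e, i)"
  shows "nabla f (eclass H e i) = (1 / real (card e)) * (\<Sum>j\<in>e. f (eclass H e j))"
proof -
  obtain K \<phi> where x: "rep_hsstar (eclass H e i) = (K, \<phi> ` e, \<phi> i)" and h: "hiso \<phi> H K"
    using rep_eclassE[OF assms] .
  have H: "hypergraph H" "e \<in> edges H" using assms by auto
  have "(\<Sum>j\<in>\<phi> ` e. f (eclass K (\<phi> ` e) j)) = (\<Sum>j\<in>e. f (eclass K (\<phi> ` e) (\<phi> j)))"
    by (rule sum.reindex_bij_betw[symmetric, OF hiso_edge(1)[OF H(1) h H(2)]])
  also have "\<dots> = (\<Sum>j\<in>e. f (eclass H e j))"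
  proof (rule sum.cong[OF refl])
    fix j assume "j \<in> e"
    then have "erooted (H, e, j)" using assms by simp
    then show "f (eclass K (\<phi> ` e) (\<phi> j)) = f (eclass H e j)" using eclass_hiso[OF _ h] by simp
  qed
  finally show ?thesis by (simp add: nabla_def x hiso_edge(2)[OF H(1) h H(2)])
qed

lemma fmin_eclass:
  assumes "erooted (H, e, i)"
  shows "fmin f (eclass H e i) = (1 / real (card e)) * (MIN j\<in>e. f (vclass H j))"
proof -
  obtain K \<phi> where x: "rep_hsstar (eclass H e i) = (K, \<phi> ` e, \<phi> i)" and h: "hiso \<phi> H K"
    using rep_eclassE[OF assms] .
  have H: "hypergraph H" "e \<in> edges H" using assms by auto
  have "f (vclass K (\<phi> j)) = f (vclass H j)" if "j \<in> e" for j
  proof -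
    have "vrooted (H, j)" using assms that hypergraph.edge_subset[OF H] by auto
    then show ?thesis using vclass_hiso[OF _ h] by simp
  qed
  then have "(\<lambda>j. f (vclass K j)) ` \<phi> ` e = (\<lambda>j. f (vclass H j)) ` e"
    unfolding image_image by (rule image_cong[OF refl])
  then show ?thesis by (simp add: fmin_def x hiso_edge(2)[OF H(1) h H(2)])
qed

definition mean_deg :: "hstar measure \<Rightarrow> ennreal" where
  "mean_deg \<mu> = (\<integral>\<^sup>+ x. of_nat (hdeg x) \<partial>\<mu>)"

text \<open>The measure \<open>\<mu>\<close> with an arrow; it exists and is unique by \<open>vec_measure_exists\<close> and \<open>vec_measure_unique\<close> below.\<close>

definition is_vec_measure :: "hstar measure \<Rightarrow> hsstar measure \<Rightarrow> bool" where
  "is_vec_measure \<mu> \<nu> \<longleftrightarrow> sets \<nu> = sets borel \<and>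
     (\<forall>f :: hsstar \<Rightarrow> real. f \<in> borel_measurable borel \<longrightarrow> (\<forall>x. 0 \<le> f x) \<longrightarrow>
        (\<integral>\<^sup>+ x. ennreal (f x) \<partial>\<nu>) = (\<integral>\<^sup>+ x. ennreal (del f x) \<partial>\<mu>))"

definition vec_measure :: "hstar measure \<Rightarrow> hsstar measure" where
  "vec_measure \<mu> = (THE \<nu>. is_vec_measure \<mu> \<nu>)"

lemma vec_measure_unique:
  assumes "is_vec_measure \<mu> \<nu>" "is_vec_measure \<mu> \<nu>'" shows "\<nu> = \<nu>'"
proof (rule measure_eqI)
  show "sets \<nu> = sets \<nu>'" using assms by (simp add: is_vec_measure_def)
  fix A assume "A \<in> sets \<nu>"
  then have A: "A \<in> sets borel" using assms by (simp add: is_vec_measure_def)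
  have *: "emeasure N A = (\<integral>\<^sup>+ x. ennreal (del (indicator A) x) \<partial>\<mu>)" if N: "is_vec_measure \<mu> N" for N
  proof -
    have "(\<integral>\<^sup>+ x. ennreal (indicator A x) \<partial>N) = (\<integral>\<^sup>+ x. ennreal (del (indicator A) x) \<partial>\<mu>)"
      using N A unfolding is_vec_measure_def by (simp add: borel_measurable_indicator)
    moreover have "A \<in> sets N" using N A by (simp add: is_vec_measure_def)
    ultimately show ?thesis by (simp add: ennreal_indicator)
  qed
  show "emeasure \<nu> A = emeasure \<nu>' A" using *[OF assms(1)] *[OF assms(2)] by simp
qed

text \<open>Existence rests on the measurability of \<open>\<partial>f\<close>, which is proved first for indicators of the balls
  of the metric, where \<open>\<partial>f\<close> is locally constant.\<close>

lemma hdist_less_hstar: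
  assumes "dist x y < 1 / (1 + real m)" "1 \<le> m"
  shows "veq m (rep_hstar x) (rep_hstar y)"
proof -
  have "agree_dist (\<lambda>m. veq m (rep_hstar x) (rep_hstar y)) \<le> 1 / (1 + real m) \<longleftrightarrow>
    (\<forall>k. 1 \<le> k \<and> k \<le> m \<longrightarrow> veq k (rep_hstar x) (rep_hstar y))"
    by (rule agree_dist_le) (blast intro: veq_mono[OF vrooted_rep vrooted_rep])
  then show ?thesis using assms unfolding dist_hstar_def by auto
qed

lemma dist_hsstar_le:
  "dist x y \<le> 1 / (1 + real n) \<longleftrightarrow> (\<forall>m. 1 \<le> m \<and> m \<le> n \<longrightarrow> eeq m (rep_hsstar x) (rep_hsstar y))"
  unfolding dist_hsstar_def by (rule agree_dist_le) (blast intro: eeq_mono[OF erooted_rep erooted_rep])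

definition esat :: "nat \<Rightarrow> hsstar set \<Rightarrow> bool" where
  "esat m A \<longleftrightarrow> (\<forall>x y. eeq m (rep_hsstar x) (rep_hsstar y) \<longrightarrow> x \<in> A \<longrightarrow> y \<in> A)"

lemma del_indicator_veq:
  assumes m: "1 \<le> m" and A: "esat m A" and xy: "veq m (rep_hstar x) (rep_hstar y)"
  shows "(del (indicator A) x :: ennreal) = del (indicator A) y"
proof -
  obtain H i where x: "rep_hstar x = (H, i)" by (cases "rep_hstar x")
  obtain K j where y: "rep_hstar y = (K, j)" by (cases "rep_hstar y")
  have H: "vrooted (H, i)" and K: "vrooted (K, j)" using vrooted_rep[of x] vrooted_rep[of y] x y by auto
  obtain \<phi> where h: "hiso \<phi> (hball H i m) (hball K j m)" and ij: "\<phi> i = j"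
    using xy unfolding x y veq.simps viso.simps by blast
  have inH: "e \<subseteq> hnbhd H i m" if "e \<in> edges H" "i \<in> e" for e
    using hypergraph.edge_subset_hnbhd_1[OF _ that m] H by simp
  have inK: "e \<subseteq> hnbhd K j m" if "e \<in> edges K" "j \<in> e" for e
    using hypergraph.edge_subset_hnbhd_1[OF _ that m] K by simp
  have eqH: "{e \<in> edges (hball H i m). i \<in> e} = {e \<in> edges H. i \<in> e}" using inH by auto
  have eqK: "{e \<in> edges (hball K j m). j \<in> e} = {e \<in> edges K. j \<in> e}" using inK by auto
  have inj: "inj_on \<phi> (hnbhd H i m)" and b: "bij_betw ((`) \<phi>) (edges (hball H i m)) (edges (hball K j m))"
    using h by (auto simp: hiso_def bij_betw_def)
  have i: "i \<in> hnbhd H i m" using hnbhd_0[of i H] hnbhd_mono[of 0 m H i] H by auto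
  have "bij_betw ((`) \<phi>) {e \<in> edges (hball H i m). i \<in> e} {e \<in> edges (hball K j m). j \<in> e}"
  proof (rule bij_betw_subset[OF b, THEN bij_betw_cong[THEN iffD1, rotated], rotated 2])
    show "(`) \<phi> ` {e \<in> edges (hball H i m). i \<in> e} = {e \<in> edges (hball K j m). j \<in> e}"
    proof (intro equalityI subsetI)
      fix f assume f: "f \<in> {e \<in> edges (hball K j m). j \<in> e}"
      then obtain e where e: "e \<in> edges (hball H i m)" "f = \<phi> ` e" using b unfolding bij_betw_def by blast
      then have "i \<in> e" using inj_on_image_mem_iff[OF inj i, of e] f ij by auto
      with e show "f \<in> (`) \<phi> ` {e \<in> edges (hball H i m). i \<in> e}" by blast
    next
      fix f assume "f \<in> (`) \<phi> ` {e \<in> edges (hball H i m). i \<in> e}"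
      then obtain e where e: "e \<in> edges (hball H i m)" "i \<in> e" "f = \<phi> ` e" by blast
      then have "f \<in> edges (hball K j m)" using b unfolding bij_betw_def by blast
      with e ij show "f \<in> {e \<in> edges (hball K j m). j \<in> e}" by blast
    qed
  qed auto
  then have bij: "bij_betw ((`) \<phi>) {e \<in> edges H. i \<in> e} {e \<in> edges K. j \<in> e}" unfolding eqH eqK .
  have "del (indicator A) y = (\<Sum>f\<in>{f \<in> edges K. j \<in> f}. (indicator A (eclass K f j) :: ennreal))"
    by (simp add: del_def y)
  also have "\<dots> = (\<Sum>e\<in>{e \<in> edges H. i \<in> e}. indicator A (eclass K (\<phi> ` e) j))"
    by (rule sum.reindex_bij_betw[symmetric, OF bij])
  also have "\<dots> = (\<Sum>e\<in>{e \<in> edges H. i \<in> e}. indicator A (eclass H e i))"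
  proof (rule sum.cong[OF refl])
    fix e assume e: "e \<in> {e \<in> edges H. i \<in> e}"
    have 1: "erooted (H, e, i)" using e H by simp
    have "\<phi> ` e \<in> {e \<in> edges K. j \<in> e}" using e bij unfolding bij_betw_def by blast
    then have 2: "erooted (K, \<phi> ` e, j)" using K by simp
    have eq: "eeq m (H, e, i) (K, \<phi> ` e, j)" using h ij by auto
    have r1: "eeq m (H, e, i) (rep_hsstar (eclass H e i))" by (rule eiso_eeq[OF 1 rep_eclass[OF 1]])
    have r2: "eeq m (K, \<phi> ` e, j) (rep_hsstar (eclass K (\<phi> ` e) j))" by (rule eiso_eeq[OF 2 rep_eclass[OF 2]])
    have "eeq m (rep_hsstar (eclass H e i)) (rep_hsstar (eclass K (\<phi> ` e) j))"
      by (rule eeq_trans[OF eeq_sym[OF 1 m r1] eeq_trans[OF eq r2]])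
    moreover from this have "eeq m (rep_hsstar (eclass K (\<phi> ` e) j)) (rep_hsstar (eclass H e i))"
      by (rule eeq_sym[OF erooted_rep m])
    ultimately have "eclass H e i \<in> A \<longleftrightarrow> eclass K (\<phi> ` e) j \<in> A" using A unfolding esat_def by blast
    then show "(indicator A (eclass K (\<phi> ` e) j) :: ennreal) = indicator A (eclass H e i)"
      by (simp add: indicator_def)
  qed
  also have "\<dots> = del (indicator A) x" by (simp add: del_def x)
  finally show ?thesis by simp
qed

lemma measurable_del_esat:
  assumes "1 \<le> m" "esat m A"
  shows "(del (indicator A) :: hstar \<Rightarrow> ennreal) \<in> borel_measurable borel"
proof (rule borel_measurableI)
  fix S :: "ennreal set"
  have "open ((del (indicator A) :: hstar \<Rightarrow> ennreal) -` S)"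
    unfolding open_dist
  proof (intro ballI exI conjI allI impI)
    fix x y assume x: "x \<in> (del (indicator A) :: hstar \<Rightarrow> ennreal) -` S" and "dist y x < 1 / (1 + real m)"
    then have "veq m (rep_hstar y) (rep_hstar x)" using hdist_less_hstar assms(1) by blast
    from del_indicator_veq[OF assms this] x show "y \<in> (del (indicator A) :: hstar \<Rightarrow> ennreal) -` S" by simp
  qed simp
  then show "(del (indicator A) :: hstar \<Rightarrow> ennreal) -` S \<inter> space borel \<in> sets borel" by simp
qed

definition eballs :: "hsstar set set" where
  "eballs = {{z. eeq m (rep_hsstar y) (rep_hsstar z)} | m y. 1 \<le> m}"

lemma countable_eballs: "countable eballs"
proof -
  define code where "code = (\<lambda>(m :: nat, y). case rep_hsstar y of (H, e, i) \<Rightarrow>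
     (m, verts (hball H i m), edges (hball H i m), e, i))"
  define D where "D = (\<lambda>(m :: nat, V :: nat set, E, e, i).
     {z. case rep_hsstar z of (K, f, j) \<Rightarrow> eiso (\<lparr>verts = V, edges = E\<rparr>, e, i) (hball K j m, f, j)})"
  let ?F = "{A :: nat set. finite A}"
  let ?C = "(UNIV :: nat set) \<times> ?F \<times> {E. finite E \<and> E \<subseteq> ?F} \<times> ?F \<times> (UNIV :: nat set)"
  have "eballs \<subseteq> D ` ?C"
  proof
    fix B assume "B \<in> eballs"
    then obtain m y where B: "B = {z. eeq m (rep_hsstar y) (rep_hsstar z)}" "1 \<le> m"
      unfolding eballs_def by blast
    obtain H e i where y: "rep_hsstar y = (H, e, i)" by (cases "rep_hsstar y")
    have r: "erooted (H, e, i)" using erooted_rep[of y] y by simp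
    then interpret hypergraph H by simp
    have i: "i \<in> verts H" and e: "finite e" using r edge_subset edge_finite by auto
    have fin: "finite (hnbhd H i m)" using finite_hnbhd[OF i] .
    have "finite (edges (hball H i m))" by (rule finite_subset[OF _ finite_Pow_iff[THEN iffD2, OF fin]]) auto
    then have "(m, verts (hball H i m), edges (hball H i m), e, i) \<in> ?C"
      using fin e edge_finite by auto
    moreover have "B = D (m, verts (hball H i m), edges (hball H i m), e, i)"
    proof -
      have *: "eeq m (H, e, i) w \<longleftrightarrow> (case w of (K, f, j) \<Rightarrow> eiso (hball H i m, e, i) (hball K j m, f, j))" for w
        by (cases w) simp
      have "\<lparr>verts = verts (hball H i m), edges = edges (hball H i m)\<rparr> = hball H i m" by simp
      then show ?thesis unfolding B(1) D_def y * prod.case by (simp only:)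
    qed
    ultimately show "B \<in> D ` ?C" by (rule rev_image_eqI)
  qed
  moreover have "countable (D ` ?C)"
  proof (rule countable_image)
    have a: "countable ?F" by (rule countable_Collect_finite)
    have b: "countable {E. finite E \<and> E \<subseteq> ?F}" by (rule countable_Collect_finite_subset[OF a])
    show "countable ?C"
      by (rule countable_SIGMA[OF countableI_type countable_SIGMA[OF a countable_SIGMA[OF b
            countable_SIGMA[OF a countableI_type]]]])
  qed
  ultimately show ?thesis by (rule countable_subset)
qed

lemma esat_eball: "esat m {z. eeq m (rep_hsstar y) (rep_hsstar z)}"
  unfolding esat_def using eeq_trans by blast

lemma esat_mono: "esat m A \<Longrightarrow> m \<le> n \<Longrightarrow> esat n A"
  unfolding esat_def using eeq_mono[OF erooted_rep erooted_rep] by blast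

lemma open_esat:
  assumes "1 \<le> m" "esat m A" shows "open A"
  unfolding open_dist
proof (intro ballI exI conjI allI impI)
  fix x y assume x: "x \<in> A" and "dist y x < 1 / (1 + real m)"
  then have "dist x y \<le> 1 / (1 + real m)" by (simp add: dist_commute)
  then have "eeq m (rep_hsstar x) (rep_hsstar y)" using assms(1) unfolding dist_hsstar_le by blast
  then show "y \<in> A" using x assms(2) unfolding esat_def by blast
qed simp

lemma sets_borel_eballs: "sets (borel :: hsstar measure) = sigma_sets UNIV (insert {} eballs)"
  unfolding sets_borel
proof (rule sigma_sets_eqI)
  fix U :: "hsstar set" assume "U \<in> {S. open S}"
  then have U: "open U" by simp
  have eq: "\<Union>{B \<in> eballs. B \<subseteq> U} = U"
  proof (rule equalityI[OF _ subsetI])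
    fix x assume x: "x \<in> U"
    then obtain \<epsilon> where \<epsilon>: "\<epsilon> > 0" "\<And>y. dist y x < \<epsilon> \<Longrightarrow> y \<in> U" using U unfolding open_dist by blast
    obtain n where n: "1 / (1 + real n) < \<epsilon>"
      using reals_Archimedean[OF \<epsilon>(1)] by (auto simp: inverse_eq_divide add.commute)
    let ?m = "max 1 n"
    let ?B = "{z. eeq ?m (rep_hsstar x) (rep_hsstar z)}"
    have "y \<in> U" if "y \<in> ?B" for y
    proof -
      have "dist x y \<le> 1 / (1 + real ?m)"
        using that eeq_mono[OF erooted_rep erooted_rep] unfolding dist_hsstar_le by blast
      also have "\<dots> \<le> 1 / (1 + real n)" by (intro divide_left_mono) auto
      finally show ?thesis using n \<epsilon>(2)[of y] by (simp add: dist_commute)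
    qed
    moreover have "?B \<in> eballs" unfolding eballs_def by (intro CollectI exI[of _ ?m] exI[of _ x]) simp
    moreover have "x \<in> ?B" using eeq_refl by simp
    ultimately show "x \<in> \<Union>{B \<in> eballs. B \<subseteq> U}" by blast
  qed blast
  have "\<Union>{B \<in> eballs. B \<subseteq> U} \<in> sigma_sets UNIV (insert {} eballs)"
  proof (rule sigma_sets_UNION)
    show "countable {B \<in> eballs. B \<subseteq> U}" by (rule countable_subset[OF _ countable_eballs]) blast
  qed (rule sigma_sets.Basic, blast)
  then show "U \<in> sigma_sets UNIV (insert {} eballs)" unfolding eq .
next
  fix B assume "B \<in> insert {} eballs"
  then consider "B = {}" | m y where "B = {z. eeq m (rep_hsstar y) (rep_hsstar z)}" "1 \<le> m"
    unfolding eballs_def by blast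
  then have "open B"
  proof cases
    case 2 then show ?thesis using open_esat[OF 2(2) esat_eball] by blast
  qed simp
  then show "B \<in> sigma_sets UNIV {S. open S}" by (intro sigma_sets.Basic CollectI)
qed

lemma Int_stable_eballs: "Int_stable (insert {} eballs)"
proof (rule Int_stableI)
  have *: "{z. eeq m (rep_hsstar x) (rep_hsstar z)} \<inter> {z. eeq n (rep_hsstar y) (rep_hsstar z)} \<in> insert {} eballs"
    (is "?A \<inter> ?B \<in> _") if mn: "1 \<le> m" "m \<le> n" for m n x y
  proof (cases "?A \<inter> ?B = {}")
    case False
    then obtain w where w: "eeq m (rep_hsstar x) (rep_hsstar w)" "eeq n (rep_hsstar y) (rep_hsstar w)" by blast
    have "?B \<subseteq> ?A"
    proof (clarify)
      fix z assume "eeq n (rep_hsstar y) (rep_hsstar z)"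
      then have "eeq n (rep_hsstar w) (rep_hsstar z)"
        using eeq_trans[OF eeq_sym[OF erooted_rep _ w(2)]] mn by simp
      then have "eeq m (rep_hsstar w) (rep_hsstar z)"
        using eeq_mono[OF erooted_rep erooted_rep mn(2)] by blast
      with w(1) show "eeq m (rep_hsstar x) (rep_hsstar z)" by (rule eeq_trans)
    qed
    then have "?A \<inter> ?B = ?B" by blast
    moreover have "?B \<in> eballs" unfolding eballs_def using mn by (intro CollectI exI[of _ n] exI[of _ y]) simp
    ultimately show ?thesis by simp
  qed simp
  fix A B assume AB: "A \<in> insert {} eballs" "B \<in> insert {} eballs"
  show "A \<inter> B \<in> insert {} eballs"
  proof (cases "A = {} \<or> B = {}")
    case False
    with AB obtain m x n y where A: "A = {z. eeq m (rep_hsstar x) (rep_hsstar z)}" "1 \<le> m"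
      and B: "B = {z. eeq n (rep_hsstar y) (rep_hsstar z)}" "1 \<le> n"
      unfolding eballs_def by blast
    show ?thesis
    proof (cases "m \<le> n")
      case True then show ?thesis unfolding A B by (intro * A)
    next
      case False
      then have "n \<le> m" by simp
      then show ?thesis unfolding A B Int_commute[of "{z. eeq m (rep_hsstar x) (rep_hsstar z)}"] by (intro * B)
    qed
  qed auto
qed

lemma measurable_del_indicator:
  assumes "A \<in> sets borel"
  shows "(del (indicator A) :: hstar \<Rightarrow> ennreal) \<in> borel_measurable borel"
proof -
  have UN: "(del (indicator UNIV) :: hstar \<Rightarrow> ennreal) \<in> borel_measurable borel"
    by (rule measurable_del_esat[of 1]) (simp_all add: esat_def)
  have "A \<in> sigma_sets UNIV (insert {} eballs)" using assms unfolding sets_borel_eballs .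
  with Int_stable_eballs Pow_UNIV[THEN equalityD2, THEN subset_trans[OF subset_UNIV]] show ?thesis
  proof (induct rule: sigma_sets_induct_disjoint)
    case (basic A)
    show ?case
    proof (cases "A = {}")
      case True
      then show ?thesis by (simp add: del_def case_prod_unfold)
    next
      case False
      with basic obtain m y where "A = {z. eeq m (rep_hsstar y) (rep_hsstar z)}" "1 \<le> m"
        unfolding eballs_def by blast
      then show ?thesis using measurable_del_esat esat_eball by simp
    qed
  next
    case empty
    show ?case by (simp add: del_def case_prod_unfold)
  next
    case (compl A)
    have "del (indicator (UNIV - A)) x = (del (indicator UNIV) x - del (indicator A) x :: ennreal)" for x
    proof -
      obtain H i where x: "rep_hstar x = (H, i)" by (cases "rep_hstar x")
      have "del (indicator UNIV) x = (del (indicator (UNIV - A)) x + del (indicator A) x :: ennreal)"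
        unfolding del_def x prod.case sum.distrib[symmetric]
        by (rule sum.cong[OF refl]) (simp add: indicator_def)
      moreover have "(del (indicator A) x :: ennreal) = ennreal (del (indicator A) x)"
        by (simp add: del_def x ennreal_indicator[symmetric] sum_ennreal del: ennreal_indicator)
      ultimately show ?thesis by (metis ennreal_add_diff_cancel_right ennreal_neq_top)
    qed
    then have "(del (indicator (UNIV - A)) :: hstar \<Rightarrow> ennreal) = (\<lambda>x. del (indicator UNIV) x - del (indicator A) x)"
      by (rule ext)
    then show ?case using borel_measurable_minus_ennreal[OF UN compl(2)] by simp
  next
    case (union A)
    have "del (indicator (\<Union>i. A i)) x = (\<Sum>i. del (indicator (A i)) x :: ennreal)" for x
      unfolding del_def case_prod_unfold
      by (subst suminf_sum) (simp_all add: suminf_indicator[OF union(1)])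
    then have "(del (indicator (\<Union>i. A i)) :: hstar \<Rightarrow> ennreal) = (\<lambda>x. \<Sum>i. del (indicator (A i)) x)"
      by (rule ext)
    then show ?case using union(3) by (simp add: borel_measurable_suminf)
  qed
qed

lemma vec_measure_exists:
  assumes \<mu>: "sets \<mu> = sets borel"
  shows "is_vec_measure \<mu> (vec_measure \<mu>)"
proof -
  define N where "N = measure_of UNIV (sets borel) (\<lambda>A. \<integral>\<^sup>+ x. del (indicator A) x \<partial>\<mu>)"
  have meas: "(del (indicator A) :: hstar \<Rightarrow> ennreal) \<in> borel_measurable \<mu>" if "A \<in> sets borel" for A
    using measurable_del_indicator[OF that] measurable_cong_sets[OF \<mu> refl] by blast
  have sN: "sets N = sets borel"
    unfolding N_def by (simp add: sigma_algebra.sigma_sets_eq[OF sets.sigma_algebra_axioms[of borel, simplified]])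
  have eN: "emeasure N A = (\<integral>\<^sup>+ x. del (indicator A) x \<partial>\<mu>)" if "A \<in> sets borel" for A
  proof (rule emeasure_measure_of[OF N_def])
    show "sets borel \<subseteq> Pow (UNIV :: hsstar set)" by simp
    show "A \<in> sets N" using that sN by simp
    show "positive (sets N) (\<lambda>A. \<integral>\<^sup>+ x. del (indicator A) x \<partial>\<mu>)"
      by (simp add: positive_def del_def case_prod_unfold)
    show "countably_additive (sets N) (\<lambda>A. \<integral>\<^sup>+ x. del (indicator A) x \<partial>\<mu>)"
    proof (rule countably_additiveI)
      fix B :: "nat \<Rightarrow> hsstar set"
      assume B: "range B \<subseteq> sets N" "disjoint_family B"
      have "del (indicator (\<Union>i. B i)) x = (\<Sum>i. del (indicator (B i)) x :: ennreal)" for x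
        unfolding del_def case_prod_unfold
        by (subst suminf_sum) (simp_all add: suminf_indicator[OF B(2)])
      then have "(\<integral>\<^sup>+ x. del (indicator (\<Union>i. B i)) x \<partial>\<mu>) = (\<integral>\<^sup>+ x. (\<Sum>i. del (indicator (B i)) x) \<partial>\<mu>)"
        by simp
      also have "\<dots> = (\<Sum>i. \<integral>\<^sup>+ x. del (indicator (B i)) x \<partial>\<mu>)"
        using B(1) sN by (intro nn_integral_suminf meas) blast
      finally show "(\<Sum>i. \<integral>\<^sup>+ x. del (indicator (B i)) x \<partial>\<mu>) = (\<integral>\<^sup>+ x. del (indicator (\<Union>i. B i)) x \<partial>\<mu>)"
        by simp
    qed
  qed
  have mN: "f \<in> borel_measurable borel \<Longrightarrow> f \<in> borel_measurable N" for f :: "hsstar \<Rightarrow> ennreal"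
    using measurable_cong_sets[OF sN refl] by blast
  have main: "del f \<in> borel_measurable \<mu> \<and> (\<integral>\<^sup>+ x. f x \<partial>N) = (\<integral>\<^sup>+ x. del f x \<partial>\<mu>)"
    if "f \<in> borel_measurable borel" for f :: "hsstar \<Rightarrow> ennreal"
    using that
  proof (induct rule: borel_measurable_induct)
    case (cong f g)
    then have "f = g" by auto
    with cong show ?case by simp
  next
    case (set A)
    then show ?case using meas[of A] eN[of A] sN by simp
  next
    case (mult u c)
    have "del (\<lambda>x. c * u x) = (\<lambda>x. c * del u x)"
      by (rule ext) (simp add: del_def case_prod_unfold sum_distrib_left)
    moreover have "u \<in> borel_measurable N" "del u \<in> borel_measurable \<mu>"
      "(\<integral>\<^sup>+ x. u x \<partial>N) = (\<integral>\<^sup>+ x. del u x \<partial>\<mu>)" using mult mN[of u] by blast+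
    ultimately show ?case by (simp add: nn_integral_cmult)
  next
    case (add u v)
    have "del (\<lambda>x. v x + u x) = (\<lambda>x. del v x + del u x)"
      by (rule ext) (simp add: del_def case_prod_unfold sum.distrib)
    moreover have "u \<in> borel_measurable N" "del u \<in> borel_measurable \<mu>"
      "v \<in> borel_measurable N" "del v \<in> borel_measurable \<mu>"
      "(\<integral>\<^sup>+ x. u x \<partial>N) = (\<integral>\<^sup>+ x. del u x \<partial>\<mu>)" "(\<integral>\<^sup>+ x. v x \<partial>N) = (\<integral>\<^sup>+ x. del v x \<partial>\<mu>)"
      using add mN[of u] mN[of v] by blast+
    ultimately show ?case by (simp add: nn_integral_add)
  next
    case (seq U)
    have U: "\<And>i. U i \<in> borel_measurable N" "\<And>i. del (U i) \<in> borel_measurable \<mu>"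
      "\<And>i. (\<integral>\<^sup>+ x. U i x \<partial>N) = (\<integral>\<^sup>+ x. del (U i) x \<partial>\<mu>)" using seq(1,3) mN by blast+
    have inc: "incseq (\<lambda>i. U i z)" for z
      using seq(4) unfolding incseq_def le_fun_def by blast
    have d: "del (SUP i. U i) = (\<lambda>x. SUP i. del (U i) x)"
    proof (rule ext)
      fix x
      show "del (SUP i. U i) x = (SUP i. del (U i) x)"
        unfolding del_def case_prod_unfold SUP_apply by (rule ennreal_SUP_sum[symmetric]) (rule inc)
    qed
    have incd: "incseq (\<lambda>i. del (U i))"
    proof (intro incseq_SucI le_funI)
      fix i x
      show "del (U i) x \<le> del (U (Suc i)) x"
        unfolding del_def case_prod_unfold by (rule sum_mono) (rule incseq_SucD[OF inc])
    qed
    have "(\<integral>\<^sup>+ x. (SUP i. U i) x \<partial>N) = (SUP i. \<integral>\<^sup>+ x. U i x \<partial>N)"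
      unfolding SUP_apply by (rule nn_integral_monotone_convergence_SUP[OF seq(4) U(1)])
    also have "\<dots> = (SUP i. \<integral>\<^sup>+ x. del (U i) x \<partial>\<mu>)" unfolding U(3) ..
    also have "\<dots> = (\<integral>\<^sup>+ x. (SUP i. del (U i) x) \<partial>\<mu>)"
      by (rule nn_integral_monotone_convergence_SUP[OF incd U(2), symmetric])
    finally have "(\<integral>\<^sup>+ x. (SUP i. U i) x \<partial>N) = (\<integral>\<^sup>+ x. (SUP i. del (U i) x) \<partial>\<mu>)" .
    moreover have "(\<lambda>x. SUP i. del (U i) x) \<in> borel_measurable \<mu>"
      by (rule borel_measurable_SUP) (use U(2) in auto)
    ultimately show ?case unfolding d by blast
  qed
  have p: "is_vec_measure \<mu> N"
    unfolding is_vec_measure_def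
  proof (intro conjI allI impI sN)
    fix f :: "hsstar \<Rightarrow> real" assume f: "f \<in> borel_measurable borel" "\<forall>x. 0 \<le> f x"
    have "(\<lambda>x. ennreal (f x)) \<in> borel_measurable borel" using f(1) by measurable
    then have "(\<integral>\<^sup>+ x. ennreal (f x) \<partial>N) = (\<integral>\<^sup>+ x. del (\<lambda>x. ennreal (f x)) x \<partial>\<mu>)" using main by blast
    moreover have "del (\<lambda>x. ennreal (f x)) x = ennreal (del f x)" for x
      using f(2) by (simp add: del_def case_prod_unfold sum_ennreal)
    ultimately show "(\<integral>\<^sup>+ x. ennreal (f x) \<partial>N) = (\<integral>\<^sup>+ x. ennreal (del f x) \<partial>\<mu>)" by simp
  qed
  have "vec_measure \<mu> = N" unfolding vec_measure_def
    by (rule the_equality, rule p, rule vec_measure_unique[OF _ p])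
  then show ?thesis using p by simp
qed

definition unimodular :: "hstar measure \<Rightarrow> bool" where
  "unimodular \<mu> \<longleftrightarrow>
     (\<forall>f :: hsstar \<Rightarrow> real. f \<in> borel_measurable borel \<longrightarrow> (\<forall>x. 0 \<le> f x) \<longrightarrow>
        (\<integral>\<^sup>+ x. ennreal (f x) \<partial>vec_measure \<mu>) = (\<integral>\<^sup>+ x. ennreal (nabla f x) \<partial>vec_measure \<mu>))"


section \<open>Borel allocations\<close>

definition borel_allocation :: "(hsstar \<Rightarrow> real) \<Rightarrow> bool" where
  "borel_allocation \<Theta> \<longleftrightarrow> \<Theta> \<in> borel_measurable borel \<and> (\<forall>x. 0 \<le> \<Theta> x \<and> \<Theta> x \<le> 1) \<and>
     (\<forall>(H :: nat pre_hypergraph) e i. erooted (H, e, i) \<longrightarrow> (\<Sum>j\<in>e. \<Theta> (eclass H e j)) = 1)"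

definition balanced_wrt :: "(hsstar \<Rightarrow> real) \<Rightarrow> hstar measure \<Rightarrow> bool" where
  "balanced_wrt \<Theta> \<mu> \<longleftrightarrow>
     (AE x in vec_measure \<mu>. \<forall>(H :: nat pre_hypergraph) e i. erooted (H, e, i) \<and> eclass H e i = x \<longrightarrow>
        (\<forall>j1\<in>e. \<forall>j2\<in>e. del \<Theta> (vclass H j1) > del \<Theta> (vclass H j2) \<longrightarrow> \<Theta> (eclass H e j1) = 0))"

text \<open>
  The integral \<open>\<integral> f \<circ> \<partial>\<Theta> d\<mu>\<close> of a nonnegative function \<open>f\<close>, with values in \<open>[0, \<infinity>]\<close>. As \<open>\<partial>\<Theta> \<ge> 0\<close>, only the
  values of \<open>f\<close> on \<open>[0, \<infinity>)\<close> matter. For a rapidly growing \<open>f\<close> the integral may be infinite for every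
  Borel allocation; then every Borel allocation attains the least value, balanced or not.
\<close>

definition load_cost :: "hstar measure \<Rightarrow> (real \<Rightarrow> real) \<Rightarrow> (hsstar \<Rightarrow> real) \<Rightarrow> ennreal" where
  "load_cost \<mu> f \<Theta> = (\<integral>\<^sup>+ x. ennreal (f (del \<Theta> x)) \<partial>\<mu>)"

definition strictly_convex_on :: "real set \<Rightarrow> (real \<Rightarrow> real) \<Rightarrow> bool" where
  "strictly_convex_on S f \<longleftrightarrow> convex S \<and>
     (\<forall>x\<in>S. \<forall>y\<in>S. \<forall>u. x \<noteq> y \<and> 0 < u \<and> u < 1 \<longrightarrow>
        f ((1 - u) * x + u * y) < (1 - u) * f x + u * f y)"


section \<open>Local weak convergence\<close>

definition converges_weakly :: "(nat \<Rightarrow> 'a::topological_space measure) \<Rightarrow> 'a measure \<Rightarrow> bool" where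
  "converges_weakly M N \<longleftrightarrow>
     (\<forall>f :: 'a \<Rightarrow> real. continuous_on UNIV f \<and> bounded (range f) \<longrightarrow>
        (\<lambda>n. \<integral>x. f x \<partial>M n) \<longlonglongrightarrow> (\<integral>x. f x \<partial>N))"

definition rooted_law :: "'v pre_hypergraph \<Rightarrow> hstar measure" where
  "rooted_law H = distr (uniform_count_measure (verts H)) borel (\<lambda>i. vclass (component H i) i)"

definition load_law :: "'v pre_hypergraph \<Rightarrow> ('v set \<Rightarrow> 'v \<Rightarrow> real) \<Rightarrow> real measure" where
  "load_law H \<theta> = distr (uniform_count_measure (verts H)) borel (load H \<theta>)"

end

theory Submission
  imports Defs
begin

text \<open>
  Everything rests on one linear duality. Let \<open>g\<close> be a bounded Borel function on \<open>\<H>\<^sub>*\<close> and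
  \<open>\<Theta>\<close> a Borel allocation. Unimodularity allows the mass \<open>g(H,i) \<Theta>(H,e,i)\<close> to be spread evenly over
  the edge \<open>e\<close>, so that \<open>\<integral> g \<partial>\<Theta> d\<mu>\<close> is the \<open>\<nu>\<close>-integral of \<open>(\<Sum>j\<in>e. g(H,j) \<Theta>(H,e,j)) / |e|\<close>, where
  \<open>\<nu>\<close> is the measure \<open>vec_measure \<mu>\<close>. The weights \<open>\<Theta>(H,e,j)\<close> of an edge sum to 1, hence this is at
  least \<open>\<integral> fmin g d\<nu>\<close> (\<open>weak_duality\<close>), with equality iff almost every edge gives its mass only to
  vertices that minimise \<open>g\<close> on it (\<open>duality_eq_iff\<close>). For every \<open>g\<close> some allocation does so
  (\<open>argmin_allocation\<close>). Being balanced means that \<open>\<Theta>\<close> itself does so when \<open>g\<close> is an increasing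
  function of the load \<open>\<partial>\<Theta>\<close> (\<open>balanced_duality\<close>), and one strictly increasing function of the load is
  enough to recognise a balanced allocation (\<open>balanced_iff_duality\<close>).

  Existence: let \<open>\<Theta>\<close> minimise the convex functional \<open>\<integral> exp (- \<partial>\<Theta>) d\<mu>\<close>. Its derivative towards any
  other allocation is nonnegative, which says that \<open>\<Theta>\<close> minimises \<open>\<integral> g \<partial>\<Theta>' d\<mu>\<close> over all \<open>\<Theta>'\<close> for
  \<open>g = - exp (- \<partial>\<Theta>)\<close>. The minimum is \<open>\<integral> fmin g d\<nu>\<close>, so \<open>\<Theta>\<close> is balanced. The functional depends on
  \<open>\<Theta>\<close> through its load only, so a minimising sequence need not converge; one of nearly minimal norm in
  \<open>L\<^sup>2(\<nu>)\<close> does, by the parallelogram identity (\<open>exp_load_minimiser\<close>).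

  The variational formula is the duality for indicators \<open>f\<close>, as \<open>(x - t)\<^sup>+ = max {f * (x - t) | 0 \<le> f \<le> 1}\<close>.
  If \<open>h\<close> is convex with bounded slopes, its slope at \<open>\<partial>\<Theta>\<close> is an increasing function of the load, so the
  tangent inequality and duality give \<open>\<integral> h \<circ> \<partial>\<Theta> d\<mu> \<le> \<integral> h \<circ> \<partial>\<Theta>' d\<mu>\<close> for balanced \<open>\<Theta>\<close>
  (\<open>balanced_minimises_lipschitz\<close>). A general convex cost is an increasing limit of such \<open>h\<close>, up to a
  possible jump at \<open>0\<close> (\<open>convex_on_decomposition\<close>). Two minimisers of a strictly convex cost have
  the same load, by comparison with their midpoint, and the duality criterion for balancedness sees
  only the load.

  Local weak limits: mass of the degree distribution may escape along the sequence, so only bounded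
  functions of the load can be followed. The hinge functions \<open>(t - x)\<^sup>+\<close> are bounded on loads, and they
  determine the law. The loads of a finite hypergraph satisfy the same duality. For the upper bound
  they are compared with allocations that depend on a finite neighbourhood only; these are dense
  (\<open>local_allocations_dense\<close>) and have continuous loads. For the lower bound they are tested
  against local functions \<open>h\<close> that vanish near vertices of large degree, which makes the dual
  functional bounded and continuous (\<open>deficit_lower\<close>).
\<close>



section \<open>Local geometry\<close>

text \<open>
  A path of length at most \<open>m\<close> from a neighbour of \<open>i\<close> does not leave the ball of
  radius \<open>m + 1\<close> around \<open>i\<close>, so balls around neighbours can be read off from a ball
  that is larger by one.
\<close>

lemma hnbhd_hball:
  assumes H: "hypergraph H" and i: "i \<in> verts H" and j: "j \<in> hnbhd H i 1"
  shows "hnbhd (hball H i (Suc m)) j m = hnbhd H j m"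
proof -
  interpret hypergraph H by fact
  let ?B = "hball H i (Suc m)"
  have near: "hnbhd H j n \<subseteq> hnbhd H i (Suc n)" for n
  proof (induction n)
    case 0
    then show ?case using hnbhd_0[of j H] j hnbhd_subset[of H i 1] by auto
  next
    case (Suc n)
    have "j \<in> verts H" using j hnbhd_subset[of H i 1] by auto
    then show ?case unfolding hnbhd_Suc[OF \<open>j \<in> verts H\<close>, of n] hnbhd_Suc[OF i, of "Suc n"]
      using Suc by blast
  qed
  have jB: "j \<in> verts ?B" using j hnbhd_mono[of 1 "Suc m" H i] by auto
  have up: "hpath H n j k" if "hpath ?B n j k" for n k
    using that jB hnbhd_subset[of H i "Suc m"] unfolding hpath_def by (auto 4 4)
  have down: "hpath ?B n j k" if "hpath H n j k" "n \<le> m" for n k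
    using that
  proof (induction n arbitrary: k)
    case 0
    then show ?case using jB by (auto simp: hpath_0)
  next
    case (Suc n)
    then obtain l e where l: "hpath H n j l" "e \<in> edges H" "l \<in> e" "k \<in> e" by (auto simp: hpath_Suc)
    have "l \<in> hnbhd H j n" using l edge_subset by (auto simp: hnbhd_iff)
    then have "l \<in> hnbhd H i (Suc n)" using near by blast
    then have "e \<subseteq> hnbhd H i (Suc (Suc n))" unfolding hnbhd_Suc[OF i, of "Suc n"] using l by blast
    then have "e \<in> edges ?B" using l hnbhd_mono[of "Suc (Suc n)" "Suc m" H i] Suc.prems by auto
    then show ?case unfolding hpath_Suc using l Suc by auto
  qed
  show ?thesis
  proof (intro equalityI subsetI)
    fix k assume "k \<in> hnbhd ?B j m"
    then show "k \<in> hnbhd H j m" using up hnbhd_subset[of H i "Suc m"] by (auto simp: hnbhd_iff[of k])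
  next
    fix k assume k: "k \<in> hnbhd H j m"
    then have "k \<in> verts ?B" using near by auto
    then show "k \<in> hnbhd ?B j m" using k down by (auto simp: hnbhd_iff[of k])
  qed
qed

lemma hball_hball:
  assumes "hypergraph H" "i \<in> verts H" "j \<in> hnbhd H i 1"
  shows "hball (hball H i (Suc m)) j m = hball H j m"
proof -
  have "hnbhd H j m \<subseteq> hnbhd H i (Suc m)"
    using hnbhd_hball[OF assms, of m] hnbhd_subset[of "hball H i (Suc m)" j m] by simp
  then have "{e \<in> edges (hball H i (Suc m)). e \<subseteq> hnbhd H j m} = {e \<in> edges H. e \<subseteq> hnbhd H j m}" by auto
  then show ?thesis
    unfolding hball_def[of "hball H i (Suc m)"] hball_def[of H j] hnbhd_hball[OF assms] hrestrict_def by simp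
qed

lemma hypergraph_hball:
  assumes "hypergraph H" shows "hypergraph (hball H i m)"
proof -
  interpret hypergraph H by fact
  show ?thesis
  proof
    show "countable (verts (hball H i m))"
      using countable_subset[OF hnbhd_subset countable_verts] by simp
    show "finite {e \<in> edges (hball H i m). j \<in> e}" if "j \<in> verts (hball H i m)" for j
    proof -
      have "j \<in> verts H" using that hnbhd_subset[of H i m] by auto
      then show ?thesis by (rule finite_subset[OF _ locally_finite, rotated]) auto
    qed
  qed (use edge_finite edge_nonempty in auto)
qed

text \<open>
  The root vertex can be moved within the root edge at the cost of one unit of radius. This is what makes sums
  and minima over the root edge of local functions local again.
\<close>

lemma eeq_reroot:
  assumes r: "erooted (H, e, i)" "erooted (K, f, l)" and eq: "eeq (Suc m) (H, e, i) (K, f, l)"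
  obtains \<phi> where "bij_betw \<phi> e f" "\<phi> i = l" "\<And>j. j \<in> e \<Longrightarrow> eeq m (H, e, j) (K, f, \<phi> j)"
proof -
  interpret H: hypergraph H using r by simp
  interpret K: hypergraph K using r by simp
  obtain \<phi> where \<phi>: "hiso \<phi> (hball H i (Suc m)) (hball K l (Suc m))" "\<phi> ` e = f" "\<phi> i = l"
    using eq by auto
  have i: "i \<in> verts H" and l: "l \<in> verts K" using r H.edge_subset K.edge_subset by auto
  have e: "e \<subseteq> hnbhd H i 1" and f: "f \<subseteq> hnbhd K l 1"
    using r H.edge_subset_hnbhd_1[of e i 1] K.edge_subset_hnbhd_1[of f l 1] by auto
  then have eb: "e \<subseteq> hnbhd H i (Suc m)" using hnbhd_mono[of 1 "Suc m" H i] by auto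
  have "inj_on \<phi> (hnbhd H i (Suc m))" using \<phi>(1) by (auto simp: hiso_def bij_betw_def)
  then have "bij_betw \<phi> e f" using \<phi>(2) eb by (auto simp: bij_betw_def intro: inj_on_subset)
  moreover have "eeq m (H, e, j) (K, f, \<phi> j)" if j: "j \<in> e" for j
  proof -
    have "hiso \<phi> (hball (hball H i (Suc m)) j m) (hball (hball K l (Suc m)) (\<phi> j) m)"
      by (rule hiso_imp_hiso_hball[OF hypergraph_hball[OF H.hypergraph_axioms] \<phi>(1)]) (use j eb in auto)
    moreover have "\<phi> j \<in> hnbhd K l 1" using f \<phi>(2) j by auto
    ultimately have "hiso \<phi> (hball H j m) (hball K (\<phi> j) m)"
      using hball_hball[OF H.hypergraph_axioms i] hball_hball[OF K.hypergraph_axioms l] j e by auto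
    then show ?thesis using \<phi>(2) by auto
  qed
  ultimately show ?thesis using that \<phi>(3) by blast
qed

section \<open>Functionals of stars and edges\<close>

text \<open>
  \<open>sibs x\<close> collects the classes that arise from \<open>x\<close> by moving the root within the root
  edge. It is a set, so vertices that are exchanged by an automorphism give the same element;
  \<open>esum\<close> therefore sums over the vertices of a representative. In the same way \<open>star
  v\<close> is the range of the sum in \<open>\<partial>\<close>.
\<close>

definition sibs :: "hsstar \<Rightarrow> hsstar set" where
  "sibs x = (case rep_hsstar x of (H, e, i) \<Rightarrow> eclass H e ` e)"

definition star :: "hstar \<Rightarrow> hsstar set" where
  "star v = (case rep_hstar v of (H, i) \<Rightarrow> (\<lambda>e. eclass H e i) ` {e \<in> edges H. i \<in> e})"

definition esum :: "(hsstar \<Rightarrow> real) \<Rightarrow> hsstar \<Rightarrow> real" where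
  "esum f x = (case rep_hsstar x of (H, e, i) \<Rightarrow> \<Sum>j\<in>e. f (eclass H e j))"

definition ecard :: "hsstar \<Rightarrow> real" where
  "ecard = esum (\<lambda>_. 1)"

definition vroot :: "hsstar \<Rightarrow> hstar" where
  "vroot x = (case rep_hsstar x of (H, e, i) \<Rightarrow> vclass H i)"

lemma erooted_vrooted: "erooted (H, e, i) \<Longrightarrow> vrooted (H, i)"
  using hypergraph.edge_subset[of H e] by auto

lemma hsstar_cases:
  obtains H :: "nat pre_hypergraph" and e i where "erooted (H, e, i)" "x = eclass H e i" "rep_hsstar x = (H, e, i)"
  using erooted_rep[of x] eclass_rep[of x] by (cases "rep_hsstar x") metis

lemma hstar_cases:
  obtains H :: "nat pre_hypergraph" and i where "vrooted (H, i)" "v = vclass H i" "rep_hstar v = (H, i)"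
  using vrooted_rep[of v] vclass_rep[of v] by (cases "rep_hstar v") metis

lemma sibs_eclass:
  assumes "erooted (H, e, i)" shows "sibs (eclass H e i) = eclass H e ` e"
proof -
  obtain K \<phi> where x: "rep_hsstar (eclass H e i) = (K, \<phi> ` e, \<phi> i)" and h: "hiso \<phi> H K"
    using rep_eclassE[OF assms] .
  have "eclass K (\<phi> ` e) (\<phi> j) = eclass H e j" if "j \<in> e" for j
    using eclass_hiso[OF _ h, of e j] assms that by simp
  then show ?thesis by (auto simp: sibs_def x image_image)
qed

lemma esum_eclass:
  assumes "erooted (H, e, i)" shows "esum f (eclass H e i) = (\<Sum>j\<in>e. f (eclass H e j))"
proof -
  obtain K \<phi> where x: "rep_hsstar (eclass H e i) = (K, \<phi> ` e, \<phi> i)" and h: "hiso \<phi> H K"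
    using rep_eclassE[OF assms] .
  have H: "hypergraph H" "e \<in> edges H" using assms by auto
  have "(\<Sum>j\<in>\<phi> ` e. f (eclass K (\<phi> ` e) j)) = (\<Sum>j\<in>e. f (eclass K (\<phi> ` e) (\<phi> j)))"
    by (rule sum.reindex_bij_betw[symmetric, OF hiso_edge(1)[OF H(1) h H(2)]])
  also have "\<dots> = (\<Sum>j\<in>e. f (eclass H e j))"
    using eclass_hiso[OF _ h, of e] assms by (intro sum.cong) auto
  finally show ?thesis by (simp add: esum_def x)
qed

lemma vroot_eclass:
  assumes "erooted (H, e, i)" shows "vroot (eclass H e i) = vclass H i"
proof -
  obtain K \<phi> where x: "rep_hsstar (eclass H e i) = (K, \<phi> ` e, \<phi> i)" and h: "hiso \<phi> H K"
    using rep_eclassE[OF assms] .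
  show ?thesis using vclass_hiso[OF erooted_vrooted[OF assms] h] by (simp add: vroot_def x)
qed

lemma ecard_eclass: "erooted (H, e, i) \<Longrightarrow> ecard (eclass H e i) = real (card e)"
  by (simp add: ecard_def esum_eclass del: erooted.simps)

lemma star_vclass:
  assumes "vrooted (H, i)" shows "star (vclass H i) = (\<lambda>e. eclass H e i) ` {e \<in> edges H. i \<in> e}"
proof -
  obtain K \<phi> where x: "rep_hstar (vclass H i) = (K, \<phi> i)" and h: "hiso \<phi> H K"
    using rep_vclassE[OF assms] .
  have "{e \<in> edges K. \<phi> i \<in> e} = (`) \<phi> ` {e \<in> edges H. i \<in> e}"
    using hiso_incident[OF _ _ h, of i] assms by (auto simp: bij_betw_def)
  moreover have "eclass K (\<phi> ` e) (\<phi> i) = eclass H e i" if "e \<in> edges H" "i \<in> e" for e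
    using eclass_hiso[OF _ h, of e i] assms that by simp
  ultimately show ?thesis by (auto simp: star_def x image_image)
qed

lemma sibs_self: "x \<in> sibs x"
  by (rule hsstar_cases[of x]) (auto simp: sibs_eclass simp del: erooted.simps intro: erooted.simps[THEN iffD1, elim_format])

lemma finite_sibs [simp]: "finite (sibs x)"
proof (rule hsstar_cases[of x])
  fix H :: "nat pre_hypergraph" and e i assume "erooted (H, e, i)" "x = eclass H e i"
  then show ?thesis using hypergraph.edge_finite[of H e] sibs_eclass[of H e i] by simp
qed

lemma sibs_nonempty [simp]: "sibs x \<noteq> {}"
  using sibs_self by blast

lemma sibs_E:
  assumes "y \<in> sibs x"
  obtains H :: "nat pre_hypergraph" and e i j where "erooted (H, e, i)" "erooted (H, e, j)" "x = eclass H e i" "y = eclass H e j"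
proof (rule hsstar_cases[of x])
  fix H :: "nat pre_hypergraph" and e i assume *: "erooted (H, e, i)" "x = eclass H e i"
  then obtain j where "j \<in> e" "y = eclass H e j" using assms by (auto simp: sibs_eclass simp del: erooted.simps)
  with * that show ?thesis by auto
qed

lemma sibs_sibs: "y \<in> sibs x \<Longrightarrow> sibs y = sibs x"
  by (erule sibs_E) (simp add: sibs_eclass del: erooted.simps)

lemma esum_sibs: "y \<in> sibs x \<Longrightarrow> esum f y = esum f x"
  by (erule sibs_E) (simp add: esum_eclass del: erooted.simps)

lemma ecard_ge_1: "1 \<le> ecard x"
proof (rule hsstar_cases[of x])
  fix H :: "nat pre_hypergraph" and e i assume *: "erooted (H, e, i)" "x = eclass H e i"
  then have "finite e" "e \<noteq> {}" using hypergraph.edge_finite[of H e] by auto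
  then have "1 \<le> card e" by (simp add: Suc_le_eq card_gt_0_iff)
  then show ?thesis using * by (simp add: ecard_eclass del: erooted.simps)
qed

lemma ecard_pos [simp]: "0 < ecard x"
  using ecard_ge_1[of x] by linarith

lemma esum_cong:
  assumes "\<And>y. y \<in> sibs x \<Longrightarrow> f y = g y" shows "esum f x = esum g x"
proof (rule hsstar_cases[of x])
  fix H :: "nat pre_hypergraph" and e i assume *: "erooted (H, e, i)" "x = eclass H e i"
  then show ?thesis using assms by (auto simp: esum_eclass sibs_eclass simp del: erooted.simps intro!: sum.cong)
qed

lemma esum_mono:
  assumes "\<And>y. y \<in> sibs x \<Longrightarrow> f y \<le> g y" shows "esum f x \<le> esum g x"
proof (rule hsstar_cases[of x])
  fix H :: "nat pre_hypergraph" and e i assume *: "erooted (H, e, i)" "x = eclass H e i"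
  then show ?thesis using assms by (auto simp: esum_eclass sibs_eclass simp del: erooted.simps intro!: sum_mono)
qed

lemma esum_add: "esum (\<lambda>y. f y + g y) x = esum f x + esum g x"
  by (simp add: esum_def case_prod_unfold sum.distrib)

lemma esum_diff: "esum (\<lambda>y. f y - g y) x = esum f x - esum g x"
  by (simp add: esum_def case_prod_unfold sum_subtractf)

lemma esum_cmult: "esum (\<lambda>y. c * f y) x = c * esum f x"
  by (simp add: esum_def case_prod_unfold sum_distrib_left)

lemma esum_const: "esum (\<lambda>_. c) x = c * ecard x"
  using esum_cmult[of c "\<lambda>_. 1" x] by (simp add: ecard_def)

lemma esum_nonneg: "(\<And>y. y \<in> sibs x \<Longrightarrow> 0 \<le> f y) \<Longrightarrow> 0 \<le> esum f x"
  using esum_mono[of x "\<lambda>_. 0" f] by (simp add: esum_const)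

lemma esum_member_le:
  assumes "\<And>y. y \<in> sibs x \<Longrightarrow> 0 \<le> f y" "z \<in> sibs x" shows "f z \<le> esum f x"
proof (rule hsstar_cases[of x])
  fix H :: "nat pre_hypergraph" and e i assume *: "erooted (H, e, i)" "x = eclass H e i"
  then have "finite e" using hypergraph.edge_finite[of H e] by auto
  moreover obtain j where "j \<in> e" "z = eclass H e j" using assms * by (auto simp: sibs_eclass simp del: erooted.simps)
  ultimately show ?thesis unfolding *(2) esum_eclass[OF *(1)]
    using assms(1) * member_le_sum[of j e "\<lambda>j. f (eclass H e j)"] by (auto simp: sibs_eclass simp del: erooted.simps)
qed

lemma esum_eq_0_iff:
  assumes "\<And>y. y \<in> sibs x \<Longrightarrow> 0 \<le> f y" shows "esum f x = 0 \<longleftrightarrow> (\<forall>y\<in>sibs x. f y = 0)"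
proof
  assume "esum f x = 0"
  then show "\<forall>y\<in>sibs x. f y = 0" using esum_member_le[of x f] assms by (metis antisym)
next
  assume "\<forall>y\<in>sibs x. f y = 0"
  then show "esum f x = 0" using esum_cong[of x f "\<lambda>_. 0"] by (simp add: esum_const)
qed

lemma tendsto_esum:
  assumes "\<And>y. y \<in> sibs x \<Longrightarrow> (\<lambda>n. f n y) \<longlonglongrightarrow> g y" shows "(\<lambda>n. esum (f n) x) \<longlonglongrightarrow> esum g x"
proof (rule hsstar_cases[of x])
  fix H :: "nat pre_hypergraph" and e i assume *: "erooted (H, e, i)" "x = eclass H e i"
  then show ?thesis using assms by (auto simp: esum_eclass sibs_eclass simp del: erooted.simps intro!: tendsto_sum)
qed

lemma nabla_esum: "nabla f x = esum f x / ecard x"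
proof (rule hsstar_cases[of x])
  fix H :: "nat pre_hypergraph" and e i assume *: "erooted (H, e, i)" "x = eclass H e i"
  then show ?thesis by (simp add: nabla_eclass esum_eclass ecard_eclass del: erooted.simps)
qed

definition emin :: "(hsstar \<Rightarrow> real) \<Rightarrow> hsstar \<Rightarrow> real" where
  "emin f x = Min (f ` sibs x)"

text \<open>
  Expresses \<open>fmin\<close> through functions on \<open>\<H>\<^sub>*\<^sub>*\<close> only, so that it can be
  compared with \<open>esum\<close>.
\<close>

lemma fmin_emin: "fmin g x = emin (\<lambda>y. g (vroot y)) x / ecard x"
proof (rule hsstar_cases[of x])
  fix H :: "nat pre_hypergraph" and e i assume *: "erooted (H, e, i)" "x = eclass H e i"
  then have "vroot (eclass H e j) = vclass H j" if "j \<in> e" for j using vroot_eclass[of H e j] that by auto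
  then have "(\<lambda>y. g (vroot y)) ` eclass H e ` e = (\<lambda>j. g (vclass H j)) ` e" by (auto simp: image_image)
  then show ?thesis using * by (simp add: fmin_eclass emin_def sibs_eclass ecard_eclass del: erooted.simps)
qed

lemma emin_le: "y \<in> sibs x \<Longrightarrow> emin f x \<le> f y"
  unfolding emin_def by simp

lemma emin_attained: obtains y where "y \<in> sibs x" "f y = emin f x"
proof -
  have "Min (f ` sibs x) \<in> f ` sibs x" by (rule Min_in) simp_all
  then show ?thesis using that unfolding emin_def by (metis imageE)
qed

lemma emin_sibs: "y \<in> sibs x \<Longrightarrow> emin f y = emin f x"
  by (simp add: emin_def sibs_sibs)

lemma le_emin_iff: "c \<le> emin f x \<longleftrightarrow> (\<forall>y\<in>sibs x. c \<le> f y)"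
  unfolding emin_def by simp

lemma emin_cong: "(\<And>y. y \<in> sibs x \<Longrightarrow> f y = g y) \<Longrightarrow> emin f x = emin g x"
  unfolding emin_def by (simp cong: image_cong_simp)

lemma tendsto_emin:
  assumes "\<And>y. y \<in> sibs x \<Longrightarrow> (\<lambda>n. f n y) \<longlonglongrightarrow> g y" shows "(\<lambda>n. emin (f n) x) \<longlonglongrightarrow> emin g x"
proof -
  have "(\<lambda>n. Min (f n ` S)) \<longlonglongrightarrow> Min (g ` S)"
    if "finite S" "S \<noteq> {}" "\<And>y. y \<in> S \<Longrightarrow> (\<lambda>n. f n y) \<longlonglongrightarrow> g y" for S
    using that by (induction S rule: finite_ne_induct) (auto intro!: tendsto_min)
  then show ?thesis using assms unfolding emin_def by simp
qed

lemma vroot_star: "y \<in> star v \<Longrightarrow> vroot y = v"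
proof (rule hstar_cases[of v])
  fix H :: "nat pre_hypergraph" and i assume *: "vrooted (H, i)" "v = vclass H i" and "y \<in> star v"
  then obtain e where "e \<in> edges H" "i \<in> e" "y = eclass H e i" by (auto simp: star_vclass simp del: vrooted.simps)
  then show ?thesis using * vroot_eclass[of H e i] by auto
qed

lemma del_cong:
  assumes "\<And>y. y \<in> star v \<Longrightarrow> f y = g y" shows "del f v = del g v"
proof (rule hstar_cases[of v])
  fix H :: "nat pre_hypergraph" and i assume *: "vrooted (H, i)" "v = vclass H i"
  then show ?thesis using assms by (auto simp: del_vclass star_vclass simp del: vrooted.simps intro!: sum.cong)
qed

lemma del_mono:
  fixes f g :: "hsstar \<Rightarrow> real"
  assumes "\<And>y. y \<in> star v \<Longrightarrow> f y \<le> g y" shows "del f v \<le> del g v"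
proof (rule hstar_cases[of v])
  fix H :: "nat pre_hypergraph" and i assume *: "vrooted (H, i)" "v = vclass H i"
  then show ?thesis using assms by (auto simp: del_vclass star_vclass simp del: vrooted.simps intro!: sum_mono)
qed

lemma del_zero [simp]: "del (\<lambda>_. 0) v = 0"
  by (simp add: del_def case_prod_unfold)

lemma del_nonneg: "(\<And>y. 0 \<le> (f y :: real)) \<Longrightarrow> 0 \<le> del f v"
  using del_mono[of v "\<lambda>_. 0" f] by simp

lemma del_add: "del (\<lambda>y. f y + g y) v = del f v + del g v"
  by (simp add: del_def case_prod_unfold sum.distrib)

lemma del_cmult: "del (\<lambda>y. c * f y :: real) v = c * del f v"
  by (simp add: del_def case_prod_unfold sum_distrib_left)

lemma del_vroot_mult: "del (\<lambda>y. g (vroot y) * f y :: real) v = g v * del f v"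
  unfolding del_cmult[symmetric] by (rule del_cong) (simp add: vroot_star)

lemma del_one: "del (\<lambda>_. 1 :: real) v = real (hdeg v)"
proof (rule hstar_cases[of v])
  fix H :: "nat pre_hypergraph" and i assume *: "vrooted (H, i)" "v = vclass H i"
  then show ?thesis by (simp add: del_vclass hdeg_vclass del: vrooted.simps)
qed

lemma tendsto_del:
  fixes f :: "nat \<Rightarrow> hsstar \<Rightarrow> real"
  assumes "\<And>y. y \<in> star v \<Longrightarrow> (\<lambda>n. f n y) \<longlonglongrightarrow> g y" shows "(\<lambda>n. del (f n) v) \<longlonglongrightarrow> del g v"
proof (rule hstar_cases[of v])
  fix H :: "nat pre_hypergraph" and i assume *: "vrooted (H, i)" "v = vclass H i"
  then show ?thesis using assms by (auto simp: del_vclass star_vclass simp del: vrooted.simps intro!: tendsto_sum)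
qed

lemma star_vroot: "y \<in> star (vroot y)"
proof (rule hsstar_cases[of y])
  fix H :: "nat pre_hypergraph" and e i assume *: "erooted (H, e, i)" "y = eclass H e i"
  then have "e \<in> edges H" "i \<in> e" by auto
  then show ?thesis using star_vclass[OF erooted_vrooted[OF *(1)]] by (auto simp: *(2) vroot_eclass[OF *(1)])
qed

lemma finite_star [simp]: "finite (star v)"
proof (rule hstar_cases[of v])
  fix H :: "nat pre_hypergraph" and i assume *: "vrooted (H, i)" "v = vclass H i"
  then have "finite {e \<in> edges H. i \<in> e}" using hypergraph.locally_finite[of H i] by simp
  then show ?thesis using star_vclass[OF *(1)] *(2) by simp
qed

lemma del_eq_0_iff:
  fixes f :: "hsstar \<Rightarrow> real"
  assumes f: "\<And>y. 0 \<le> f y" shows "del f v = 0 \<longleftrightarrow> (\<forall>y\<in>star v. f y = 0)"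
proof (rule hstar_cases[of v])
  fix H :: "nat pre_hypergraph" and i assume *: "vrooted (H, i)" "v = vclass H i"
  then have "finite {e \<in> edges H. i \<in> e}" using hypergraph.locally_finite[of H i] by simp
  then show ?thesis unfolding *(2) del_vclass[OF *(1)] star_vclass[OF *(1)]
    by (subst sum_nonneg_eq_0_iff) (auto simp: f)
qed

section \<open>Local functions\<close>

text \<open>
  Functions of the ball of radius \<open>m\<close> around the root. For \<open>m \<ge> 1\<close> they are
  locally constant, hence both continuous and Borel.
\<close>

definition elocal :: "nat \<Rightarrow> (hsstar \<Rightarrow> 'a) \<Rightarrow> bool" where
  "elocal m F \<longleftrightarrow> (\<forall>x y. eeq m (rep_hsstar x) (rep_hsstar y) \<longrightarrow> F x = F y)"

definition vlocal :: "nat \<Rightarrow> (hstar \<Rightarrow> 'a) \<Rightarrow> bool" where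
  "vlocal m F \<longleftrightarrow> (\<forall>x y. veq m (rep_hstar x) (rep_hstar y) \<longrightarrow> F x = F y)"


lemma eclass_veq:
  assumes "erooted (H, e, i)" "erooted (K, f, j)" "eeq m (H, e, i) (K, f, j)" "1 \<le> m"
  shows "eeq m (rep_hsstar (eclass H e i)) (rep_hsstar (eclass K f j))"
  using eeq_trans[OF eeq_sym[OF assms(1,4) eiso_eeq[OF assms(1) rep_eclass[OF assms(1)]]]
      eeq_trans[OF assms(3) eiso_eeq[OF assms(2) rep_eclass[OF assms(2)]]]] .

lemma elocalD:
  assumes "elocal m F" "1 \<le> m" "erooted (H, e, i)" "erooted (K, f, j)" "eeq m (H, e, i) (K, f, j)"
  shows "F (eclass H e i) = F (eclass K f j)"
  using assms eclass_veq[OF assms(3-5,2)] unfolding elocal_def by blast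

lemma vlocalD:
  assumes "vlocal m F" "1 \<le> m" "vrooted (H, i)" "vrooted (K, j)" "veq m (H, i) (K, j)"
  shows "F (vclass H i) = F (vclass K j)"
proof -
  have "veq m (rep_hstar (vclass H i)) (rep_hstar (vclass K j))"
    using veq_trans[OF veq_sym[OF assms(3,2) viso_veq[OF assms(3) rep_vclass[OF assms(3)]]]
      veq_trans[OF assms(5) viso_veq[OF assms(4) rep_vclass[OF assms(4)]]]] .
  then show ?thesis using assms(1) unfolding vlocal_def by blast
qed

lemma elocal_mono: "elocal m F \<Longrightarrow> m \<le> n \<Longrightarrow> elocal n F"
  unfolding elocal_def using eeq_mono[OF erooted_rep erooted_rep] by blast

lemma vlocal_mono: "vlocal m F \<Longrightarrow> m \<le> n \<Longrightarrow> vlocal n F"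
  unfolding vlocal_def using veq_mono[OF vrooted_rep vrooted_rep] by blast

lemma elocal_indicator:
  assumes "1 \<le> m" "esat m A" shows "elocal m (indicat_real A)"
  unfolding elocal_def
proof (intro allI impI)
  fix x y assume "eeq m (rep_hsstar x) (rep_hsstar y)"
  then have "x \<in> A \<longleftrightarrow> y \<in> A" using assms eeq_sym[OF erooted_rep assms(1)] unfolding esat_def by blast
  then show "indicat_real A x = indicator A y" by (simp add: indicator_def)
qed

lemma elocal_const: "elocal m (\<lambda>_. c)"
  by (simp add: elocal_def)

lemma elocal_comp: "elocal m F \<Longrightarrow> elocal m (\<lambda>x. h (F x))"
  unfolding elocal_def by metis

lemma elocal_comp2: "elocal m F \<Longrightarrow> elocal m G \<Longrightarrow> elocal m (\<lambda>x. h (F x) (G x))"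
  unfolding elocal_def by metis

lemma vlocal_comp: "vlocal m F \<Longrightarrow> vlocal m (\<lambda>x. h (F x))"
  unfolding vlocal_def by metis

lemma vlocal_comp2: "vlocal m F \<Longrightarrow> vlocal m G \<Longrightarrow> vlocal m (\<lambda>x. h (F x) (G x))"
  unfolding vlocal_def by metis

lemma elocal_vroot:
  assumes "vlocal m F" "1 \<le> m" shows "elocal m (\<lambda>x. F (vroot x))"
  unfolding elocal_def
proof (intro allI impI)
  fix x y assume eq: "eeq m (rep_hsstar x) (rep_hsstar y)"
  show "F (vroot x) = F (vroot y)"
  proof (rule hsstar_cases[of x], rule hsstar_cases[of y])
    fix H K :: "nat pre_hypergraph" and e i f j
    assume *: "erooted (H, e, i)" "x = eclass H e i" "rep_hsstar x = (H, e, i)"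
      "erooted (K, f, j)" "y = eclass K f j" "rep_hsstar y = (K, f, j)"
    have v: "vrooted (H, i)" "vrooted (K, j)" by (rule erooted_vrooted, fact)+
    have "veq m (H, i) (K, j)" using eq unfolding *(3,6) by auto
    then show ?thesis unfolding *(2,5) vroot_eclass[OF *(1)] vroot_eclass[OF *(4)] by (rule vlocalD[OF assms v])
  qed
qed

text \<open>
  Stated for a given \<open>F\<close>, as a matching of the vertices of the two root edges along which
  \<open>F\<close> agrees; multiplicities in sums over the edge are thereby respected.
\<close>

lemma eeq_sibs_bij:
  assumes F: "elocal m F" and eq: "eeq (Suc m) (rep_hsstar x) (rep_hsstar y)" and m: "1 \<le> m"
  obtains H :: "nat pre_hypergraph" and e i and K :: "nat pre_hypergraph" and f j \<phi>
  where "erooted (H, e, i)" "x = eclass H e i" "erooted (K, f, j)" "y = eclass K f j" "bij_betw \<phi> e f"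
    "\<forall>l\<in>e. F (eclass H e l) = F (eclass K f (\<phi> l))"
proof (rule hsstar_cases[of x], rule hsstar_cases[of y])
  fix H K :: "nat pre_hypergraph" and e i f j
  assume *: "erooted (H, e, i)" "x = eclass H e i" "rep_hsstar x = (H, e, i)"
    "erooted (K, f, j)" "y = eclass K f j" "rep_hsstar y = (K, f, j)"
  obtain \<phi> where \<phi>: "bij_betw \<phi> e f" "\<And>l. l \<in> e \<Longrightarrow> eeq m (H, e, l) (K, f, \<phi> l)"
    using eeq_reroot[OF *(1,4) eq[unfolded *(3,6)]] by metis
  have "F (eclass H e l) = F (eclass K f (\<phi> l))" if "l \<in> e" for l
  proof (rule elocalD[OF F m _ _ \<phi>(2)[OF that]])
    show "erooted (H, e, l)" using * that by simp
    show "erooted (K, f, \<phi> l)" using * that \<phi>(1) by (auto simp: bij_betw_def)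
  qed
  then show ?thesis using that[OF *(1,2,4,5) \<phi>(1)] by blast
qed

lemma elocal_sibs:
  assumes "elocal m F" "1 \<le> m" shows "elocal (Suc m) (\<lambda>x. F ` sibs x)"
  unfolding elocal_def
proof (intro allI impI)
  fix x y assume "eeq (Suc m) (rep_hsstar x) (rep_hsstar y)"
  then obtain H :: "nat pre_hypergraph" and e i and K :: "nat pre_hypergraph" and f j \<phi> where
    *: "erooted (H, e, i)" "x = eclass H e i" "erooted (K, f, j)" "y = eclass K f j" "bij_betw \<phi> e f"
    "\<forall>l\<in>e. F (eclass H e l) = F (eclass K f (\<phi> l))"
    by (rule eeq_sibs_bij[OF assms(1) _ assms(2)])
  have "f = \<phi> ` e" using *(5) by (simp add: bij_betw_def)
  then show "F ` sibs x = F ` sibs y"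
    unfolding *(2,4) sibs_eclass[OF *(1)] sibs_eclass[OF *(3)] using *(6) by (auto simp: image_image)
qed

lemma elocal_esum:
  assumes "elocal m F" "1 \<le> m" shows "elocal (Suc m) (esum F)"
  unfolding elocal_def
proof (intro allI impI)
  fix x y assume "eeq (Suc m) (rep_hsstar x) (rep_hsstar y)"
  then obtain H :: "nat pre_hypergraph" and e i and K :: "nat pre_hypergraph" and f j \<phi> where
    *: "erooted (H, e, i)" "x = eclass H e i" "erooted (K, f, j)" "y = eclass K f j" "bij_betw \<phi> e f"
    "\<forall>l\<in>e. F (eclass H e l) = F (eclass K f (\<phi> l))"
    by (rule eeq_sibs_bij[OF assms(1) _ assms(2)])
  show "esum F x = esum F y"
    unfolding *(2,4) esum_eclass[OF *(1)] esum_eclass[OF *(3)]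
    using *(6) by (simp add: sum.reindex_bij_betw[OF *(5), symmetric])
qed

text \<open>
  All edges at the root lie in the ball of radius 1, so no radius is lost here.
\<close>

lemma vlocal_del:
  fixes F :: "hsstar \<Rightarrow> real"
  assumes F: "elocal m F" and m: "1 \<le> m" shows "vlocal m (del F)"
  unfolding vlocal_def
proof (intro allI impI)
  fix x y assume eq: "veq m (rep_hstar x) (rep_hstar y)"
  show "del F x = del F y"
  proof (rule hstar_cases[of x], rule hstar_cases[of y])
    fix H K :: "nat pre_hypergraph" and i j
    assume *: "vrooted (H, i)" "x = vclass H i" "rep_hstar x = (H, i)"
      "vrooted (K, j)" "y = vclass K j" "rep_hstar y = (K, j)"
    obtain \<phi> where \<phi>: "hiso \<phi> (hball H i m) (hball K j m)" "\<phi> i = j" using eq unfolding *(3,6) by auto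
    have inH: "{e \<in> edges (hball H i m). i \<in> e} = {e \<in> edges H. i \<in> e}"
      using hypergraph.edge_subset_hnbhd_1[of H _ i m] * m by auto
    have inK: "{e \<in> edges (hball K j m). j \<in> e} = {e \<in> edges K. j \<in> e}"
      using hypergraph.edge_subset_hnbhd_1[of K _ j m] * m by auto
    have i: "i \<in> verts (hball H i m)" using hnbhd_0[of i H] hnbhd_mono[of 0 m H i] * by auto
    have bij: "bij_betw ((`) \<phi>) {e \<in> edges H. i \<in> e} {e \<in> edges K. j \<in> e}"
      using hiso_incident[OF hypergraph_hball i \<phi>(1)] * unfolding \<phi>(2) inH inK by simp
    have "F (eclass H e i) = F (eclass K (\<phi> ` e) j)" if e: "e \<in> edges H" "i \<in> e" for e
    proof (rule elocalD[OF F m])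
      show "erooted (H, e, i)" using e * by simp
      show "erooted (K, \<phi> ` e, j)" using e * bij by (auto simp: bij_betw_def)
      show "eeq m (H, e, i) (K, \<phi> ` e, j)" using \<phi> by auto
    qed
    then show ?thesis unfolding *(2,5) del_vclass[OF *(1)] del_vclass[OF *(4)]
      by (simp add: sum.reindex_bij_betw[OF bij, symmetric])
  qed
qed

lemma vlocal_hdeg: "1 \<le> m \<Longrightarrow> vlocal m hdeg"
  using vlocal_del[of m "\<lambda>_. 1"] by (simp add: del_one elocal_const vlocal_def)

lemma elocal_measurable:
  fixes F :: "hsstar \<Rightarrow> 'a :: topological_space"
  assumes "elocal m F" "1 \<le> m" shows "F \<in> borel_measurable borel"
proof (rule borel_measurableI)
  fix S :: "'a set"
  have "esat m (F -` S)" using assms(1) by (auto simp: esat_def elocal_def)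
  then show "F -` S \<inter> space borel \<in> sets borel" using open_esat[OF assms(2)] by simp
qed

lemma vlocal_continuous:
  fixes F :: "hstar \<Rightarrow> 'a :: topological_space"
  assumes "vlocal m F" "1 \<le> m" shows "continuous_on UNIV F"
proof -
  have "open (F -` S)" for S
    unfolding open_dist
  proof (intro ballI exI conjI allI impI)
    fix x y assume x: "x \<in> F -` S" and "dist y x < 1 / (1 + real m)"
    then have "veq m (rep_hstar y) (rep_hstar x)" using hdist_less_hstar assms(2) by blast
    then show "y \<in> F -` S" using assms(1) x by (auto simp: vlocal_def)
  qed simp
  then show ?thesis by (simp add: continuous_on_open_vimage)
qed

lemma vlocal_measurable:
  fixes F :: "hstar \<Rightarrow> 'a :: topological_space"
  assumes "vlocal m F" "1 \<le> m" shows "F \<in> borel_measurable borel"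
  by (intro borel_measurable_continuous_onI vlocal_continuous[OF assms])

lemma vroot_measurable [measurable]: "vroot \<in> borel_measurable borel"
proof (rule borel_measurableI)
  fix S :: "hstar set" assume S: "open S"
  have "open (vroot -` S)"
    unfolding open_dist
  proof (intro ballI)
    fix x assume "x \<in> vroot -` S"
    then obtain d where d: "d > 0" "\<And>v. dist v (vroot x) < d \<Longrightarrow> v \<in> S" using S unfolding open_dist by auto
    obtain n where n: "1 / (1 + real n) < d"
      using reals_Archimedean[OF d(1)] by (auto simp: inverse_eq_divide add.commute)
    let ?B = "\<lambda>v. \<forall>k. 1 \<le> k \<and> k \<le> max 1 n \<longrightarrow> veq k (rep_hstar (vroot x)) (rep_hstar v)"
    have loc: "elocal (max 1 n) (\<lambda>z. ?B (vroot z))"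
    proof (rule elocal_vroot[OF _ max.cobounded1], unfold vlocal_def, intro allI impI)
      fix v w assume vw: "veq (max 1 n) (rep_hstar v) (rep_hstar w)"
      have "veq k (rep_hstar v) (rep_hstar w)" "veq k (rep_hstar w) (rep_hstar v)" if "1 \<le> k" "k \<le> max 1 n" for k
        using veq_mono[OF vrooted_rep vrooted_rep that(2) vw] veq_sym[OF vrooted_rep that(1)] by blast+
      then show "?B v = ?B w" using veq_trans by blast
    qed
    show "\<exists>e>0. \<forall>y. dist y x < e \<longrightarrow> y \<in> vroot -` S"
    proof (intro exI conjI allI impI)
      show "0 < 1 / (1 + real (max 1 n))" by simp
      fix y assume "dist y x < 1 / (1 + real (max 1 n))"
      then have "eeq (max 1 n) (rep_hsstar x) (rep_hsstar y)"
        using dist_hsstar_le[of x y "max 1 n"] by (simp add: dist_commute)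
      then have "?B (vroot x) = ?B (vroot y)" using loc unfolding elocal_def by blast
      then have "?B (vroot y)" using veq_refl by blast
      then have "agree_dist (\<lambda>m. veq m (rep_hstar (vroot x)) (rep_hstar (vroot y))) \<le> 1 / (1 + real (max 1 n))"
        by (subst agree_dist_le) (auto intro: veq_mono[OF vrooted_rep vrooted_rep])
      then have "dist (vroot x) (vroot y) \<le> 1 / (1 + real (max 1 n))" by (simp add: dist_hstar_def)
      also have "\<dots> \<le> 1 / (1 + real n)" by (intro divide_left_mono) auto
      finally show "y \<in> vroot -` S" using n d(2)[of "vroot y"] by (simp add: dist_commute)
    qed
  qed
  then show "vroot -` S \<inter> space borel \<in> sets borel" by simp
qed


section \<open>Measurability of the operators\<close>

text \<open>
  The local functions generate the Borel sets of \<open>\<H>\<^sub>*\<^sub>*\<close>. An operator that is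
  linear, respects pointwise limits and is measurable on local functions is therefore measurable on all Borel
  functions, first on indicators by a Dynkin system argument from the balls \<open>eballs\<close>, then by
  approximation. It is used for the two finite sums \<open>esum\<close> and \<open>\<partial>\<close>, whose
  numbers of terms are unbounded.
\<close>

lemma measurable_local_operator:
  fixes T :: "(hsstar \<Rightarrow> real) \<Rightarrow> 'b :: topological_space \<Rightarrow> real"
  assumes add: "\<And>f g x. T (\<lambda>y. f y + g y) x = T f x + T g x"
    and cmult: "\<And>c f x. T (\<lambda>y. c * f y) x = c * T f x"
    and lim: "\<And>f g x. (\<And>y. (\<lambda>n :: nat. f n y) \<longlonglongrightarrow> g y) \<Longrightarrow> (\<lambda>n. T (f n) x) \<longlonglongrightarrow> T g x"
    and loc: "\<And>m f. 1 \<le> m \<Longrightarrow> elocal m f \<Longrightarrow> T f \<in> borel_measurable borel"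
    and f: "f \<in> borel_measurable borel"
  shows "T f \<in> borel_measurable borel"
proof -
  have UN: "T (\<lambda>_. 1) \<in> borel_measurable borel" by (rule loc[of 1]) (simp_all add: elocal_const)
  have zero: "T (\<lambda>_. 0) x = 0" for x using cmult[of 0 "\<lambda>_. 0" x] by simp
  have ind: "T (indicator A) \<in> borel_measurable borel" if "A \<in> sets borel" for A
  proof -
    have "A \<in> sigma_sets UNIV (insert {} eballs)" using that unfolding sets_borel_eballs .
    with Int_stable_eballs Pow_UNIV[THEN equalityD2, THEN subset_trans[OF subset_UNIV]] show ?thesis
    proof (induct rule: sigma_sets_induct_disjoint)
      case (basic A)
      then have "\<exists>m\<ge>1. esat m A" using esat_eball by (auto simp: eballs_def esat_def)
      then obtain m where m: "1 \<le> m" "esat m A" by blast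
      show ?case by (rule loc[OF m(1) elocal_indicator[OF m]])
    next
      case empty
      have "(indicator {} :: hsstar \<Rightarrow> real) = (\<lambda>_. 0)" by (simp add: fun_eq_iff)
      then show ?case using zero by simp
    next
      case (compl A)
      have eq: "(indicator (UNIV - A) :: hsstar \<Rightarrow> real) = (\<lambda>y. 1 + (- 1) * indicator A y)"
        by (auto simp: indicator_def)
      have "T (indicator (UNIV - A)) = (\<lambda>x. T (\<lambda>_. 1) x + (- 1) * T (indicator A) x)"
        unfolding eq by (rule ext) (simp only: add cmult)
      then show ?case using UN compl by simp
    next
      case (union A)
      have step: "T (\<lambda>y. \<Sum>i<n. indicator (A i) y) = (\<lambda>x. \<Sum>i<n. T (indicator (A i)) x)" for n
        by (induction n) (simp_all add: zero add fun_eq_iff)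
      have "(\<lambda>n. \<Sum>i<n. indicator (A i) y) \<longlonglongrightarrow> (indicator (\<Union>i. A i) y :: real)" for y
      proof (cases "\<exists>k. y \<in> A k")
        case True
        then obtain k where "y \<in> A k" ..
        then have "(\<lambda>i. indicator (A i) y :: real) = (\<lambda>i. if i = k then 1 else 0)"
          using union(1) by (auto simp: fun_eq_iff indicator_def disjoint_family_on_def)
        then have "(\<lambda>i. indicator (A i) y :: real) sums 1" using sums_single[of k "\<lambda>_. 1 :: real"] by simp
        then show ?thesis using True by (simp add: sums_def indicator_def)
      qed (simp add: indicator_def)
      then have "(\<lambda>n. T (\<lambda>y. \<Sum>i<n. indicator (A i) y) x) \<longlonglongrightarrow> T (indicator (\<Union>i. A i)) x" for x
        by (rule lim)
      then have "(\<lambda>n. \<Sum>i<n. T (indicator (A i)) x) \<longlonglongrightarrow> T (indicator (\<Union>i. A i)) x" for x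
        unfolding step .
      moreover have "(\<lambda>x. \<Sum>i<n. T (indicator (A i)) x) \<in> borel_measurable borel" for n
        using union(3) by (intro borel_measurable_sum)
      ultimately show ?case by (rule borel_measurable_LIMSEQ_real)
    qed
  qed
  have nonneg: "T g \<in> borel_measurable borel" if "g \<in> borel_measurable borel" "\<And>x. 0 \<le> g x" for g
    using that
  proof (induction rule: borel_measurable_induct_real)
    case (set A) then show ?case using ind by simp
  next
    case (mult u c)
    have "T (\<lambda>x. c * u x) = (\<lambda>x. c * T u x)" using cmult by blast
    then show ?case using mult by simp
  next
    case (add u v)
    have "T (\<lambda>x. v x + u x) = (\<lambda>x. T v x + T u x)" using assms(1) by blast
    then show ?case using add by simp
  next
    case (seq U)
    have "(\<lambda>n. T (U n) x) \<longlonglongrightarrow> T g x" for x by (rule lim) (use seq in simp)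
    then show ?case by (rule borel_measurable_LIMSEQ_real) (rule seq.IH)
  qed
  have eq: "f = (\<lambda>y. max 0 (f y) + (- 1) * max 0 (- f y))" by (auto simp: max_def)
  have "T (\<lambda>y. max 0 (f y) + (- 1) * max 0 (- f y)) = (\<lambda>x. T (\<lambda>y. max 0 (f y)) x + (- 1) * T (\<lambda>y. max 0 (- f y)) x)"
    by (rule ext) (simp only: add cmult)
  then have "T f = (\<lambda>x. T (\<lambda>y. max 0 (f y)) x + (- 1) * T (\<lambda>y. max 0 (- f y)) x)"
    unfolding eq[symmetric] .
  moreover have "T (\<lambda>y. max 0 (f y)) \<in> borel_measurable borel" "T (\<lambda>y. max 0 (- f y)) \<in> borel_measurable borel"
    by (intro nonneg; use f in measurable)+
  ultimately show ?thesis by simp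
qed

lemma esum_measurable:
  "f \<in> borel_measurable borel \<Longrightarrow> esum f \<in> borel_measurable borel"
proof (rule measurable_local_operator[where T = esum])
  show "esum f \<in> borel_measurable borel" if "1 \<le> m" "elocal m f" for m f
    using elocal_measurable[OF elocal_esum[OF that(2,1)]] by simp
qed (auto simp: esum_add esum_cmult intro: tendsto_esum)

lemma del_measurable:
  fixes f :: "hsstar \<Rightarrow> real"
  shows "f \<in> borel_measurable borel \<Longrightarrow> del f \<in> borel_measurable borel"
proof (rule measurable_local_operator[where T = del])
  show "del f \<in> borel_measurable borel" if "1 \<le> m" "elocal m f" for m and f :: "hsstar \<Rightarrow> real"
    using vlocal_measurable[OF vlocal_del[OF that(2,1)] that(1)] .
qed (auto simp: del_add del_cmult intro: tendsto_del)

lemmas del_measurable_comp [measurable (raw)] = measurable_compose[OF _ del_measurable]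
lemmas esum_measurable_comp [measurable (raw)] = measurable_compose[OF _ esum_measurable]

lemma ecard_measurable [measurable]: "ecard \<in> borel_measurable borel"
  unfolding ecard_def by (rule esum_measurable) simp

lemma sibs_ball_measurable:
  assumes "{y. P y} \<in> sets borel" shows "{x. \<forall>y\<in>sibs x. P y} \<in> sets borel"
proof -
  have "(\<forall>y\<in>sibs x. P y) \<longleftrightarrow> esum (indicator {y. \<not> P y}) x = 0" for x
    by (subst esum_eq_0_iff) (auto simp: indicator_def)
  then have "{x. \<forall>y\<in>sibs x. P y} = {x \<in> space borel. esum (indicator {y. \<not> P y}) x = 0}" by simp
  moreover have "{y. \<not> P y} \<in> sets borel" using borel_comp[OF assms] by (simp add: Collect_neg_eq)
  ultimately show ?thesis by simp
qed

lemma emin_measurable: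
  assumes "f \<in> borel_measurable borel" shows "emin f \<in> borel_measurable borel"
  unfolding borel_measurable_iff_ge
proof
  fix a
  have "{y. a \<le> f y} \<in> sets borel" using assms unfolding borel_measurable_iff_ge by simp
  then show "{w \<in> space borel. a \<le> emin f w} \<in> sets borel"
    using sibs_ball_measurable[of "\<lambda>y. a \<le> f y"] by (simp add: le_emin_iff)
qed

lemmas emin_measurable_comp [measurable (raw)] = measurable_compose[OF _ emin_measurable]

lemma nabla_measurable: "f \<in> borel_measurable borel \<Longrightarrow> nabla f \<in> borel_measurable borel"
  unfolding nabla_esum[abs_def] by (intro borel_measurable_divide esum_measurable ecard_measurable)

lemma fmin_measurable:
  assumes "g \<in> borel_measurable borel" shows "fmin g \<in> borel_measurable borel"
  unfolding fmin_emin[abs_def]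
proof -
  have "(\<lambda>y. g (vroot y)) \<in> borel_measurable borel" using assms by measurable
  then show "(\<lambda>x. emin (\<lambda>y. g (vroot y)) x / ecard x) \<in> borel_measurable borel" by measurable
qed

lemma hdeg_measurable [measurable]: "hdeg \<in> measurable borel (count_space UNIV)"
proof -
  have "(\<lambda>v. real (hdeg v)) \<in> borel_measurable borel" unfolding del_one[symmetric] by measurable
  then have "(\<lambda>v. nat \<lfloor>real (hdeg v)\<rfloor>) \<in> measurable borel (count_space UNIV)" by measurable
  then show ?thesis by simp
qed

section \<open>Mass transport\<close>

lemma bounded_shift_nonneg: "\<bar>a\<bar> \<le> B \<Longrightarrow> 0 \<le> a + (B :: real)"
  by linarith

locale unimodular_measure =
  fixes \<mu> :: "hstar measure"
  assumes sets_\<mu>: "sets \<mu> = sets borel"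
    and prob_\<mu>: "prob_space \<mu>"
    and unimodular_\<mu>: "unimodular \<mu>"
    and mean_deg_\<mu>: "mean_deg \<mu> < \<infinity>"
begin

sublocale prob_space \<mu>
  by (rule prob_\<mu>)

abbreviation "\<nu> \<equiv> vec_measure \<mu>"

lemma sets_\<nu>: "sets \<nu> = sets borel"
  using vec_measure_exists[OF sets_\<mu>] by (simp add: is_vec_measure_def)

lemma space_\<mu> [simp]: "space \<mu> = UNIV"
  using sets_eq_imp_space_eq[OF sets_\<mu>] by simp

lemma space_\<nu> [simp]: "space \<nu> = UNIV"
  using sets_eq_imp_space_eq[OF sets_\<nu>] by simp

lemmas [measurable_cong] = sets_\<mu> sets_\<nu>

lemma nn_integral_\<nu>:
  assumes "f \<in> borel_measurable borel" "\<And>x. 0 \<le> f x"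
  shows "(\<integral>\<^sup>+ x. ennreal (f x) \<partial>\<nu>) = (\<integral>\<^sup>+ x. ennreal (del f x) \<partial>\<mu>)"
  using vec_measure_exists[OF sets_\<mu>] assms by (simp add: is_vec_measure_def)

lemma integrable_hdeg: "integrable \<mu> (\<lambda>v. real (hdeg v))"
  by (rule integrableI_bounded) (use mean_deg_\<mu> in \<open>simp_all add: mean_deg_def ennreal_of_nat_eq_real_of_nat\<close>)

sublocale vec: finite_measure \<nu>
proof
  have "emeasure \<nu> (space \<nu>) = (\<integral>\<^sup>+ x. ennreal 1 \<partial>\<nu>)" by simp
  also have "\<dots> = mean_deg \<mu>"
    using nn_integral_\<nu>[of "\<lambda>_. 1"] by (simp add: mean_deg_def del_one ennreal_of_nat_eq_real_of_nat)
  finally show "emeasure \<nu> (space \<nu>) \<noteq> \<infinity>" using mean_deg_\<mu> by simp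
qed

lemma integrable_\<nu>:
  fixes f :: "hsstar \<Rightarrow> real"
  shows "f \<in> borel_measurable borel \<Longrightarrow> (\<And>x. \<bar>f x\<bar> \<le> B) \<Longrightarrow> integrable \<nu> f"
  by (rule vec.integrable_const_bound[of _ B]) auto

lemma del_bound:
  fixes f :: "hsstar \<Rightarrow> real"
  assumes "\<And>y. \<bar>f y\<bar> \<le> B" shows "\<bar>del f v\<bar> \<le> B * real (hdeg v)"
proof -
  have "del f v \<le> B * real (hdeg v)" "- B * real (hdeg v) \<le> del f v"
    using assms abs_le_iff del_mono[of v f "\<lambda>_. B * 1"] del_mono[of v "\<lambda>_. - B * 1" f]
    unfolding del_cmult del_one by (auto simp: abs_le_iff minus_le_iff)
  then show ?thesis by simp
qed

lemma integrable_del: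
  fixes f :: "hsstar \<Rightarrow> real"
  assumes f: "f \<in> borel_measurable borel" "\<And>x. \<bar>f x\<bar> \<le> B" shows "integrable \<mu> (del f)"
proof (rule Bochner_Integration.integrable_bound)
  show "integrable \<mu> (\<lambda>v. B * real (hdeg v))" using integrable_hdeg by simp
  show "del f \<in> borel_measurable \<mu>" using del_measurable[OF f(1)] by simp
  show "AE v in \<mu>. norm (del f v) \<le> norm (B * real (hdeg v))"
    using order_trans[OF del_bound[OF f(2)] abs_ge_self] by simp
qed

lemma integral_\<nu>_nonneg:
  fixes f :: "hsstar \<Rightarrow> real"
  assumes f: "f \<in> borel_measurable borel" "\<And>x. 0 \<le> f x"
  shows "integral\<^sup>L \<nu> f = integral\<^sup>L \<mu> (del f)"
proof -
  have "del f \<in> borel_measurable borel" using f del_measurable by blast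
  then show ?thesis using f nn_integral_\<nu>[OF f] del_nonneg[of f]
    by (simp add: integral_eq_nn_integral)
qed

lemma integral_\<nu>:
  fixes f :: "hsstar \<Rightarrow> real"
  assumes f: "f \<in> borel_measurable borel" "\<And>x. \<bar>f x\<bar> \<le> B"
  shows "integral\<^sup>L \<nu> f = integral\<^sup>L \<mu> (del f)"
proof -
  have "integral\<^sup>L \<nu> (\<lambda>x. f x + B) = integral\<^sup>L \<mu> (del (\<lambda>x. f x + B))"
    using f by (intro integral_\<nu>_nonneg) (auto intro: bounded_shift_nonneg)
  moreover have "integral\<^sup>L \<nu> (\<lambda>x. B) = integral\<^sup>L \<mu> (del (\<lambda>x. B))"
    using f(2)[of undefined] by (intro integral_\<nu>_nonneg) auto
  moreover have "integrable \<nu> f" "integrable \<mu> (del f)" "integrable \<mu> (del (\<lambda>x. B))"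
    using integrable_\<nu>[OF f] integrable_del[OF f] integrable_del[of "\<lambda>_. B" "\<bar>B\<bar>"] by auto
  ultimately show ?thesis unfolding del_add[abs_def] by simp
qed

lemma esum_bound:
  assumes "\<And>y. \<bar>f y\<bar> \<le> B" shows "\<bar>esum f x\<bar> \<le> B * ecard x"
  using esum_mono[of x f "\<lambda>_. B"] esum_mono[of x "\<lambda>_. - B" f] assms
  by (auto simp: esum_const abs_le_iff minus_le_iff)

lemma integral_transport_nonneg:
  fixes f :: "hsstar \<Rightarrow> real"
  assumes f: "f \<in> borel_measurable borel" "\<And>x. 0 \<le> f x"
  shows "integral\<^sup>L \<nu> f = (\<integral>x. esum f x / ecard x \<partial>\<nu>)"
proof -
  have "(\<integral>\<^sup>+ x. ennreal (f x) \<partial>\<nu>) = (\<integral>\<^sup>+ x. ennreal (esum f x / ecard x) \<partial>\<nu>)"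
    using unimodular_\<mu> f by (simp add: unimodular_def nabla_esum)
  then show ?thesis using f esum_nonneg[of _ f] ecard_pos
    by (simp add: integral_eq_nn_integral less_imp_le)
qed

text \<open>
  Unimodularity for signed bounded functions. A constant is added to reduce to the nonnegative case; it is fixed
  by the averaging over the edge.
\<close>

lemma integral_transport:
  fixes f :: "hsstar \<Rightarrow> real"
  assumes f: "f \<in> borel_measurable borel" "\<And>x. \<bar>f x\<bar> \<le> B"
  shows "integral\<^sup>L \<nu> f = (\<integral>x. esum f x / ecard x \<partial>\<nu>)"
proof -
  have "integral\<^sup>L \<nu> (\<lambda>x. f x + B) = (\<integral>x. esum (\<lambda>x. f x + B) x / ecard x \<partial>\<nu>)"
    using f by (intro integral_transport_nonneg) (auto intro: bounded_shift_nonneg)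
  also have "\<dots> = (\<integral>x. esum f x / ecard x + B \<partial>\<nu>)"
    by (intro Bochner_Integration.integral_cong) (auto simp: esum_add esum_const add_divide_distrib less_imp_neq[OF ecard_pos, symmetric])
  finally have eq: "integral\<^sup>L \<nu> (\<lambda>x. f x + B) = (\<integral>x. esum f x / ecard x + B \<partial>\<nu>)" .
  have "\<bar>esum f x / ecard x\<bar> \<le> B" for x
    using esum_bound[of f B x] f(2) by (simp add: abs_divide pos_divide_le_eq abs_of_pos)
  then have "integrable \<nu> (\<lambda>x. esum f x / ecard x)" using f(1) by (intro integrable_\<nu>[of _ B]) auto
  then show ?thesis using eq integrable_\<nu>[OF f] by simp
qed

text \<open>
  Null sets of \<open>\<nu>\<close> are invisible from \<open>\<mu>\<close>-almost every vertex, by the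
  definition of \<open>\<nu>\<close>. Together with \<open>AE_sibs\<close> (unimodularity) and
  \<open>AE_vroot\<close> this moves almost sure statements between vertices and edges.
\<close>

lemma AE_star:
  assumes "AE y in \<nu>. P y" shows "AE v in \<mu>. \<forall>y\<in>star v. P y"
proof -
  obtain N where N: "{y. \<not> P y} \<subseteq> N" "N \<in> sets borel" "emeasure \<nu> N = 0"
    using assms by (auto elim!: AE_E simp: sets_\<mu> sets_\<nu>)
  have "(\<integral>\<^sup>+ x. ennreal (indicator N x) \<partial>\<nu>) = (\<integral>\<^sup>+ v. ennreal (del (indicator N) v) \<partial>\<mu>)"
    using N by (intro nn_integral_\<nu>) auto
  moreover have "(\<integral>\<^sup>+ x. ennreal (indicator N x) \<partial>\<nu>) = 0" using N by (simp add: ennreal_indicator)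
  ultimately have "AE v in \<mu>. ennreal (del (indicator N) v) = 0"
    using N by (subst nn_integral_0_iff_AE[symmetric]) auto
  then show ?thesis
  proof (rule AE_mp, intro AE_I2 impI ballI)
    fix v y assume "ennreal (del (indicator N) v) = 0" "y \<in> star v"
    moreover have "0 \<le> (del (indicator N) v :: real)" by (rule del_nonneg) simp
    ultimately show "P y" using del_eq_0_iff[of "indicator N" v] N by (auto simp: ennreal_eq_0_iff indicator_def split: if_splits)
  qed
qed

text \<open>
  A null set stays null when the root may be moved within its edge: by unimodularity, the proportion of the edge
  that lies in the null set vanishes almost everywhere.
\<close>

lemma AE_sibs:
  assumes "AE y in \<nu>. P y" shows "AE x in \<nu>. \<forall>y\<in>sibs x. P y"
proof -
  obtain N where N: "{y. \<not> P y} \<subseteq> N" "N \<in> sets borel" "emeasure \<nu> N = 0"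
    using assms by (auto elim!: AE_E simp: sets_\<mu> sets_\<nu>)
  have "(\<integral>\<^sup>+ x. ennreal (indicator N x) \<partial>\<nu>) = (\<integral>\<^sup>+ x. ennreal (nabla (indicator N) x) \<partial>\<nu>)"
    using unimodular_\<mu> N by (simp add: unimodular_def)
  moreover have "(\<integral>\<^sup>+ x. ennreal (indicator N x) \<partial>\<nu>) = 0" using N by (simp add: ennreal_indicator)
  moreover have "nabla (indicator N) \<in> borel_measurable borel" using N by (intro nabla_measurable) simp
  ultimately have "AE x in \<nu>. ennreal (nabla (indicator N) x) = 0"
    by (subst nn_integral_0_iff_AE[symmetric]) auto
  then show ?thesis
  proof (rule AE_mp, intro AE_I2 impI)
    fix x assume "ennreal (nabla (indicator N) x) = 0"
    moreover have "0 \<le> esum (indicator N) x" by (rule esum_nonneg) simp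
    ultimately have "esum (indicator N) x = 0"
      using ecard_pos[of x] by (auto simp: nabla_esum ennreal_eq_0_iff divide_le_0_iff)
    then show "\<forall>y\<in>sibs x. P y" using N by (subst (asm) esum_eq_0_iff) (auto simp: indicator_def split: if_splits)
  qed
qed

lemma AE_vroot:
  assumes "AE v in \<mu>. P v" shows "AE y in \<nu>. P (vroot y)"
proof -
  obtain N where N: "{y. \<not> P y} \<subseteq> N" "N \<in> sets borel" "emeasure \<mu> N = 0"
    using assms by (auto elim!: AE_E simp: sets_\<mu> sets_\<nu>)
  have [measurable]: "N \<in> sets borel" by fact
  have "(\<integral>\<^sup>+ y. ennreal (indicator N (vroot y)) \<partial>\<nu>) = (\<integral>\<^sup>+ v. ennreal (del (\<lambda>y. indicator N (vroot y)) v) \<partial>\<mu>)"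
    by (intro nn_integral_\<nu>) auto
  also have "\<dots> = (\<integral>\<^sup>+ v. ennreal (indicator N v * real (hdeg v)) \<partial>\<mu>)"
    using del_vroot_mult[of "indicator N" "\<lambda>_. 1"] by (simp add: del_one)
  also have "\<dots> = 0"
  proof (subst nn_integral_0_iff_AE)
    show "AE v in \<mu>. ennreal (indicator N v * real (hdeg v)) = 0"
      using N AE_not_in[of N \<mu>] by (auto simp: null_sets_def sets_\<mu> indicator_def elim!: AE_mp)
  qed measurable
  finally have "AE y in \<nu>. ennreal (indicator N (vroot y)) = 0"
    by (subst nn_integral_0_iff_AE[symmetric]) auto
  then show ?thesis
    by (rule AE_mp, intro AE_I2) (use N in \<open>auto simp: indicator_def split: if_splits\<close>)
qed

end


section \<open>Allocations and duality\<close>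

lemma borel_allocation_iff:
  "borel_allocation \<Theta> \<longleftrightarrow> \<Theta> \<in> borel_measurable borel \<and> (\<forall>x. 0 \<le> \<Theta> x \<and> \<Theta> x \<le> 1) \<and> (\<forall>x. esum \<Theta> x = 1)"
proof -
  have "(\<forall>(H :: nat pre_hypergraph) e i. erooted (H, e, i) \<longrightarrow> (\<Sum>j\<in>e. \<Theta> (eclass H e j)) = 1) \<longleftrightarrow> (\<forall>x. esum \<Theta> x = 1)"
    by (metis esum_eclass hsstar_cases)
  then show ?thesis unfolding borel_allocation_def by blast
qed

lemma borel_allocationD:
  assumes "borel_allocation \<Theta>"
  shows "\<Theta> \<in> borel_measurable borel" "0 \<le> \<Theta> x" "\<Theta> x \<le> 1" "\<bar>\<Theta> x\<bar> \<le> 1" "esum \<Theta> x = 1"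
  using assms unfolding borel_allocation_iff by (auto simp: abs_le_iff intro: order_trans[of _ 0])

lemma del_allocation_nonneg: "borel_allocation \<Theta> \<Longrightarrow> 0 \<le> del \<Theta> v"
  by (rule del_nonneg, rule borel_allocationD(2))

lemma borel_allocationI:
  assumes "\<Theta> \<in> borel_measurable borel" "\<And>x. 0 \<le> \<Theta> x" "\<And>x. esum \<Theta> x = 1"
  shows "borel_allocation \<Theta>"
  using assms esum_member_le[OF _ sibs_self, of _ \<Theta>] unfolding borel_allocation_iff by metis

text \<open>
  Allocations are made from nonnegative weights; it suffices that no edge has total weight zero.
\<close>

lemma borel_allocation_normalise:
  assumes w: "w \<in> borel_measurable borel" "\<And>x. 0 \<le> w x" "\<And>x. \<exists>y\<in>sibs x. w y \<noteq> 0"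
  shows "borel_allocation (\<lambda>x. w x / esum w x)"
proof (rule borel_allocationI)
  show "(\<lambda>x. w x / esum w x) \<in> borel_measurable borel" using w esum_measurable[OF w(1)] by measurable
  show "0 \<le> w x / esum w x" for x using w esum_nonneg[of x w] by simp
  show "esum (\<lambda>x. w x / esum w x) x = 1" for x
  proof -
    have "esum (\<lambda>x. w x / esum w x) x = esum (\<lambda>y. (1 / esum w x) * w y) x"
      by (rule esum_cong) (simp add: esum_sibs)
    moreover have "esum w x \<noteq> 0" using w by (subst esum_eq_0_iff) auto
    ultimately show ?thesis unfolding esum_cmult by simp
  qed
qed

lemma borel_allocation_uniform: "borel_allocation (\<lambda>x. 1 / ecard x)"
  using borel_allocation_normalise[of "\<lambda>_. 1"] sibs_self by (auto simp: ecard_def)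

lemma borel_allocation_convex:
  assumes "borel_allocation \<Theta>" "borel_allocation \<Theta>'" "0 \<le> s" "s \<le> 1"
  shows "borel_allocation (\<lambda>x. (1 - s) * \<Theta> x + s * \<Theta>' x)"
  using assms by (intro borel_allocationI)
    (auto simp: borel_allocation_iff esum_add esum_cmult intro!: borel_measurable_add borel_measurable_times)

lemma del_convex: "del (\<lambda>x. (1 - s) * \<Theta> x + s * \<Theta>' x) v = (1 - s) * del \<Theta> v + s * del \<Theta>' v" for s :: real
  by (simp only: del_add del_cmult)

lemma balanced_wrt_iff:
  "balanced_wrt \<Theta> \<mu> \<longleftrightarrow> (AE x in vec_measure \<mu>. \<forall>y1\<in>sibs x. \<forall>y2\<in>sibs x.
     del \<Theta> (vroot y1) > del \<Theta> (vroot y2) \<longrightarrow> \<Theta> y1 = 0)" (is "_ \<longleftrightarrow> (AE x in _. ?R x)")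
proof -
  have *: "?R x \<longleftrightarrow> (\<forall>j1\<in>e. \<forall>j2\<in>e. del \<Theta> (vclass H j1) > del \<Theta> (vclass H j2) \<longrightarrow> \<Theta> (eclass H e j1) = 0)"
    if "erooted (H, e, i)" "eclass H e i = x" for x and H :: "nat pre_hypergraph" and e i
  proof -
    have "vroot (eclass H e j) = vclass H j" if "j \<in> e" for j
      using vroot_eclass[of H e j] \<open>erooted (H, e, i)\<close> that by auto
    then show ?thesis unfolding that(2)[symmetric] sibs_eclass[OF that(1)] by auto
  qed
  have "(\<forall>(H :: nat pre_hypergraph) e i. erooted (H, e, i) \<and> eclass H e i = x \<longrightarrow>
        (\<forall>j1\<in>e. \<forall>j2\<in>e. del \<Theta> (vclass H j1) > del \<Theta> (vclass H j2) \<longrightarrow> \<Theta> (eclass H e j1) = 0)) \<longleftrightarrow> ?R x"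
    (is "?A \<longleftrightarrow> _") for x
  proof
    obtain H :: "nat pre_hypergraph" and e i where er: "erooted (H, e, i)" "eclass H e i = x"
      using hsstar_cases[of x] by metis
    assume ?A
    from this[THEN spec, THEN spec, THEN spec, THEN mp, OF conjI[OF er]] show "?R x"
      by (rule *[OF er, THEN iffD2])
  next
    assume R: "?R x"
    show ?A by (intro allI impI, elim conjE, rule *[THEN iffD1, OF _ _ R])
  qed
  then show ?thesis unfolding balanced_wrt_def by (simp only:)
qed

text \<open>
  Complementary slackness for the duality between allocations and functions \<open>g\<close>.
\<close>

definition argmin_supported :: "(hstar \<Rightarrow> real) \<Rightarrow> (hsstar \<Rightarrow> real) \<Rightarrow> hsstar \<Rightarrow> bool" where
  "argmin_supported g \<Theta> x \<longleftrightarrow> (\<forall>y\<in>sibs x. \<Theta> y \<noteq> 0 \<longrightarrow> g (vroot y) = emin (\<lambda>z. g (vroot z)) x)"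

lemma emin_le_esum:
  assumes "borel_allocation \<Theta>"
  shows "emin (\<lambda>y. g (vroot y)) x \<le> esum (\<lambda>y. g (vroot y) * \<Theta> y) x"
    and "emin (\<lambda>y. g (vroot y)) x = esum (\<lambda>y. g (vroot y) * \<Theta> y) x \<longleftrightarrow> argmin_supported g \<Theta> x"
proof -
  let ?m = "emin (\<lambda>y. g (vroot y)) x"
  have eq: "esum (\<lambda>y. (g (vroot y) - ?m) * \<Theta> y) x = esum (\<lambda>y. g (vroot y) * \<Theta> y) x - ?m"
    using borel_allocationD(5)[OF assms, of x] by (simp add: left_diff_distrib esum_diff esum_cmult)
  have nn: "0 \<le> (g (vroot y) - ?m) * \<Theta> y" if "y \<in> sibs x" for y
    using emin_le[OF that, of "\<lambda>y. g (vroot y)"] borel_allocationD(2)[OF assms, of y] by simp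
  show "?m \<le> esum (\<lambda>y. g (vroot y) * \<Theta> y) x"
    using esum_nonneg[of x "\<lambda>y. (g (vroot y) - ?m) * \<Theta> y"] nn eq by simp
  have "esum (\<lambda>y. (g (vroot y) - ?m) * \<Theta> y) x = 0 \<longleftrightarrow> argmin_supported g \<Theta> x"
    by (subst esum_eq_0_iff[OF nn]) (auto simp: argmin_supported_def)
  then show "?m = esum (\<lambda>y. g (vroot y) * \<Theta> y) x \<longleftrightarrow> argmin_supported g \<Theta> x" unfolding eq by auto
qed

text \<open>
  Share every edge equally among its minimisers of \<open>g\<close>. Some minimiser exists as edges are finite,
  and the set of minimisers is Borel.
\<close>

lemma argmin_allocation:
  assumes g: "g \<in> borel_measurable borel"
  obtains \<Theta> where "borel_allocation \<Theta>" "\<forall>x. argmin_supported g \<Theta> x"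
proof -
  define w where "w y = indicat_real {y. g (vroot y) = emin (\<lambda>z. g (vroot z)) y} y" for y
  have [measurable]: "(\<lambda>y. g (vroot y)) \<in> borel_measurable borel" using g by measurable
  then have [measurable]: "emin (\<lambda>y. g (vroot y)) \<in> borel_measurable borel" by (rule emin_measurable)
  have "{y \<in> space borel. g (vroot y) = emin (\<lambda>z. g (vroot z)) y} \<in> sets borel" by measurable
  then have [measurable]: "{y. g (vroot y) = emin (\<lambda>z. g (vroot z)) y} \<in> sets borel" by simp
  have w: "w \<in> borel_measurable borel" unfolding w_def[abs_def] by measurable
  have ex: "\<exists>y\<in>sibs x. w y \<noteq> 0" for x
  proof -
    obtain y where "y \<in> sibs x" "g (vroot y) = emin (\<lambda>z. g (vroot z)) x" using emin_attained .
    then show ?thesis by (auto simp: w_def emin_sibs intro!: bexI[of _ y])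
  qed
  have "borel_allocation (\<lambda>x. w x / esum w x)"
    by (rule borel_allocation_normalise[OF w _ ex]) (simp add: w_def)
  moreover have "argmin_supported g (\<lambda>x. w x / esum w x) x" for x
    unfolding argmin_supported_def by (auto simp: w_def indicator_def emin_sibs split: if_splits)
  ultimately show ?thesis using that by blast
qed

context unimodular_measure
begin

lemma fmin_bound:
  assumes "\<And>v. \<bar>g v\<bar> \<le> B" shows "\<bar>fmin g x\<bar> \<le> B"
proof -
  obtain y where "emin (\<lambda>y. g (vroot y)) x = g (vroot y)" by (metis emin_attained)
  then have "\<bar>emin (\<lambda>y. g (vroot y)) x\<bar> \<le> B" using assms by simp
  moreover have "B \<le> B * ecard x"
    using assms[of undefined] mult_left_mono[OF ecard_ge_1[of x], of B] by simp
  ultimately show ?thesis by (simp add: fmin_emin abs_divide abs_of_pos pos_divide_le_eq)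
qed

lemma integrable_fmin:
  "g \<in> borel_measurable borel \<Longrightarrow> (\<And>v. \<bar>g v\<bar> \<le> B) \<Longrightarrow> integrable \<nu> (fmin g)"
  by (rule integrable_\<nu>[OF fmin_measurable fmin_bound])

lemma integrable_mult_del:
  assumes \<Theta>: "borel_allocation \<Theta>" and g: "g \<in> borel_measurable borel" "\<And>v. \<bar>g v\<bar> \<le> B"
  shows "integrable \<mu> (\<lambda>v. g v * del \<Theta> v)"
proof -
  have "\<bar>g (vroot y) * \<Theta> y\<bar> \<le> B" for y
    using mult_mono[OF g(2)[of "vroot y"] borel_allocationD(4)[OF \<Theta>, of y]] g(2)[of "vroot y"] by (simp add: abs_mult)
  moreover have "(\<lambda>y. g (vroot y) * \<Theta> y) \<in> borel_measurable borel"
    using g(1) borel_allocationD(1)[OF \<Theta>] by measurable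
  ultimately have "integrable \<mu> (del (\<lambda>y. g (vroot y) * \<Theta> y))" by (intro integrable_del)
  then show ?thesis by (simp add: del_vroot_mult[abs_def])
qed

lemma integral_mult_del:
  assumes \<Theta>: "borel_allocation \<Theta>" and g: "g \<in> borel_measurable borel" "\<And>v. \<bar>g v\<bar> \<le> B"
  shows "(\<integral>v. g v * del \<Theta> v \<partial>\<mu>) = (\<integral>x. esum (\<lambda>y. g (vroot y) * \<Theta> y) x / ecard x \<partial>\<nu>)"
    and "integrable \<nu> (\<lambda>x. esum (\<lambda>y. g (vroot y) * \<Theta> y) x / ecard x)"
proof -
  let ?f = "\<lambda>y. g (vroot y) * \<Theta> y"
  have b: "\<bar>?f y\<bar> \<le> B" for y
    using mult_mono[OF g(2)[of "vroot y"] borel_allocationD(4)[OF \<Theta>, of y]] g(2)[of "vroot y"] by (simp add: abs_mult)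
  have m: "?f \<in> borel_measurable borel"
    using g(1) borel_allocationD(1)[OF \<Theta>] by measurable
  show "(\<integral>v. g v * del \<Theta> v \<partial>\<mu>) = (\<integral>x. esum ?f x / ecard x \<partial>\<nu>)"
    using integral_\<nu>[OF m b] integral_transport[OF m b] by (simp add: del_vroot_mult[abs_def])
  have "\<bar>esum ?f x / ecard x\<bar> \<le> B" for x
    using esum_bound[of ?f B x] b by (simp add: abs_divide pos_divide_le_eq abs_of_pos)
  then show "integrable \<nu> (\<lambda>x. esum ?f x / ecard x)"
    using esum_measurable[OF m] by (intro integrable_\<nu>[of _ B]) auto
qed

text \<open>
  Mass transport, and the fact that a weighted mean is at least the minimum.
\<close>

lemma weak_duality:
  assumes \<Theta>: "borel_allocation \<Theta>" and g: "g \<in> borel_measurable borel" "\<And>v. \<bar>g v\<bar> \<le> B"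
  shows "integral\<^sup>L \<nu> (fmin g) \<le> (\<integral>v. g v * del \<Theta> v \<partial>\<mu>)"
  unfolding integral_mult_del(1)[OF assms]
proof (rule integral_mono[OF integrable_fmin[OF g] integral_mult_del(2)[OF assms]])
  show "fmin g x \<le> esum (\<lambda>y. g (vroot y) * \<Theta> y) x / ecard x" for x
    unfolding fmin_emin by (intro divide_right_mono emin_le_esum[OF \<Theta>] less_imp_le[OF ecard_pos])
qed

lemma duality_eq_iff:
  assumes \<Theta>: "borel_allocation \<Theta>" and g: "g \<in> borel_measurable borel" "\<And>v. \<bar>g v\<bar> \<le> B"
  shows "integral\<^sup>L \<nu> (fmin g) = (\<integral>v. g v * del \<Theta> v \<partial>\<mu>) \<longleftrightarrow> (AE x in \<nu>. argmin_supported g \<Theta> x)"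
proof -
  let ?d = "\<lambda>x. esum (\<lambda>y. g (vroot y) * \<Theta> y) x / ecard x - fmin g x"
  have i: "integrable \<nu> ?d" using integral_mult_del(2)[OF assms] integrable_fmin[OF g] by simp
  have nn: "0 \<le> ?d x" for x
    unfolding fmin_emin using divide_right_mono[OF emin_le_esum(1)[OF \<Theta>, of g x] less_imp_le[OF ecard_pos[of x]]] by simp
  have iff: "?d x = 0 \<longleftrightarrow> argmin_supported g \<Theta> x" for x
    unfolding fmin_emin emin_le_esum(2)[OF \<Theta>, symmetric] using ecard_pos[of x] by (auto simp: diff_divide_distrib[symmetric] less_imp_neq[OF ecard_pos, symmetric])
  have "(\<integral>v. g v * del \<Theta> v \<partial>\<mu>) - integral\<^sup>L \<nu> (fmin g) = integral\<^sup>L \<nu> ?d"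
    unfolding integral_mult_del(1)[OF assms] using integral_mult_del(2)[OF assms] integrable_fmin[OF g] by simp
  moreover have "integral\<^sup>L \<nu> ?d = 0 \<longleftrightarrow> (AE x in \<nu>. argmin_supported g \<Theta> x)"
    using integral_nonneg_eq_0_iff_AE[OF i] nn unfolding iff by simp
  ultimately show ?thesis by auto
qed

text \<open>
  On an edge, a balanced allocation uses only vertices of least load, and these minimise every increasing
  function of the load.
\<close>

lemma balanced_duality:
  assumes \<Theta>: "borel_allocation \<Theta>" "balanced_wrt \<Theta> \<mu>"
    and \<gamma>: "\<And>x y. 0 \<le> x \<Longrightarrow> x \<le> y \<Longrightarrow> \<gamma> x \<le> \<gamma> y" "\<And>x. \<bar>\<gamma> x\<bar> \<le> B" "(\<lambda>v. \<gamma> (del \<Theta> v)) \<in> borel_measurable borel"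
  shows "integral\<^sup>L \<nu> (fmin (\<lambda>v. \<gamma> (del \<Theta> v))) = (\<integral>v. \<gamma> (del \<Theta> v) * del \<Theta> v \<partial>\<mu>)"
proof (rule duality_eq_iff[OF \<Theta>(1) \<gamma>(3,2), THEN iffD2])
  show "AE x in \<nu>. argmin_supported (\<lambda>v. \<gamma> (del \<Theta> v)) \<Theta> x"
    using \<Theta>(2)[unfolded balanced_wrt_iff]
  proof (rule AE_mp, intro AE_I2 impI)
    fix x assume *: "\<forall>y1\<in>sibs x. \<forall>y2\<in>sibs x. del \<Theta> (vroot y1) > del \<Theta> (vroot y2) \<longrightarrow> \<Theta> y1 = 0"
    show "argmin_supported (\<lambda>v. \<gamma> (del \<Theta> v)) \<Theta> x"
      unfolding argmin_supported_def
    proof (intro ballI impI antisym)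
      fix y assume y: "y \<in> sibs x" "\<Theta> y \<noteq> 0"
      show "\<gamma> (del \<Theta> (vroot y)) \<le> emin (\<lambda>z. \<gamma> (del \<Theta> (vroot z))) x"
        unfolding le_emin_iff using * y
        by (intro ballI \<gamma>(1) del_nonneg borel_allocationD(2)[OF \<Theta>(1)]) (meson not_le)
      show "emin (\<lambda>z. \<gamma> (del \<Theta> (vroot z))) x \<le> \<gamma> (del \<Theta> (vroot y))" using emin_le[OF y(1), of "\<lambda>z. \<gamma> (del \<Theta> (vroot z))"] .
    qed
  qed
qed

text \<open>
  The function \<open>- exp (- x)\<close> is bounded and strictly increasing on \<open>[0, \<infinity>)\<close>,
  so its minimisers on an edge are exactly the vertices of least load. The load is replaced by a version
  \<open>L\<close> that agrees almost surely, because this shows that being balanced is a property of the load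
  alone.
\<close>

lemma balanced_iff_duality:
  assumes \<Theta>: "borel_allocation \<Theta>"
    and L: "L \<in> borel_measurable borel" "\<And>v. 0 \<le> L v" "AE v in \<mu>. L v = del \<Theta> v"
  shows "balanced_wrt \<Theta> \<mu> \<longleftrightarrow> integral\<^sup>L \<nu> (fmin (\<lambda>v. - exp (- L v))) = (\<integral>v. - exp (- L v) * del \<Theta> v \<partial>\<mu>)"
proof -
  let ?g = "\<lambda>v. - exp (- L v)"
  have g: "?g \<in> borel_measurable borel" "\<bar>?g v\<bar> \<le> 1" for v using L by auto
  have "(\<forall>y1\<in>sibs x. \<forall>y2\<in>sibs x. del \<Theta> (vroot y1) > del \<Theta> (vroot y2) \<longrightarrow> \<Theta> y1 = 0) \<longleftrightarrow> argmin_supported ?g \<Theta> x"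
    (is "?A \<longleftrightarrow> ?B") if eq: "\<forall>y\<in>sibs x. L (vroot y) = del \<Theta> (vroot y)" for x
  proof
    assume A: ?A
    show ?B unfolding argmin_supported_def
    proof (intro ballI impI antisym)
      fix y assume y: "y \<in> sibs x" "\<Theta> y \<noteq> 0"
      show "?g (vroot y) \<le> emin (\<lambda>z. ?g (vroot z)) x"
        unfolding le_emin_iff
      proof
        fix z assume z: "z \<in> sibs x"
        then have "L (vroot y) \<le> L (vroot z)" using A y eq by (metis not_le)
        then show "?g (vroot y) \<le> ?g (vroot z)" by simp
      qed
      show "emin (\<lambda>z. ?g (vroot z)) x \<le> ?g (vroot y)" using emin_le[OF y(1), of "\<lambda>z. ?g (vroot z)"] .
    qed
  next
    assume B: ?B
    show ?A
    proof (intro ballI impI, rule ccontr)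
      fix y z assume yz: "y \<in> sibs x" "z \<in> sibs x" "del \<Theta> (vroot z) < del \<Theta> (vroot y)" "\<Theta> y \<noteq> 0"
      then have "?g (vroot y) \<le> ?g (vroot z)"
        using B emin_le[OF yz(2), of "\<lambda>z. ?g (vroot z)"] unfolding argmin_supported_def by auto
      then show False using yz eq by simp
    qed
  qed
  moreover have "AE x in \<nu>. \<forall>y\<in>sibs x. L (vroot y) = del \<Theta> (vroot y)"
    using AE_sibs[OF AE_vroot[OF L(3)]] .
  ultimately have "AE x in \<nu>. (\<forall>y1\<in>sibs x. \<forall>y2\<in>sibs x. del \<Theta> (vroot y1) > del \<Theta> (vroot y2) \<longrightarrow> \<Theta> y1 = 0) \<longleftrightarrow> argmin_supported ?g \<Theta> x"
    by (auto elim!: AE_mp)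
  then have "balanced_wrt \<Theta> \<mu> \<longleftrightarrow> (AE x in \<nu>. argmin_supported ?g \<Theta> x)"
    unfolding balanced_wrt_iff by (rule eventually_subst)
  also have "\<dots> \<longleftrightarrow> integral\<^sup>L \<nu> (fmin ?g) = (\<integral>v. ?g v * del \<Theta> v \<partial>\<mu>)"
    using duality_eq_iff[OF \<Theta> g] by simp
  finally show ?thesis .
qed

end


section \<open>Existence of balanced allocations\<close>

context unimodular_measure
begin

text \<open>
  The pointwise limit is an allocation on almost every edge only. On the remaining edges, a set that does not
  depend on the choice of the root within the edge, the uniform allocation is substituted.
\<close>

lemma borel_allocation_limit:
  assumes \<Theta>: "\<And>n. borel_allocation (\<Theta> n)" and C: "AE x in \<nu>. Cauchy (\<lambda>n :: nat. \<Theta> n x)"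
  obtains \<Theta>' where "borel_allocation \<Theta>'" "AE x in \<nu>. (\<lambda>n. \<Theta> n x) \<longlonglongrightarrow> \<Theta>' x"
proof -
  define u where "u x = lim (\<lambda>n. \<Theta> n x)" for x
  define ok where "ok x \<longleftrightarrow> esum u x = 1 \<and> (\<forall>y\<in>sibs x. 0 \<le> u y)" for x
  define \<Theta>' where "\<Theta>' x = (if ok x then u x else 1 / ecard x)" for x
  have u[measurable]: "u \<in> borel_measurable borel"
    unfolding u_def[abs_def] using borel_allocationD(1)[OF \<Theta>] by measurable
  have ok_sibs: "ok y \<longleftrightarrow> ok x" if "y \<in> sibs x" for x y
    using that by (simp add: ok_def esum_sibs sibs_sibs)
  have "{x. \<forall>y\<in>sibs x. 0 \<le> u y} \<in> sets borel"
    by (rule sibs_ball_measurable) (use u in \<open>auto simp: borel_measurable_iff_ge\<close>)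
  moreover have "{x \<in> space borel. esum u x = 1} \<in> sets borel" by measurable
  ultimately have ok: "{x. ok x} \<in> sets borel"
    using sets.Int[of "{x. \<forall>y\<in>sibs x. 0 \<le> u y}" borel "{x. esum u x = 1}"] by (simp add: ok_def Int_def conj_commute)
  have "borel_allocation \<Theta>'"
  proof (rule borel_allocationI)
    show "\<Theta>' \<in> borel_measurable borel" unfolding \<Theta>'_def[abs_def]
      by (rule measurable_If) (use ok in simp_all)
    show "0 \<le> \<Theta>' x" for x using sibs_self[of x] ecard_pos[of x] by (auto simp: \<Theta>'_def ok_def less_imp_le)
    show "esum \<Theta>' x = 1" for x
    proof (cases "ok x")
      case True
      then have "esum \<Theta>' x = esum u x" by (intro esum_cong) (simp add: \<Theta>'_def ok_sibs)
      then show ?thesis using True by (simp add: ok_def)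
    next
      case False
      then have "esum \<Theta>' x = esum (\<lambda>y. 1 / ecard y) x" by (intro esum_cong) (simp add: \<Theta>'_def ok_sibs)
      then show ?thesis using borel_allocationD(5)[OF borel_allocation_uniform] by simp
    qed
  qed
  moreover have "AE x in \<nu>. (\<lambda>n. \<Theta> n x) \<longlonglongrightarrow> \<Theta>' x"
    using AE_sibs[OF C]
  proof (rule AE_mp, intro AE_I2 impI)
    fix x assume "\<forall>y\<in>sibs x. Cauchy (\<lambda>n. \<Theta> n y)"
    then have lim: "(\<lambda>n. \<Theta> n y) \<longlonglongrightarrow> u y" if "y \<in> sibs x" for y
      using that by (simp add: u_def Cauchy_convergent_iff convergent_LIMSEQ_iff)
    have "(\<lambda>n. esum (\<Theta> n) x) \<longlonglongrightarrow> esum u x" by (rule tendsto_esum[OF lim])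
    then have "esum u x = 1" using borel_allocationD(5)[OF \<Theta>] by (simp add: LIMSEQ_const_iff)
    moreover have "0 \<le> u y" if "y \<in> sibs x" for y
      by (rule LIMSEQ_le_const[OF lim[OF that]]) (use borel_allocationD(2)[OF \<Theta>] in auto)
    ultimately have "ok x" by (simp add: ok_def)
    then show "(\<lambda>n. \<Theta> n x) \<longlonglongrightarrow> \<Theta>' x" using lim[OF sibs_self] by (simp add: \<Theta>'_def)
  qed
  ultimately show ?thesis by (rule that)
qed

lemma AE_tendsto_del:
  fixes \<Theta> :: "nat \<Rightarrow> hsstar \<Rightarrow> real"
  assumes "AE x in \<nu>. (\<lambda>n. \<Theta> n x) \<longlonglongrightarrow> \<Theta>' x"
  shows "AE v in \<mu>. (\<lambda>n. del (\<Theta> n) v) \<longlonglongrightarrow> del \<Theta>' v"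
  using AE_star[OF assms] by (rule AE_mp) (auto intro!: AE_I2 tendsto_del)

lemma integrable_exp_del:
  assumes "borel_allocation \<Theta>" shows "integrable \<mu> (\<lambda>v. exp (- del \<Theta> v))"
proof (rule integrable_const_bound[of _ 1])
  show "(\<lambda>v. exp (- del \<Theta> v)) \<in> borel_measurable \<mu>" using borel_allocationD(1)[OF assms] by measurable
  show "AE v in \<mu>. norm (exp (- del \<Theta> v)) \<le> 1" using del_allocation_nonneg[OF assms] by simp
qed

lemma integrable_alloc:
  assumes "borel_allocation \<Theta>" "borel_allocation \<Theta>'"
  shows "integrable \<nu> (\<lambda>x. \<Theta> x * \<Theta>' x)" "integrable \<nu> (\<lambda>x. (\<Theta> x)\<^sup>2)"
proof -
  have *: "integrable \<nu> (\<lambda>x. \<Theta> x * \<Theta>' x)" if "borel_allocation \<Theta>" "borel_allocation \<Theta>'" for \<Theta> \<Theta>'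
  proof (rule integrable_\<nu>[of _ 1])
    show "(\<lambda>x. \<Theta> x * \<Theta>' x) \<in> borel_measurable borel"
      using borel_allocationD(1)[OF that(1)] borel_allocationD(1)[OF that(2)] by measurable
    show "\<bar>\<Theta> x * \<Theta>' x\<bar> \<le> 1" for x
      using borel_allocationD(2-4)[OF that(1), of x] borel_allocationD(2-4)[OF that(2), of x]
      by (simp add: abs_mult mult_le_one)
  qed
  show "integrable \<nu> (\<lambda>x. \<Theta> x * \<Theta>' x)" "integrable \<nu> (\<lambda>x. (\<Theta> x)\<^sup>2)"
    using *[OF assms] *[OF assms(1,1)] by (simp_all add: power2_eq_square)
qed

text \<open>
  Let \<open>C n\<close> be the convex set of allocations whose cost exceeds the infimum by at most \<open>1 /
  (n + 1)\<close>, and \<open>d n\<close> the infimum over \<open>C n\<close> of the squared norm in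
  \<open>L\<^sup>2(\<nu>)\<close>. The sets decrease, so \<open>d\<close> increases, and it is bounded because
  \<open>\<nu>\<close> is finite. If \<open>X n \<in> C n\<close> nearly attains \<open>d n\<close>, then for
  \<open>n \<le> k\<close> the midpoint of \<open>X n\<close> and \<open>X k\<close> lies in \<open>C n\<close>
  and has squared norm at least \<open>d n\<close>, and the parallelogram identity makes \<open>X\<close> a
  Cauchy sequence.
\<close>

lemma exp_load_minimiser:
  obtains \<Theta> where "borel_allocation \<Theta>"
    "\<forall>\<Theta>'. borel_allocation \<Theta>' \<longrightarrow> (\<integral>v. exp (- del \<Theta> v) \<partial>\<mu>) \<le> (\<integral>v. exp (- del \<Theta>' v) \<partial>\<mu>)"
proof -
  define F where "F \<Theta> = (\<integral>v. exp (- del \<Theta> v) \<partial>\<mu>)" for \<Theta> :: "hsstar \<Rightarrow> real"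
  define N where "N \<Theta> = (\<integral>x. (\<Theta> x)\<^sup>2 \<partial>\<nu>)" for \<Theta> :: "hsstar \<Rightarrow> real"
  define m where "m = Inf (F ` Collect borel_allocation)"
  define C where "C n = {\<Theta>. borel_allocation \<Theta> \<and> F \<Theta> \<le> m + 1 / (1 + real n)}" for n
  define d where "d n = Inf (N ` C n)" for n
  define M where "M = measure \<nu> UNIV"
  have Fbd: "bdd_below (F ` Collect borel_allocation)" by (rule bdd_belowI2[of _ 0]) (simp add: F_def)
  have Nbd: "bdd_below (N ` A)" for A by (rule bdd_belowI2[of _ 0]) (simp add: N_def)
  have m_le: "m \<le> F \<Theta>" if "borel_allocation \<Theta>" for \<Theta>
    unfolding m_def using that by (intro cInf_lower Fbd) auto
  have Cne: "C n \<noteq> {}" for n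
  proof -
    have "F ` Collect borel_allocation \<noteq> {}" using borel_allocation_uniform by blast
    then obtain \<Theta> where "borel_allocation \<Theta>" "F \<Theta> < m + 1 / (1 + real n)"
      using cInf_lessD[of "F ` Collect borel_allocation" "m + 1 / (1 + real n)"] by (auto simp: m_def)
    then show ?thesis by (auto simp: C_def intro!: exI[of _ \<Theta>])
  qed
  have "\<exists>\<Theta>. \<Theta> \<in> C n \<and> N \<Theta> < d n + 1 / (1 + real n)" for n
    using cInf_lessD[of "N ` C n" "d n + 1 / (1 + real n)"] Cne[of n] by (auto simp: d_def)
  then obtain X where X: "\<And>n. X n \<in> C n" "\<And>n. N (X n) < d n + 1 / (1 + real n)" by metis
  have XA: "borel_allocation (X n)" for n using X(1) by (simp add: C_def)
  have C_mono: "C k \<subseteq> C n" if "n \<le> k" for n k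
  proof -
    have "1 / (1 + real k) \<le> 1 / (1 + real n)" using that by (intro divide_left_mono) auto
    then show ?thesis by (auto simp: C_def)
  qed
  have d_mono: "d n \<le> d k" if "n \<le> k" for n k
    unfolding d_def by (rule cInf_superset_mono) (use Cne Nbd C_mono[OF that] in auto)
  have d_le: "d n \<le> M" for n
  proof -
    have "d n \<le> N (X n)" unfolding d_def using X(1) Nbd by (intro cInf_lower) auto
    also have "\<dots> \<le> (\<integral>x. 1 \<partial>\<nu>)" unfolding N_def
      using borel_allocationD(2,3)[OF XA] integrable_alloc(2)[OF XA XA]
      by (intro integral_mono) (auto simp: power_le_one)
    finally show ?thesis by (simp add: M_def)
  qed
  have mid: "d n \<le> N (\<lambda>x. (1 - 1/2) * X n x + 1/2 * X k x)" if "n \<le> k" for n k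
  proof -
    let ?Z = "\<lambda>x. (1 - 1/2) * X n x + 1/2 * X k x"
    have Z: "borel_allocation ?Z" by (intro borel_allocation_convex XA) auto
    \<comment> \<open>Convexity of the cost: the midpoint \<open>?Z\<close> stays in \<open>C n\<close>.\<close>
    have "F ?Z \<le> (\<integral>v. 1/2 * exp (- del (X n) v) + 1/2 * exp (- del (X k) v) \<partial>\<mu>)"
      unfolding F_def
    proof (rule integral_mono)
      show "integrable \<mu> (\<lambda>v. exp (- del ?Z v))" by (rule integrable_exp_del[OF Z])
      show "integrable \<mu> (\<lambda>v. 1/2 * exp (- del (X n) v) + 1/2 * exp (- del (X k) v))"
        using integrable_exp_del[OF XA] by simp
      show "exp (- del ?Z v) \<le> 1/2 * exp (- del (X n) v) + 1/2 * exp (- del (X k) v)" for v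
        using convex_onD[OF exp_convex, of "1/2" "- del (X n) v" "- del (X k) v"] unfolding del_convex by simp
    qed
    also have "\<dots> = 1/2 * F (X n) + 1/2 * F (X k)"
      using integrable_exp_del[OF XA] by (simp add: F_def)
    also have "\<dots> \<le> m + 1 / (1 + real n)"
      using X(1)[of n] X(1)[of k] C_mono[OF that] by (auto simp: C_def)
    finally have "?Z \<in> C n" using Z by (simp add: C_def)
    then show ?thesis unfolding d_def using Nbd by (intro cInf_lower) auto
  qed
  have arith: "2 * a + 2 * b - 4 * c \<le> 2 * p + 2 * q - 4 * e" if "a < p" "b < q" "e \<le> c" for a b c p q e :: real
    using that by linarith
  have par: "(\<integral>x. (X n x - X k x)\<^sup>2 \<partial>\<nu>) \<le> 2 * (d k - d n) + 4 / (1 + real n)" if "n \<le> k" for n k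
  proof -
    have "(\<integral>x. (X n x - X k x)\<^sup>2 \<partial>\<nu>) = (\<integral>x. 2 * (X n x)\<^sup>2 + 2 * (X k x)\<^sup>2 - 4 * ((1 - 1/2) * X n x + 1/2 * X k x)\<^sup>2 \<partial>\<nu>)"
      by (rule Bochner_Integration.integral_cong) (auto simp: power2_eq_square field_simps)
    also have "\<dots> = 2 * N (X n) + 2 * N (X k) - 4 * N (\<lambda>x. (1 - 1/2) * X n x + 1/2 * X k x)"
      unfolding N_def using integrable_alloc(2)[OF XA XA] integrable_alloc(2)[OF borel_allocation_convex[OF XA[of n] XA[of k], of "1/2"] XA]
      by simp
    also have "\<dots> \<le> 2 * (d n + 1 / (1 + real n)) + 2 * (d k + 1 / (1 + real k)) - 4 * d n"
      by (rule arith[OF X(2)[of n] X(2)[of k] mid[OF that]])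
    finally have "(\<integral>x. (X n x - X k x)\<^sup>2 \<partial>\<nu>) \<le> 2 * (d n + 1 / (1 + real n)) + 2 * (d k + 1 / (1 + real k)) - 4 * d n" .
    moreover have "1 / (1 + real k) \<le> 1 / (1 + real n)" using that by (intro divide_left_mono) auto
    moreover have "4 / (1 + real n) = 4 * (1 / (1 + real n))" by simp
    ultimately show ?thesis unfolding distrib_left right_diff_distrib by linarith
  qed
  have "\<bar>d n\<bar> \<le> \<bar>d 0\<bar> + \<bar>M\<bar>" for n
    using d_mono[of 0 n] d_le[of n] by linarith
  then have "Bseq d" by (intro BseqI'[of _ "\<bar>d 0\<bar> + \<bar>M\<bar>"]) simp
  then have dconv: "convergent d"
    using d_mono by (intro Bseq_mono_convergent) auto
  have cauchy: "\<exists>K. \<forall>n\<ge>K. \<forall>k\<ge>K. (\<integral>x. norm (X n x - X k x) \<partial>\<nu>) < \<epsilon>" if \<epsilon>: "\<epsilon> > 0" for \<epsilon>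
  proof -
    define \<eta> where "\<eta> = \<epsilon> / (2 * (M + 1))"
    have M: "0 \<le> M" by (simp add: M_def)
    have \<eta>: "\<eta> > 0" "\<eta> * M < \<epsilon> / 2" using \<epsilon> M by (auto simp: \<eta>_def field_simps)
    have "0 < \<eta> * \<epsilon> / 8" using \<eta> \<epsilon> by simp
    then obtain K1 where K1: "\<And>n k. n \<ge> K1 \<Longrightarrow> k \<ge> K1 \<Longrightarrow> dist (d n) (d k) < \<eta> * \<epsilon> / 8"
      using dconv unfolding Cauchy_convergent_iff[symmetric] Cauchy_def by meson
    obtain K2 where K2: "1 / (1 + real K2) < \<eta> * \<epsilon> / 16"
      using reals_Archimedean[of "\<eta> * \<epsilon> / 16"] \<eta> \<epsilon> by (auto simp: inverse_eq_divide add.commute)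
    have main: "(\<integral>x. norm (X n x - X k x) \<partial>\<nu>) < \<epsilon>" if "n \<ge> max K1 K2" "n \<le> k" for n k
    proof -
      let ?D = "\<integral>x. (X n x - X k x)\<^sup>2 \<partial>\<nu>"
      have "1 / (1 + real n) \<le> 1 / (1 + real K2)" using that by (intro divide_left_mono) auto
      moreover have "d k - d n < \<eta> * \<epsilon> / 8" using le_less_trans[OF abs_ge_self K1[of k n, unfolded dist_real_def]] that by simp
      ultimately have "?D < \<eta> * \<epsilon> / 2" using par[OF that(2)] K2 by simp
      then have D: "?D / \<eta> < \<epsilon> / 2" using \<eta> by (simp add: field_simps)
      have meas: "X n \<in> borel_measurable borel" "X k \<in> borel_measurable borel" by (rule borel_allocationD(1)[OF XA])+
      have b: "\<bar>X n x - X k x\<bar> \<le> 1" for x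
        using borel_allocationD(2,3)[OF XA, of n x] borel_allocationD(2,3)[OF XA, of k x] by linarith
      have i2: "integrable \<nu> (\<lambda>x. (X n x - X k x)\<^sup>2)"
        by (rule integrable_\<nu>[of _ 1]) (use meas b abs_le_square_iff[of _ 1] in auto)
      have i1: "integrable \<nu> (\<lambda>x. norm (X n x - X k x))"
        by (rule integrable_\<nu>[of _ 1]) (use meas b in auto)
      \<comment> \<open>\<open>\<bar>a\<bar> \<le> \<eta> + a\<^sup>2 / \<eta>\<close> turns the bound in \<open>L\<^sup>2\<close> into one in \<open>L\<^sup>1\<close>, for which a subsequence
          converges almost everywhere.\<close>
      have "(\<integral>x. norm (X n x - X k x) \<partial>\<nu>) \<le> (\<integral>x. \<eta> + (X n x - X k x)\<^sup>2 / \<eta> \<partial>\<nu>)"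
      proof (rule integral_mono[OF i1])
        show "integrable \<nu> (\<lambda>x. \<eta> + (X n x - X k x)\<^sup>2 / \<eta>)" using i2 by simp
        have "\<bar>a\<bar> \<le> \<eta> + a\<^sup>2 / \<eta>" for a
        proof (cases "\<bar>a\<bar> \<le> \<eta>")
          case True then show ?thesis using \<eta> by (intro order_trans[OF True]) simp
        next
          case False
          then have "\<bar>a\<bar> * \<eta> \<le> a\<^sup>2" using mult_left_mono[of \<eta> "\<bar>a\<bar>" "\<bar>a\<bar>"] by (simp add: power2_eq_square)
          then show ?thesis using \<eta> by (simp add: field_simps add_increasing)
        qed
        then show "norm (X n x - X k x) \<le> \<eta> + (X n x - X k x)\<^sup>2 / \<eta>" for x by simp
      qed
      also have "\<dots> = \<eta> * M + ?D / \<eta>" using i2 by (simp add: M_def)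
      also have "\<dots> < \<epsilon>" using \<eta>(2) D by linarith
      finally show ?thesis .
    qed
    have "(\<integral>x. norm (X n x - X k x) \<partial>\<nu>) < \<epsilon>" if "n \<ge> max K1 K2" "k \<ge> max K1 K2" for n k
      using main[of n k] main[of k n] that by (cases "n \<le> k") (auto simp: norm_minus_commute abs_minus_commute)
    then show ?thesis by blast
  qed
  obtain r where r: "strict_mono r" "AE x in \<nu>. Cauchy (\<lambda>i. X (r i) x)"
  proof (rule cauchy_L1_AE_cauchy_subseq[OF _ cauchy])
    show "integrable \<nu> (X n)" for n using borel_allocationD[OF XA, of n] by (intro integrable_\<nu>[of _ 1])
  qed
  obtain \<Theta> where \<Theta>: "borel_allocation \<Theta>" "AE x in \<nu>. (\<lambda>i. X (r i) x) \<longlonglongrightarrow> \<Theta> x"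
    using borel_allocation_limit[OF XA r(2)] .
  have lim: "(\<lambda>i. F (X (r i))) \<longlonglongrightarrow> F \<Theta>"
    unfolding F_def
  proof (rule integral_dominated_convergence[where w = "\<lambda>_. 1"])
    show "AE v in \<mu>. (\<lambda>i. exp (- del (X (r i)) v)) \<longlonglongrightarrow> exp (- del \<Theta> v)"
      using AE_tendsto_del[OF \<Theta>(2)] by (rule AE_mp) (auto intro!: AE_I2 tendsto_exp tendsto_minus)
    show "AE v in \<mu>. norm (exp (- del (X (r i)) v)) \<le> 1" for i
      using del_allocation_nonneg[OF XA] by simp
    show "(\<lambda>v. exp (- del \<Theta> v)) \<in> borel_measurable \<mu>" using integrable_exp_del[OF \<Theta>(1)] by simp
    show "(\<lambda>v. exp (- del (X (r i)) v)) \<in> borel_measurable \<mu>" for i using integrable_exp_del[OF XA] by simp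
  qed simp
  have "(\<lambda>n. 1 / (1 + real n)) \<longlonglongrightarrow> 0"
    using LIMSEQ_inverse_real_of_nat by (simp add: inverse_eq_divide add.commute)
  then have "(\<lambda>i. m + 1 / (1 + real (r i))) \<longlonglongrightarrow> m + 0"
    using LIMSEQ_subseq_LIMSEQ[OF _ r(1)] by (intro tendsto_add tendsto_const) (auto simp: comp_def)
  with lim have "F \<Theta> \<le> m + 0"
    by (rule LIMSEQ_le) (use X(1) in \<open>auto simp: C_def\<close>)
  then show ?thesis using \<Theta>(1) m_le by (intro that[of \<Theta>]) (auto simp: F_def intro: order_trans)
qed

text \<open>
  Differentiate the cost along the segment from \<open>\<Theta>\<close> to \<open>\<Theta>'\<close>. The tangent
  at the point \<open>\<partial>\<Theta> + s D\<close> of the segment, with \<open>D\<close> the difference of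
  the loads, gives an inequality that is linear in \<open>D\<close> for each \<open>s\<close>; the integrable
  bound \<open>\<bar>D\<bar>\<close> then allows \<open>s \<rightarrow> 0\<close> without a second moment of the
  degree.
\<close>

lemma exp_load_first_variation:
  assumes \<Theta>: "borel_allocation \<Theta>" and \<Theta>': "borel_allocation \<Theta>'"
    and min: "\<forall>\<Theta>'. borel_allocation \<Theta>' \<longrightarrow> (\<integral>v. exp (- del \<Theta> v) \<partial>\<mu>) \<le> (\<integral>v. exp (- del \<Theta>' v) \<partial>\<mu>)"
  shows "(\<integral>v. - exp (- del \<Theta> v) * del \<Theta> v \<partial>\<mu>) \<le> (\<integral>v. - exp (- del \<Theta> v) * del \<Theta>' v \<partial>\<mu>)"
proof -
  have m[measurable]: "\<Theta> \<in> borel_measurable borel" "\<Theta>' \<in> borel_measurable borel"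
    using \<Theta> \<Theta>' by (auto dest: borel_allocationD(1))
  define D where "D v = del \<Theta>' v - del \<Theta> v" for v
  have [measurable]: "D \<in> borel_measurable borel" unfolding D_def[abs_def] by measurable
  have iD: "integrable \<mu> D" unfolding D_def[abs_def]
    using integrable_del[OF m(1) borel_allocationD(4)[OF \<Theta>]] integrable_del[OF m(2) borel_allocationD(4)[OF \<Theta>']] by simp
  define s where "s n = 1 / (1 + real n)" for n
  have s: "0 < s n" "s n \<le> 1" for n by (auto simp: s_def)
  have s0: "s \<longlonglongrightarrow> 0" using LIMSEQ_inverse_real_of_nat by (simp add: s_def[abs_def] inverse_eq_divide add.commute)
  define \<Phi> where "\<Phi> n x = (1 - s n) * \<Theta> x + s n * \<Theta>' x" for n x
  have \<Phi>: "borel_allocation (\<Phi> n)" for n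
    unfolding \<Phi>_def[abs_def] using s[of n] by (intro borel_allocation_convex \<Theta> \<Theta>') auto
  have [measurable]: "\<Phi> n \<in> borel_measurable borel" for n using \<Phi> borel_allocationD(1) by blast
  have d\<Phi>: "del (\<Phi> n) v = del \<Theta> v + s n * D v" for n v
    unfolding \<Phi>_def[abs_def] del_convex D_def by (simp add: algebra_simps)
  have nn: "0 \<le> del (\<Phi> n) v" for n v by (rule del_allocation_nonneg[OF \<Phi>])
  have dom: "\<bar>exp (- del (\<Phi> n) v) * D v\<bar> \<le> \<bar>D v\<bar>" for n v
    using nn[of n v] mult_right_mono[of "exp (- del (\<Phi> n) v)" 1 "\<bar>D v\<bar>"] by (simp add: abs_mult)
  have iE: "integrable \<mu> (\<lambda>v. exp (- del (\<Phi> n) v) * D v)" for n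
    by (rule Bochner_Integration.integrable_bound[OF iD]) (use dom in auto)
  have le0: "(\<integral>v. exp (- del (\<Phi> n) v) * D v \<partial>\<mu>) \<le> 0" for n
  proof -
    have "(\<integral>v. exp (- del (\<Phi> n) v) + s n * (exp (- del (\<Phi> n) v) * D v) \<partial>\<mu>) \<le> (\<integral>v. exp (- del \<Theta> v) \<partial>\<mu>)"
    proof (rule integral_mono)
      show "integrable \<mu> (\<lambda>v. exp (- del (\<Phi> n) v) + s n * (exp (- del (\<Phi> n) v) * D v))"
        using integrable_exp_del[OF \<Phi>] iE by simp
      show "integrable \<mu> (\<lambda>v. exp (- del \<Theta> v))" by (rule integrable_exp_del[OF \<Theta>])
      fix v
      have "exp (- del (\<Phi> n) v) * (1 + s n * D v) \<le> exp (- del (\<Phi> n) v) * exp (s n * D v)"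
        by (intro mult_left_mono exp_ge_add_one_self) simp
      also have "\<dots> = exp (- del \<Theta> v)" unfolding exp_add[symmetric] d\<Phi> by simp
      finally show "exp (- del (\<Phi> n) v) + s n * (exp (- del (\<Phi> n) v) * D v) \<le> exp (- del \<Theta> v)"
        by (simp add: algebra_simps)
    qed
    also have "\<dots> \<le> (\<integral>v. exp (- del (\<Phi> n) v) \<partial>\<mu>)" by (rule min[rule_format, OF \<Phi>])
    finally have "s n * (\<integral>v. exp (- del (\<Phi> n) v) * D v \<partial>\<mu>) \<le> 0" using integrable_exp_del[OF \<Phi>] iE by simp
    then show ?thesis using s(1)[of n] by (simp add: mult_le_0_iff)
  qed
  have "(\<lambda>n. \<integral>v. exp (- del (\<Phi> n) v) * D v \<partial>\<mu>) \<longlonglongrightarrow> (\<integral>v. exp (- del \<Theta> v) * D v \<partial>\<mu>)"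
  proof (rule integral_dominated_convergence[where w = "\<lambda>v. \<bar>D v\<bar>"])
    show "integrable \<mu> (\<lambda>v. \<bar>D v\<bar>)" using iD by simp
    have "(\<lambda>n. exp (- (del \<Theta> v + s n * D v)) * D v) \<longlonglongrightarrow> exp (- (del \<Theta> v + 0 * D v)) * D v" for v
      by (intro tendsto_intros s0)
    then show "AE v in \<mu>. (\<lambda>n. exp (- del (\<Phi> n) v) * D v) \<longlonglongrightarrow> exp (- del \<Theta> v) * D v" by (simp add: d\<Phi>)
  qed (use dom in auto)
  then have "(\<integral>v. exp (- del \<Theta> v) * D v \<partial>\<mu>) \<le> 0" by (rule LIMSEQ_le_const2) (use le0 in auto)
  moreover have g: "(\<lambda>v. exp (- del \<Theta> v)) \<in> borel_measurable borel" "\<bar>exp (- del \<Theta> v)\<bar> \<le> 1" for v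
    using del_allocation_nonneg[OF \<Theta>, of v] by auto
  ultimately show ?thesis
    using integrable_mult_del[OF \<Theta> g] integrable_mult_del[OF \<Theta>' g] by (simp add: D_def right_diff_distrib)
qed

theorem balanced_exists:
  obtains \<Theta> where "borel_allocation \<Theta>" "balanced_wrt \<Theta> \<mu>"
proof -
  obtain \<Theta> where \<Theta>: "borel_allocation \<Theta>"
    and min: "\<forall>\<Theta>'. borel_allocation \<Theta>' \<longrightarrow> (\<integral>v. exp (- del \<Theta> v) \<partial>\<mu>) \<le> (\<integral>v. exp (- del \<Theta>' v) \<partial>\<mu>)"
    using exp_load_minimiser .
  let ?g = "\<lambda>v. - exp (- del \<Theta> v)"
  have dm: "del \<Theta> \<in> borel_measurable borel" using borel_allocationD(1)[OF \<Theta>] by (rule del_measurable)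
  have nn: "0 \<le> del \<Theta> v" for v by (rule del_allocation_nonneg[OF \<Theta>])
  have g: "?g \<in> borel_measurable borel" "\<bar>?g v\<bar> \<le> 1" for v using dm nn by auto
  obtain \<Theta>' where \<Theta>': "borel_allocation \<Theta>'" "\<forall>x. argmin_supported ?g \<Theta>' x" using argmin_allocation[OF g(1)] .
  have "(\<integral>v. ?g v * del \<Theta> v \<partial>\<mu>) \<le> (\<integral>v. ?g v * del \<Theta>' v \<partial>\<mu>)"
    by (rule exp_load_first_variation[OF \<Theta> \<Theta>'(1) min])
  also have "\<dots> = integral\<^sup>L \<nu> (fmin ?g)"
    by (rule duality_eq_iff[OF \<Theta>'(1) g, THEN iffD2, symmetric]) (simp add: \<Theta>'(2))
  finally have "integral\<^sup>L \<nu> (fmin ?g) = (\<integral>v. ?g v * del \<Theta> v \<partial>\<mu>)"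
    using weak_duality[OF \<Theta> g] by (rule antisym[rotated])
  then have "balanced_wrt \<Theta> \<mu>" using balanced_iff_duality[OF \<Theta> dm nn] by simp
  with \<Theta> show ?thesis by (rule that)
qed

end


section \<open>Convex functions on the half-line\<close>

lemma convex_on_tangents:
  fixes f :: "real \<Rightarrow> real"
  assumes f: "convex_on {0..} f"
  obtains D where "\<forall>x y. 0 < x \<longrightarrow> 0 \<le> y \<longrightarrow> f x + D x * (y - x) \<le> f y"
proof
  show "\<forall>x y. 0 < x \<longrightarrow> 0 \<le> y \<longrightarrow>
    f x + (\<lambda>x. Inf ((\<lambda>t. (f x - f t) / (x - t)) ` ({x<..} \<inter> {0..}))) x * (y - x) \<le> f y"
    using convex_le_Inf_differential[OF f] by simp
qed

text \<open>
  The slopes at points \<open>q \<in> (x/2, x)\<close> are at least \<open>D (x/2)\<close>, so the tangents at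
  \<open>q\<close>, taken at \<open>x\<close>, tend to \<open>f x\<close> by the continuity of \<open>f\<close>
  at \<open>x > 0\<close>.
\<close>

lemma convex_on_tangent_approx:
  fixes f :: "real \<Rightarrow> real"
  assumes f: "convex_on {0..} f" and D: "\<forall>x y. 0 < x \<longrightarrow> 0 \<le> y \<longrightarrow> f x + D x * (y - x) \<le> f y"
    and x: "0 < x" and \<epsilon>: "0 < \<epsilon>"
  obtains q where "q \<in> \<rat>" "0 < q" "f x - \<epsilon> < f q + D q * (x - q)"
proof -
  have "convex_on {0<..} f" using f by (rule convex_on_subset) auto
  then have "continuous_on {0<..} f" by (intro convex_on_continuous) auto
  then have "isCont f x" using x by (simp add: continuous_on_eq_continuous_at)
  then have "(f \<longlongrightarrow> f x) (at_left x)" by (simp add: isCont_def filterlim_at_split)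
  then have "((\<lambda>q. f q + D (x / 2) * (x - q)) \<longlongrightarrow> f x + D (x / 2) * (x - x)) (at_left x)"
    by (intro tendsto_intros)
  then have "eventually (\<lambda>q. f x - \<epsilon> < f q + D (x / 2) * (x - q)) (at_left x)"
    using \<epsilon> by (intro order_tendstoD(1)) auto
  then obtain b where b: "b < x" "\<forall>q>b. q < x \<longrightarrow> f x - \<epsilon> < f q + D (x / 2) * (x - q)"
    unfolding eventually_at_left_field by auto
  obtain q where q: "q \<in> \<rat>" "max b (x / 2) < q" "q < x"
    using Rats_dense_in_real[of "max b (x / 2)" x] b(1) x by auto
  have "D (x / 2) * (q - x / 2) \<le> D q * (q - x / 2)"
    using D[rule_format, of "x / 2" q] D[rule_format, of q "x / 2"] q x by (simp add: algebra_simps)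
  then have "D (x / 2) \<le> D q" using q by simp
  then have "D (x / 2) * (x - q) \<le> D q * (x - q)" using q by (intro mult_right_mono) auto
  moreover have "f x - \<epsilon> < f q + D (x / 2) * (x - q)" using b(2) q by simp
  ultimately have "f x - \<epsilon> < f q + D q * (x - q)" by linarith
  then show ?thesis using q x by (intro that[of q]) auto
qed

definition upper_env :: "(nat \<Rightarrow> real) \<Rightarrow> (nat \<Rightarrow> real) \<Rightarrow> nat \<Rightarrow> real \<Rightarrow> real" where
  "upper_env a b n x = Max ((\<lambda>k. a k + b k * x) ` {..n})"

lemma upper_env_ge: "k \<le> n \<Longrightarrow> a k + b k * x \<le> upper_env a b n x"
  unfolding upper_env_def by (rule Max_ge) auto

lemma upper_env_le: "(\<And>k. k \<le> n \<Longrightarrow> a k + b k * x \<le> c) \<Longrightarrow> upper_env a b n x \<le> c"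
  unfolding upper_env_def by (subst Max_le_iff) auto

lemma upper_env_mono: "m \<le> n \<Longrightarrow> upper_env a b m x \<le> upper_env a b n x"
  by (rule upper_env_le) (rule upper_env_ge, simp)

text \<open>
  The slope of a line that attains the maximum at \<open>x\<close> is a subgradient there; finitely many lines
  have bounded slopes.
\<close>

lemma upper_env_subgradient:
  obtains \<gamma> B where "\<And>x. \<bar>\<gamma> x\<bar> \<le> B" "\<And>x y. upper_env a b n x + \<gamma> x * (y - x) \<le> upper_env a b n y"
proof -
  have "\<exists>k\<le>n. upper_env a b n x = a k + b k * x" for x
  proof -
    have "Max ((\<lambda>k. a k + b k * x) ` {..n}) \<in> (\<lambda>k. a k + b k * x) ` {..n}" by (rule Max_in) auto
    then show ?thesis unfolding upper_env_def by (metis (no_types, lifting) atMost_iff imageE)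
  qed
  then obtain k where k: "\<And>x. k x \<le> n" "\<And>x. upper_env a b n x = a (k x) + b (k x) * x" by metis
  have "\<bar>b (k x)\<bar> \<le> (\<Sum>j\<le>n. \<bar>b j\<bar>)" for x
    by (rule member_le_sum[of "k x" "{..n}" "\<lambda>j. \<bar>b j\<bar>"]) (use k in auto)
  moreover have "upper_env a b n x + b (k x) * (y - x) \<le> upper_env a b n y" for x y
    using upper_env_ge[OF k(1)[of x], of a b y] by (simp add: k(2)[of x] algebra_simps)
  ultimately show ?thesis by (rule that)
qed

lemma upper_env_measurable [measurable]: "upper_env a b n \<in> borel_measurable borel"
  unfolding upper_env_def[abs_def] by measurable

text \<open>
  The lines are the zero function, which is line \<open>0\<close>, and tangents at the positive rationals. Their
  supremum is \<open>f\<close> on \<open>(0, \<infinity>)\<close>. A convex function on \<open>[0,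
  \<infinity>)\<close> may jump up at the end point, or have slope \<open>-\<infinity>\<close> there; the jump
  is the constant \<open>c\<close>.
\<close>

lemma convex_on_decomposition:
  fixes f :: "real \<Rightarrow> real"
  assumes f: "convex_on {0..} f" and nn: "\<And>x. 0 \<le> x \<Longrightarrow> 0 \<le> f x"
  obtains a b c where "a 0 = 0" "b 0 = 0" "0 \<le> c"
    "\<forall>x\<ge>0. ennreal (f x) = (SUP n. ennreal (upper_env a b n x)) + ennreal c * indicator {0} x"
proof -
  obtain D where D: "\<forall>x y. 0 < x \<longrightarrow> 0 \<le> y \<longrightarrow> f x + D x * (y - x) \<le> f y"
    using convex_on_tangents[OF f] .
  let ?Q = "\<rat> \<inter> {0::real<..}"
  have Q: "countable ?Q" "?Q \<noteq> {}" by (auto intro!: countable_Int1 countable_rat exI[of _ 1])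
  define q where "q = from_nat_into ?Q"
  have q: "0 < q k" for k using from_nat_into[OF Q(2)] by (simp add: q_def)
  define a where "a k = (case k of 0 \<Rightarrow> 0 | Suc k \<Rightarrow> f (q k) - D (q k) * q k)" for k
  define b where "b k = (case k of 0 \<Rightarrow> 0 | Suc k \<Rightarrow> D (q k))" for k
  have le: "upper_env a b n x \<le> f x" if "0 \<le> x" for n x
  proof (rule upper_env_le)
    fix k show "a k + b k * x \<le> f x"
      using nn[OF that] D[rule_format, OF q that] by (cases k) (auto simp: a_def b_def algebra_simps)
  qed
  have ge0: "0 \<le> upper_env a b n x" for n x
    using upper_env_ge[of 0 n a b x] by (simp add: a_def b_def)
  define G where "G = (SUP n. upper_env a b n 0)"
  have bdd: "bdd_above (range (\<lambda>n. upper_env a b n 0))" by (rule bdd_aboveI2[of _ _ "f 0"]) (use le in simp)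
  have G: "0 \<le> G" "G \<le> f 0"
    using cSUP_least[of UNIV "\<lambda>n. upper_env a b n 0" "f 0"] le cSUP_upper2[OF bdd, of 0 0] ge0 by (auto simp: G_def)
  show ?thesis
  proof (rule that)
    show "a 0 = 0" "b 0 = 0" "0 \<le> f 0 - G" using G by (simp_all add: a_def b_def)
    show "\<forall>x\<ge>0. ennreal (f x) = (SUP n. ennreal (upper_env a b n x)) + ennreal (f 0 - G) * indicator {0} x"
    proof (intro allI impI)
      fix x :: real assume x: "0 \<le> x"
      show "ennreal (f x) = (SUP n. ennreal (upper_env a b n x)) + ennreal (f 0 - G) * indicator {0} x"
      proof (cases "x = 0")
        case True
        have "(SUP n. ennreal (upper_env a b n 0)) \<le> ennreal (f 0)"
          by (rule SUP_least) (use le in \<open>simp add: ennreal_leI\<close>)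
        then have "(SUP n. ennreal (upper_env a b n 0)) < top" by (rule le_less_trans) (rule ennreal_less_top)
        then have "(SUP n. ennreal (upper_env a b n 0)) \<noteq> top" by (rule less_imp_neq)
        then have "(SUP n. ennreal (upper_env a b n 0)) = ennreal G"
          unfolding G_def by (rule ennreal_SUP[symmetric]) (use ge0 in auto)
        then show ?thesis using True G by (simp add: ennreal_plus[symmetric] del: ennreal_plus)
      next
        case False
        then have x: "0 < x" using x by simp
        have "ennreal (f x) = (SUP n. ennreal (upper_env a b n x))"
        proof (rule antisym)
          show "(SUP n. ennreal (upper_env a b n x)) \<le> ennreal (f x)"
            by (rule SUP_least) (use le x in \<open>simp add: ennreal_leI\<close>)
          show "ennreal (f x) \<le> (SUP n. ennreal (upper_env a b n x))"
          proof (rule ennreal_le_epsilon)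
            fix \<epsilon> :: real assume "0 < \<epsilon>"
            then obtain p where p: "p \<in> \<rat>" "0 < p" "f x - \<epsilon> < f p + D p * (x - p)"
              using convex_on_tangent_approx[OF f D x] by metis
            then obtain k where k: "q k = p"
              using from_nat_into_surj[OF Q(1), of p] by (auto simp: q_def)
            have "f x \<le> upper_env a b (Suc k) x + \<epsilon>"
              using upper_env_ge[of "Suc k" "Suc k" a b x] p(3) by (simp add: a_def b_def k algebra_simps)
            then have "ennreal (f x) \<le> ennreal (upper_env a b (Suc k) x) + ennreal \<epsilon>"
              using ge0 \<open>0 < \<epsilon>\<close> by (simp add: ennreal_plus[symmetric] ennreal_leI del: ennreal_plus)
            also have "\<dots> \<le> (SUP n. ennreal (upper_env a b n x)) + ennreal \<epsilon>"
              by (intro add_right_mono SUP_upper) simp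
            finally show "ennreal (f x) \<le> (SUP n. ennreal (upper_env a b n x)) + ennreal \<epsilon>" .
          qed
        qed
        then show ?thesis using False by simp
      qed
    qed
  qed
qed

section \<open>Balanced allocations minimise every convex cost\<close>

context unimodular_measure
begin

lemma balanced_tangent:
  assumes \<Theta>: "borel_allocation \<Theta>" "balanced_wrt \<Theta> \<mu>" and \<Theta>': "borel_allocation \<Theta>'"
    and \<gamma>: "\<And>x y. 0 \<le> x \<Longrightarrow> x \<le> y \<Longrightarrow> \<gamma> x \<le> \<gamma> y" "\<And>x. \<bar>\<gamma> x\<bar> \<le> B" "(\<lambda>v. \<gamma> (del \<Theta> v)) \<in> borel_measurable borel"
  shows "(\<integral>v. \<gamma> (del \<Theta> v) * del \<Theta> v \<partial>\<mu>) \<le> (\<integral>v. \<gamma> (del \<Theta> v) * del \<Theta>' v \<partial>\<mu>)"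
  using balanced_duality[OF \<Theta> \<gamma>] weak_duality[OF \<Theta>' \<gamma>(3,2)] by simp

lemma integrable_del_alloc: "borel_allocation \<Theta> \<Longrightarrow> integrable \<mu> (del \<Theta>)"
  by (rule integrable_del[OF borel_allocationD(1,4)])

text \<open>
  The subgradients \<open>\<gamma>\<close> are increasing as a consequence of the tangent inequality, whatever
  choice is made at the corners of \<open>h\<close>, so \<open>balanced_tangent\<close> applies.
\<close>

lemma balanced_minimises_lipschitz:
  assumes \<Theta>: "borel_allocation \<Theta>" "balanced_wrt \<Theta> \<mu>" and \<Theta>': "borel_allocation \<Theta>'"
    and \<gamma>: "\<And>x. \<bar>\<gamma> x\<bar> \<le> B" and h: "\<And>x y. 0 \<le> x \<Longrightarrow> 0 \<le> y \<Longrightarrow> h x + \<gamma> x * (y - x) \<le> h y"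
    and hm: "h \<in> borel_measurable borel"
  shows "integrable \<mu> (\<lambda>v. h (del \<Theta> v))" "integrable \<mu> (\<lambda>v. h (del \<Theta>' v))"
    and "(\<integral>v. h (del \<Theta> v) \<partial>\<mu>) \<le> (\<integral>v. h (del \<Theta>' v) \<partial>\<mu>)"
proof -
  have nn: "0 \<le> del \<Theta> v" "0 \<le> del \<Theta>' v" for v
    by (rule del_allocation_nonneg, fact)+
  have m[measurable]: "\<Theta> \<in> borel_measurable borel" "\<Theta>' \<in> borel_measurable borel"
    using \<Theta> \<Theta>' by (auto dest: borel_allocationD(1))
  have mono: "\<gamma> x \<le> \<gamma> y" if "0 \<le> x" "x \<le> y" for x y
  proof (cases "x = y")
    case False
    have "\<gamma> x * (y - x) \<le> \<gamma> y * (y - x)" using h[of x y] h[of y x] that by (simp add: algebra_simps)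
    then show ?thesis using that False by simp
  qed simp
  \<comment> \<open>Loads are nonnegative, so \<open>\<gamma>\<close> may be changed on \<open>(-\<infinity>, 0)\<close> to be monotone everywhere, hence Borel.\<close>
  have "mono (\<lambda>x. \<gamma> (max 0 x))" by (intro monoI mono) auto
  then have [measurable]: "(\<lambda>x. \<gamma> (max 0 x)) \<in> borel_measurable borel" by (rule borel_measurable_mono)
  have "(\<lambda>v. \<gamma> (max 0 (del \<Theta> v))) \<in> borel_measurable borel" by measurable
  then have \<gamma>m: "(\<lambda>v. \<gamma> (del \<Theta> v)) \<in> borel_measurable borel" using nn by (simp add: max_absorb2)
  have hb: "\<bar>h x\<bar> \<le> \<bar>h 0\<bar> + B * x" if "0 \<le> x" for x
  proof -
    have "\<bar>\<gamma> x * x\<bar> \<le> B * x" "\<bar>\<gamma> 0 * x\<bar> \<le> B * x"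
      using \<gamma> that by (auto simp: abs_mult intro!: mult_right_mono)
    then show ?thesis using h[of x 0] h[of 0 x] that by (auto simp: abs_le_iff)
  qed
  have int: "integrable \<mu> (\<lambda>v. h (del \<Phi> v))" if \<Phi>: "borel_allocation \<Phi>" for \<Phi>
  proof (rule Bochner_Integration.integrable_bound)
    show "integrable \<mu> (\<lambda>v. \<bar>h 0\<bar> + B * del \<Phi> v)" using integrable_del_alloc[OF \<Phi>] by simp
    have "0 \<le> del \<Phi> v" for v by (rule del_allocation_nonneg[OF \<Phi>])
    then show "AE v in \<mu>. norm (h (del \<Phi> v)) \<le> norm (\<bar>h 0\<bar> + B * del \<Phi> v)"
      using order_trans[OF hb abs_ge_self] by simp
    show "(\<lambda>v. h (del \<Phi> v)) \<in> borel_measurable \<mu>"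
      using hm borel_allocationD(1)[OF \<Phi>] by measurable
  qed
  show i: "integrable \<mu> (\<lambda>v. h (del \<Theta> v))" "integrable \<mu> (\<lambda>v. h (del \<Theta>' v))"
    using int \<Theta> \<Theta>' by auto
  have g: "integrable \<mu> (\<lambda>v. \<gamma> (del \<Theta> v) * del \<Theta> v)" "integrable \<mu> (\<lambda>v. \<gamma> (del \<Theta> v) * del \<Theta>' v)"
    using integrable_mult_del[OF _ \<gamma>m \<gamma>] \<Theta> \<Theta>' by auto
  have "(\<integral>v. h (del \<Theta> v) \<partial>\<mu>) + (\<integral>v. \<gamma> (del \<Theta> v) * del \<Theta>' v - \<gamma> (del \<Theta> v) * del \<Theta> v \<partial>\<mu>) =
        (\<integral>v. h (del \<Theta> v) + (\<gamma> (del \<Theta> v) * del \<Theta>' v - \<gamma> (del \<Theta> v) * del \<Theta> v) \<partial>\<mu>)"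
    using i(1) g by simp
  also have "\<dots> \<le> (\<integral>v. h (del \<Theta>' v) \<partial>\<mu>)"
    using i g h[OF nn(1) nn(2)] by (intro integral_mono) (auto simp: algebra_simps)
  finally show "(\<integral>v. h (del \<Theta> v) \<partial>\<mu>) \<le> (\<integral>v. h (del \<Theta>' v) \<partial>\<mu>)"
    using balanced_tangent[OF \<Theta> \<Theta>' mono \<gamma> \<gamma>m] g by simp
qed

lemma balanced_minimises_upper_env:
  assumes \<Theta>: "borel_allocation \<Theta>" "balanced_wrt \<Theta> \<mu>" and \<Theta>': "borel_allocation \<Theta>'"
    and ab: "a 0 = 0" "b 0 = 0"
  shows "(\<integral>\<^sup>+v. ennreal (upper_env a b n (del \<Theta> v)) \<partial>\<mu>) \<le> (\<integral>\<^sup>+v. ennreal (upper_env a b n (del \<Theta>' v)) \<partial>\<mu>)"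
proof -
  obtain \<gamma> B where \<gamma>: "\<And>x. \<bar>\<gamma> x\<bar> \<le> B" "\<And>x y. upper_env a b n x + \<gamma> x * (y - x) \<le> upper_env a b n y"
    by (rule upper_env_subgradient[of a b n]) blast
  note * = balanced_minimises_lipschitz[OF \<Theta> \<Theta>' \<gamma>(1) \<gamma>(2) upper_env_measurable]
  have "0 \<le> upper_env a b n x" for x using upper_env_ge[of 0 n a b x] ab by simp
  then show ?thesis using * by (simp add: nn_integral_eq_integral ennreal_leI)
qed

text \<open>
  The indicator of \<open>0\<close> is the limit on \<open>[0, \<infinity>)\<close> of the convex functions
  \<open>(1 - n x)\<^sup>+\<close>. This takes care of a jump of the cost at \<open>0\<close>.
\<close>

lemma balanced_minimises_atom:
  assumes \<Theta>: "borel_allocation \<Theta>" "balanced_wrt \<Theta> \<mu>" and \<Theta>': "borel_allocation \<Theta>'"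
  shows "(\<integral>\<^sup>+v. indicator {0} (del \<Theta> v) \<partial>\<mu>) \<le> (\<integral>\<^sup>+v. indicator {0} (del \<Theta>' v) \<partial>\<mu>)"
proof -
  define h where "h n x = max 0 (1 - real n * x)" for n and x :: real
  have le: "(\<integral>v. h n (del \<Theta> v) \<partial>\<mu>) \<le> (\<integral>v. h n (del \<Theta>' v) \<partial>\<mu>)" for n
  proof (rule balanced_minimises_lipschitz(3)[OF \<Theta> \<Theta>'])
    show "\<bar>if 1 - real n * x > 0 then - real n else 0\<bar> \<le> real n" for x by simp
    show "h n x + (if 1 - real n * x > 0 then - real n else 0) * (y - x) \<le> h n y" for x y
      by (simp add: h_def algebra_simps)
    show "h n \<in> borel_measurable borel" unfolding h_def[abs_def] by measurable
  qed
  have lim: "(\<lambda>n. \<integral>v. h n (del \<Phi> v) \<partial>\<mu>) \<longlonglongrightarrow> (\<integral>v. indicat_real {0} (del \<Phi> v) \<partial>\<mu>)"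
    if \<Phi>: "borel_allocation \<Phi>" for \<Phi>
  proof (rule integral_dominated_convergence[where w = "\<lambda>_. 1"])
    have [measurable]: "\<Phi> \<in> borel_measurable borel" by (rule borel_allocationD(1)[OF \<Phi>])
    have [measurable]: "h n \<in> borel_measurable borel" for n unfolding h_def[abs_def] by measurable
    have nn: "0 \<le> del \<Phi> v" for v by (rule del_allocation_nonneg[OF \<Phi>])
    show "(\<lambda>v. indicat_real {0} (del \<Phi> v)) \<in> borel_measurable \<mu>" "(\<lambda>v. h n (del \<Phi> v)) \<in> borel_measurable \<mu>" for n
      by measurable
    show "AE v in \<mu>. norm (h n (del \<Phi> v)) \<le> 1" for n using nn by (auto simp: h_def)
    have "(\<lambda>n. h n x) \<longlonglongrightarrow> indicat_real {0} x" if "0 \<le> x" for x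
    proof (cases "x = 0")
      case True then show ?thesis by (simp add: h_def)
    next
      case False
      then have "0 < x" using that by simp
      then obtain N where N: "1 < real N * x" using reals_Archimedean3 by blast
      have "h n x = 0" if "n \<ge> N" for n
      proof -
        have "real N * x \<le> real n * x" using that \<open>0 < x\<close> by (intro mult_right_mono) auto
        then show ?thesis using N by (simp add: h_def)
      qed
      then show ?thesis using False by (intro tendsto_eventually) (auto simp: eventually_sequentially)
    qed
    then show "AE v in \<mu>. (\<lambda>n. h n (del \<Phi> v)) \<longlonglongrightarrow> indicat_real {0} (del \<Phi> v)" using nn by simp
  qed simp
  have eq: "(\<integral>\<^sup>+v. indicator {0} (del \<Phi> v) \<partial>\<mu>) = ennreal (\<integral>v. indicat_real {0} (del \<Phi> v) \<partial>\<mu>)"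
    if \<Phi>: "borel_allocation \<Phi>" for \<Phi>
  proof -
    have [measurable]: "\<Phi> \<in> borel_measurable borel" by (rule borel_allocationD(1)[OF \<Phi>])
    have "integrable \<mu> (\<lambda>v. indicat_real {0} (del \<Phi> v))"
      by (rule integrable_const_bound[of _ 1]) auto
    then show ?thesis by (subst nn_integral_eq_integral[symmetric]) (auto simp: ennreal_indicator)
  qed
  show ?thesis unfolding eq[OF \<Theta>(1)] eq[OF \<Theta>']
    by (intro ennreal_leI LIMSEQ_le[OF lim[OF \<Theta>(1)] lim[OF \<Theta>']]) (use le in auto)
qed

lemma load_cost_decomposition:
  assumes \<Theta>: "borel_allocation \<Theta>" and ab: "a 0 = 0" "b 0 = 0"
    and f: "\<forall>x\<ge>0. ennreal (f x) = (SUP n. ennreal (upper_env a b n x)) + ennreal c * indicator {0} x"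
  shows "load_cost \<mu> f \<Theta> = (SUP n. \<integral>\<^sup>+v. ennreal (upper_env a b n (del \<Theta> v)) \<partial>\<mu>) + ennreal c * (\<integral>\<^sup>+v. indicator {0} (del \<Theta> v) \<partial>\<mu>)"
    and "(\<lambda>v. ennreal (f (del \<Theta> v))) \<in> borel_measurable \<mu>"
proof -
  have [measurable]: "\<Theta> \<in> borel_measurable borel" by (rule borel_allocationD(1)[OF \<Theta>])
  have nn: "0 \<le> del \<Theta> v" for v by (rule del_allocation_nonneg[OF \<Theta>])
  have eq: "ennreal (f (del \<Theta> v)) = (SUP n. ennreal (upper_env a b n (del \<Theta> v))) + ennreal c * indicator {0} (del \<Theta> v)" for v
    using f nn by blast
  show "(\<lambda>v. ennreal (f (del \<Theta> v))) \<in> borel_measurable \<mu>" unfolding eq by measurable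
  have "(\<integral>\<^sup>+v. (SUP n. ennreal (upper_env a b n (del \<Theta> v))) \<partial>\<mu>) = (SUP n. \<integral>\<^sup>+v. ennreal (upper_env a b n (del \<Theta> v)) \<partial>\<mu>)"
    by (rule nn_integral_monotone_convergence_SUP) (auto simp: incseq_def le_fun_def intro!: ennreal_leI upper_env_mono)
  then show "load_cost \<mu> f \<Theta> = (SUP n. \<integral>\<^sup>+v. ennreal (upper_env a b n (del \<Theta> v)) \<partial>\<mu>) + ennreal c * (\<integral>\<^sup>+v. indicator {0} (del \<Theta> v) \<partial>\<mu>)"
    unfolding load_cost_def eq by (simp add: nn_integral_add nn_integral_cmult)
qed

theorem balanced_minimises_convex:
  assumes \<Theta>: "borel_allocation \<Theta>" "balanced_wrt \<Theta> \<mu>" and \<Theta>': "borel_allocation \<Theta>'"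
    and f: "convex_on {0..} f" "\<And>x. 0 \<le> x \<Longrightarrow> 0 \<le> f x"
  shows "load_cost \<mu> f \<Theta> \<le> load_cost \<mu> f \<Theta>'"
proof -
  obtain a b c where ab: "a 0 = 0" "b 0 = 0" and c: "0 \<le> c"
    "\<forall>x\<ge>0. ennreal (f x) = (SUP n. ennreal (upper_env a b n x)) + ennreal c * indicator {0} x"
    using convex_on_decomposition[OF f] by metis
  show ?thesis
    unfolding load_cost_decomposition(1)[OF \<Theta>(1) ab c(2)] load_cost_decomposition(1)[OF \<Theta>' ab c(2)]
  proof (intro add_mono mult_left_mono balanced_minimises_atom[OF \<Theta> \<Theta>'])
    show "(SUP n. \<integral>\<^sup>+v. ennreal (upper_env a b n (del \<Theta> v)) \<partial>\<mu>) \<le> (SUP n. \<integral>\<^sup>+v. ennreal (upper_env a b n (del \<Theta>' v)) \<partial>\<mu>)"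
      by (rule SUP_mono') (rule balanced_minimises_upper_env[OF \<Theta> \<Theta>', of a b, OF ab])
  qed simp
qed

lemma strictly_convex_on_imp_convex_on:
  assumes "strictly_convex_on S f" shows "convex_on S f"
proof (rule convex_onI)
  show "convex S" using assms by (simp add: strictly_convex_on_def)
  fix t x y :: real assume "0 < t" "t < 1" "x \<in> S" "y \<in> S"
  then show "f ((1 - t) *\<^sub>R x + t *\<^sub>R y) \<le> (1 - t) * f x + t * f y"
  proof (cases "x = y")
    case True then show ?thesis by (simp add: algebra_simps)
  next
    case False
    have "\<forall>x\<in>S. \<forall>y\<in>S. \<forall>u. x \<noteq> y \<and> 0 < u \<and> u < 1 \<longrightarrow> f ((1 - u) * x + u * y) < (1 - u) * f x + u * f y"
      using assms by (simp add: strictly_convex_on_def)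
    from this[rule_format, OF \<open>x \<in> S\<close> \<open>y \<in> S\<close>, of t] show ?thesis
      using False \<open>0 < t\<close> \<open>t < 1\<close> by simp
  qed
qed

text \<open>
  Otherwise the midpoint of the two allocations would have a strictly smaller cost. Finiteness of the cost is
  essential for the strict inequality of the integrals.
\<close>

lemma strictly_convex_minimisers_agree:
  assumes \<Theta>: "borel_allocation \<Theta>" and \<Phi>: "borel_allocation \<Phi>"
    and f: "strictly_convex_on {0..} f" "\<And>x. 0 \<le> x \<Longrightarrow> 0 \<le> f x" and fin: "load_cost \<mu> f \<Theta> < \<infinity>"
    and min: "\<And>\<Theta>'. borel_allocation \<Theta>' \<Longrightarrow> load_cost \<mu> f \<Theta> \<le> load_cost \<mu> f \<Theta>'"
    and eq: "load_cost \<mu> f \<Phi> = load_cost \<mu> f \<Theta>"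
  shows "AE v in \<mu>. del \<Theta> v = del \<Phi> v"
proof (rule ccontr)
  assume neq: "\<not> (AE v in \<mu>. del \<Theta> v = del \<Phi> v)"
  let ?M = "\<lambda>x. (1 - 1/2) * \<Theta> x + 1/2 * \<Phi> x"
  have M: "borel_allocation ?M" by (intro borel_allocation_convex \<Theta> \<Phi>) auto
  have dM: "del ?M v = (1 - 1/2) * del \<Theta> v + 1/2 * del \<Phi> v" for v by (rule del_convex)
  have nn: "0 \<le> del \<Theta> v" "0 \<le> del \<Phi> v" "0 \<le> del ?M v" for v
    by (rule del_allocation_nonneg, fact)+
  have conv: "convex_on {0..} f" by (rule strictly_convex_on_imp_convex_on[OF f(1)])
  obtain a b c where dec: "a 0 = 0" "b 0 = 0" "0 \<le> c"
    "\<forall>x\<ge>0. ennreal (f x) = (SUP n. ennreal (upper_env a b n x)) + ennreal c * indicator {0} x"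
    using convex_on_decomposition[OF conv f(2)] by metis
  note meas[measurable] = load_cost_decomposition(2)[OF \<Theta> dec(1,2,4)]
    load_cost_decomposition(2)[OF \<Phi> dec(1,2,4)] load_cost_decomposition(2)[OF M dec(1,2,4)]
  let ?r = "\<lambda>v. ennreal (1/2) * ennreal (f (del \<Theta> v)) + ennreal (1/2) * ennreal (f (del \<Phi> v))"
  have r: "?r v = ennreal ((1 - 1/2) * f (del \<Theta> v) + 1/2 * f (del \<Phi> v))" for v
  proof -
    have half: "1 - 1 / 2 = (1 / 2 :: real)" "0 \<le> (1 / 2 :: real)" by simp_all
    show ?thesis using f(2)[OF nn(1)[of v]] f(2)[OF nn(2)[of v]]
      by (simp only: half ennreal_plus ennreal_mult' mult_nonneg_nonneg)
  qed
  have half: "ennreal (1 / 2) + ennreal (1 / 2) = 1" by (subst ennreal_plus[symmetric]) simp_all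
  have cost: "(\<integral>\<^sup>+v. ?r v \<partial>\<mu>) = load_cost \<mu> f \<Theta>"
  proof -
    have "(\<integral>\<^sup>+v. ?r v \<partial>\<mu>) = ennreal (1/2) * load_cost \<mu> f \<Theta> + ennreal (1/2) * load_cost \<mu> f \<Theta>"
      unfolding eq[symmetric] by (subst (1) eq) (simp add: load_cost_def nn_integral_add nn_integral_cmult)
    also have "\<dots> = load_cost \<mu> f \<Theta>"
      unfolding distrib_right[symmetric] half by simp
    finally show ?thesis .
  qed
  have le: "ennreal (f (del ?M v)) \<le> ?r v" for v
    unfolding r dM using convex_onD[OF conv, of "1/2" "del \<Theta> v" "del \<Phi> v"] nn by (intro ennreal_leI) simp
  have strict: "del \<Theta> v = del \<Phi> v" if "?r v \<le> ennreal (f (del ?M v))" for v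
  proof (rule ccontr)
    assume ne: "del \<Theta> v \<noteq> del \<Phi> v"
    have "f ((1 - 1/2) * del \<Theta> v + 1/2 * del \<Phi> v) < (1 - 1/2) * f (del \<Theta> v) + 1/2 * f (del \<Phi> v)"
    proof -
      have "\<forall>x\<in>{0..}. \<forall>y\<in>{0..}. \<forall>u. x \<noteq> y \<and> 0 < u \<and> u < 1 \<longrightarrow> f ((1 - u) * x + u * y) < (1 - u) * f x + u * f y"
        using f(1) by (simp add: strictly_convex_on_def)
      from this[rule_format, of "del \<Theta> v" "del \<Phi> v" "1/2"] show ?thesis using ne nn(1,2) by simp
    qed
    moreover have "(1 - 1/2) * f (del \<Theta> v) + 1/2 * f (del \<Phi> v) \<le> f (del ?M v)"
      using that f(2)[OF nn(3)] unfolding r by (simp add: ennreal_le_iff)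
    ultimately show False unfolding dM by linarith
  qed
  have "load_cost \<mu> f ?M < (\<integral>\<^sup>+v. ?r v \<partial>\<mu>)"
    unfolding load_cost_def
  proof (rule nn_integral_less)
    show "(\<lambda>v. ennreal (f (del ?M v))) \<in> borel_measurable \<mu>" by (rule meas)
    show "?r \<in> borel_measurable \<mu>" by measurable
    show "(\<integral>\<^sup>+v. ennreal (f (del ?M v)) \<partial>\<mu>) \<noteq> \<infinity>"
    proof -
      have "(\<integral>\<^sup>+v. ennreal (f (del ?M v)) \<partial>\<mu>) \<le> (\<integral>\<^sup>+v. ?r v \<partial>\<mu>)" by (intro nn_integral_mono le)
      then show ?thesis using fin unfolding cost by auto
    qed
    show "\<not> (AE v in \<mu>. ?r v \<le> ennreal (f (del ?M v)))"
    proof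
      assume "AE v in \<mu>. ?r v \<le> ennreal (f (del ?M v))"
      then have "AE v in \<mu>. del \<Theta> v = del \<Phi> v" by (rule AE_mp) (use strict in auto)
      with neq show False ..
    qed
  qed (use le in auto)
  then show False using min[OF M] unfolding cost by simp
qed

lemma exp_gt_one_plus:
  assumes "x \<noteq> (0 :: real)" shows "1 + x < exp x"
proof (cases "0 \<le> 1 + x / 2")
  case True
  have "1 + x < (1 + x / 2)\<^sup>2" using assms zero_less_power2[of x] by (simp add: power2_eq_square field_simps)
  also have "\<dots> \<le> (exp (x / 2))\<^sup>2" using True by (intro power_mono exp_ge_add_one_self)
  also have "\<dots> = exp x" by (simp add: power2_eq_square exp_add[symmetric])
  finally show ?thesis .
next
  case False
  then have "1 + x < 0" by simp
  then show ?thesis using exp_gt_zero[of x] by linarith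
qed

lemma strictly_convex_on_exp: "strictly_convex_on {0..} (\<lambda>x. exp (- x))"
  unfolding strictly_convex_on_def
proof (intro conjI ballI allI impI)
  show "convex {0::real..}" by simp
  fix x y u :: real assume u: "x \<noteq> y \<and> 0 < u \<and> u < 1"
  let ?z = "(1 - u) * x + u * y"
  have tangent: "exp (- ?z) * (1 + (?z - w)) < exp (- w)" if "w \<noteq> ?z" for w
  proof -
    have "exp (- ?z) * (1 + (?z - w)) < exp (- ?z) * exp (?z - w)"
      using that exp_gt_one_plus[of "?z - w"] by simp
    then show ?thesis by (simp add: exp_add[symmetric])
  qed
  have "?z - x = u * (y - x)" "y - ?z = (1 - u) * (y - x)" by (simp_all add: algebra_simps)
  then have ne: "x \<noteq> ?z" "y \<noteq> ?z" using u by auto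
  have "exp (- ?z) = (1 - u) * (exp (- ?z) * (1 + (?z - x))) + u * (exp (- ?z) * (1 + (?z - y)))"
    by (simp add: algebra_simps)
  also have "\<dots> < (1 - u) * exp (- x) + u * exp (- y)"
    using u by (intro add_strict_mono mult_strict_left_mono tangent ne) auto
  finally show "exp (- ?z) < (1 - u) * exp (- x) + u * exp (- y)" .
qed

lemma load_cost_exp_finite:
  assumes "borel_allocation \<Theta>" shows "load_cost \<mu> (\<lambda>x. exp (- x)) \<Theta> < \<infinity>"
proof -
  have "load_cost \<mu> (\<lambda>x. exp (- x)) \<Theta> \<le> (\<integral>\<^sup>+v. 1 \<partial>\<mu>)"
    unfolding load_cost_def using del_allocation_nonneg[OF assms]
    by (intro nn_integral_mono) simp
  then show ?thesis using emeasure_space_1 by (simp add: order_le_less_trans[OF _ ennreal_one_less_top])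
qed

text \<open>
  Two balanced allocations both minimise the cost \<open>exp (- x)\<close>. Conversely,
  \<open>balanced_iff_duality\<close> with \<open>L = \<partial>\<Theta>\<^sub>0\<close> involves
  \<open>\<Theta>\<close> through its load only.
\<close>

theorem balanced_loads_agree:
  assumes \<Theta>\<^sub>0: "borel_allocation \<Theta>\<^sub>0" "balanced_wrt \<Theta>\<^sub>0 \<mu>" and \<Theta>: "borel_allocation \<Theta>"
  shows "balanced_wrt \<Theta> \<mu> \<longleftrightarrow> (AE v in \<mu>. del \<Theta>\<^sub>0 v = del \<Theta> v)"
proof
  assume bal: "balanced_wrt \<Theta> \<mu>"
  note conv = strictly_convex_on_imp_convex_on[OF strictly_convex_on_exp]
  show "AE v in \<mu>. del \<Theta>\<^sub>0 v = del \<Theta> v"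
  proof (rule strictly_convex_minimisers_agree[OF \<Theta>\<^sub>0(1) \<Theta> strictly_convex_on_exp _ load_cost_exp_finite[OF \<Theta>\<^sub>0(1)]])
    show "load_cost \<mu> (\<lambda>x. exp (- x)) \<Theta> = load_cost \<mu> (\<lambda>x. exp (- x)) \<Theta>\<^sub>0"
      using balanced_minimises_convex[OF \<Theta>\<^sub>0 \<Theta> conv] balanced_minimises_convex[OF \<Theta> bal \<Theta>\<^sub>0(1) conv] by simp
  qed (use balanced_minimises_convex[OF \<Theta>\<^sub>0 _ conv] in auto)
next
  assume eq: "AE v in \<mu>. del \<Theta>\<^sub>0 v = del \<Theta> v"
  have dm: "del \<Theta>\<^sub>0 \<in> borel_measurable borel" using borel_allocationD(1)[OF \<Theta>\<^sub>0(1)] by (rule del_measurable)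
  have nn: "0 \<le> del \<Theta>\<^sub>0 v" for v by (rule del_allocation_nonneg[OF \<Theta>\<^sub>0(1)])
  have "(\<integral>v. - exp (- del \<Theta>\<^sub>0 v) * del \<Theta> v \<partial>\<mu>) = (\<integral>v. - exp (- del \<Theta>\<^sub>0 v) * del \<Theta>\<^sub>0 v \<partial>\<mu>)"
    using eq borel_allocationD(1)[OF \<Theta>] borel_allocationD(1)[OF \<Theta>\<^sub>0(1)]
    by (intro integral_cong_AE) (auto elim!: AE_mp)
  then show "balanced_wrt \<Theta> \<mu>"
    using balanced_iff_duality[OF \<Theta>\<^sub>0(1) dm nn] \<Theta>\<^sub>0(2) balanced_iff_duality[OF \<Theta> dm nn eq] by simp
qed

text \<open>
  A balanced allocation minimises the bounded cost \<open>exp (- x)\<close>. A minimiser for some other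
  \<open>f\<close> has the load of a balanced allocation, since one exists and it minimises \<open>f\<close> as
  well.
\<close>

theorem balanced_iff_strictly_convex:
  assumes \<Theta>: "borel_allocation \<Theta>"
  shows "balanced_wrt \<Theta> \<mu> \<longleftrightarrow>
          (\<exists>f. strictly_convex_on {0..} f \<and> (\<forall>x\<ge>0. 0 \<le> f x) \<and> load_cost \<mu> f \<Theta> < \<infinity> \<and>
             (\<forall>\<Theta>'. borel_allocation \<Theta>' \<longrightarrow> load_cost \<mu> f \<Theta> \<le> load_cost \<mu> f \<Theta>'))"
proof
  assume "balanced_wrt \<Theta> \<mu>"
  then show "\<exists>f. strictly_convex_on {0..} f \<and> (\<forall>x\<ge>0. 0 \<le> f x) \<and> load_cost \<mu> f \<Theta> < \<infinity> \<and>
             (\<forall>\<Theta>'. borel_allocation \<Theta>' \<longrightarrow> load_cost \<mu> f \<Theta> \<le> load_cost \<mu> f \<Theta>')"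
    using strictly_convex_on_exp load_cost_exp_finite[OF \<Theta>]
      balanced_minimises_convex[OF \<Theta> _ _ strictly_convex_on_imp_convex_on[OF strictly_convex_on_exp]]
    by (intro exI[of _ "\<lambda>x. exp (- x)"]) auto
next
  assume "\<exists>f. strictly_convex_on {0..} f \<and> (\<forall>x\<ge>0. 0 \<le> f x) \<and> load_cost \<mu> f \<Theta> < \<infinity> \<and>
             (\<forall>\<Theta>'. borel_allocation \<Theta>' \<longrightarrow> load_cost \<mu> f \<Theta> \<le> load_cost \<mu> f \<Theta>')"
  then obtain f where f: "strictly_convex_on {0..} f" "\<And>x. 0 \<le> x \<Longrightarrow> 0 \<le> f x" "load_cost \<mu> f \<Theta> < \<infinity>"
    and min: "\<And>\<Theta>'. borel_allocation \<Theta>' \<Longrightarrow> load_cost \<mu> f \<Theta> \<le> load_cost \<mu> f \<Theta>'" by blast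
  obtain \<Theta>\<^sub>0 where \<Theta>\<^sub>0: "borel_allocation \<Theta>\<^sub>0" "balanced_wrt \<Theta>\<^sub>0 \<mu>" using balanced_exists .
  have "load_cost \<mu> f \<Theta>\<^sub>0 = load_cost \<mu> f \<Theta>"
    using balanced_minimises_convex[OF \<Theta>\<^sub>0 \<Theta> strictly_convex_on_imp_convex_on[OF f(1)] f(2)] min[OF \<Theta>\<^sub>0(1)] by simp
  then have "AE v in \<mu>. del \<Theta> v = del \<Theta>\<^sub>0 v"
    using strictly_convex_minimisers_agree[OF \<Theta> \<Theta>\<^sub>0(1) f min] by blast
  then show "balanced_wrt \<Theta> \<mu>" using balanced_loads_agree[OF \<Theta>\<^sub>0 \<Theta>] by (simp add: eq_commute)
qed

theorem balanced_iff_all_convex: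
  assumes \<Theta>: "borel_allocation \<Theta>"
  shows "balanced_wrt \<Theta> \<mu> \<longleftrightarrow>
          (\<forall>f. convex_on {0..} f \<and> (\<forall>x\<ge>0. 0 \<le> f x) \<longrightarrow>
             (\<forall>\<Theta>'. borel_allocation \<Theta>' \<longrightarrow> load_cost \<mu> f \<Theta> \<le> load_cost \<mu> f \<Theta>'))" (is "_ \<longleftrightarrow> ?R")
proof
  show ?R if "balanced_wrt \<Theta> \<mu>" using balanced_minimises_convex[OF \<Theta> that] by blast
  assume R: ?R
  show "balanced_wrt \<Theta> \<mu>"
    unfolding balanced_iff_strictly_convex[OF \<Theta>]
    using strictly_convex_on_exp load_cost_exp_finite[OF \<Theta>] strictly_convex_on_imp_convex_on[OF strictly_convex_on_exp] R
    by (intro exI[of _ "\<lambda>x. exp (- x)"]) auto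
qed

text \<open>
  The maximum is attained at the indicator of \<open>{\<partial>\<Theta> > t}\<close>.
\<close>

theorem balanced_excess_duality:
  assumes \<Theta>: "borel_allocation \<Theta>" "balanced_wrt \<Theta> \<mu>"
  shows "\<exists>f. f \<in> borel_measurable borel \<and> (\<forall>x. 0 \<le> f x \<and> f x \<le> 1) \<and>
             (\<integral>x. max (del \<Theta> x - t) 0 \<partial>\<mu>) = (\<integral>x. fmin f x \<partial>\<nu>) - t * (\<integral>x. f x \<partial>\<mu>)" (is ?A)
    and "f \<in> borel_measurable borel \<Longrightarrow> \<forall>x. 0 \<le> f x \<and> f x \<le> 1 \<Longrightarrow>
             (\<integral>x. fmin f x \<partial>\<nu>) - t * (\<integral>x. f x \<partial>\<mu>) \<le> (\<integral>x. max (del \<Theta> x - t) 0 \<partial>\<mu>)"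
proof -
  have [measurable]: "\<Theta> \<in> borel_measurable borel" by (rule borel_allocationD(1)[OF \<Theta>(1)])
  have dm: "del \<Theta> \<in> borel_measurable borel" by (rule del_measurable) measurable
  have int: "(\<integral>v. f v * del \<Theta> v \<partial>\<mu>) - t * (\<integral>x. f x \<partial>\<mu>) = (\<integral>v. f v * (del \<Theta> v - t) \<partial>\<mu>)"
    "integrable \<mu> (\<lambda>v. f v * (del \<Theta> v - t))"
    if f: "f \<in> borel_measurable borel" "\<And>v. \<bar>f v\<bar> \<le> 1" for f
  proof -
    have "integrable \<mu> f" by (rule integrable_const_bound[of _ 1]) (use f in auto)
    moreover note integrable_mult_del[OF \<Theta>(1) f]
    ultimately show "(\<integral>v. f v * del \<Theta> v \<partial>\<mu>) - t * (\<integral>x. f x \<partial>\<mu>) = (\<integral>v. f v * (del \<Theta> v - t) \<partial>\<mu>)"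
      "integrable \<mu> (\<lambda>v. f v * (del \<Theta> v - t))"
      by (simp_all add: right_diff_distrib)
  qed
  let ?\<gamma> = "\<lambda>x. if t < x then 1 else 0 :: real"
  have \<gamma>: "(\<lambda>v. ?\<gamma> (del \<Theta> v)) \<in> borel_measurable borel" by measurable
  have "(\<integral>x. max (del \<Theta> x - t) 0 \<partial>\<mu>) = (\<integral>v. ?\<gamma> (del \<Theta> v) * (del \<Theta> v - t) \<partial>\<mu>)"
    by (intro Bochner_Integration.integral_cong) auto
  also have "\<dots> = (\<integral>v. ?\<gamma> (del \<Theta> v) * del \<Theta> v \<partial>\<mu>) - t * (\<integral>x. ?\<gamma> (del \<Theta> x) \<partial>\<mu>)"
    using \<gamma> by (intro int(1)[symmetric]) auto
  also have "(\<integral>v. ?\<gamma> (del \<Theta> v) * del \<Theta> v \<partial>\<mu>) = (\<integral>x. fmin (\<lambda>v. ?\<gamma> (del \<Theta> v)) x \<partial>\<nu>)"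
    using \<gamma> by (intro balanced_duality[OF \<Theta>, of ?\<gamma> 1, symmetric]) auto
  finally show ?A using \<gamma> by (intro exI[of _ "\<lambda>v. ?\<gamma> (del \<Theta> v)"]) auto
  assume f: "f \<in> borel_measurable borel" "\<forall>x. 0 \<le> f x \<and> f x \<le> 1"
  then have b: "\<bar>f v\<bar> \<le> 1" for v by (simp add: abs_of_nonneg)
  have "(\<integral>x. fmin f x \<partial>\<nu>) - t * (\<integral>x. f x \<partial>\<mu>) \<le> (\<integral>v. f v * (del \<Theta> v - t) \<partial>\<mu>)"
    using weak_duality[OF \<Theta>(1) f(1) b] int(1)[OF f(1) b] by simp
  also have "\<dots> \<le> (\<integral>x. max (del \<Theta> x - t) 0 \<partial>\<mu>)"
  proof (rule integral_mono[OF int(2)[OF f(1) b]])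
    show "integrable \<mu> (\<lambda>x. max (del \<Theta> x - t) 0)" using integrable_del_alloc[OF \<Theta>(1)] by simp
    fix v
    have "f v * (del \<Theta> v - t) \<le> f v * max (del \<Theta> v - t) 0" using f(2) by (intro mult_left_mono) auto
    also have "\<dots> \<le> 1 * max (del \<Theta> v - t) 0" using f(2) by (intro mult_right_mono) auto
    finally show "f v * (del \<Theta> v - t) \<le> max (del \<Theta> v - t) 0" by simp
  qed
  finally show "(\<integral>x. fmin f x \<partial>\<nu>) - t * (\<integral>x. f x \<partial>\<mu>) \<le> (\<integral>x. max (del \<Theta> x - t) 0 \<partial>\<mu>)" .
qed

end


section \<open>Local allocations are dense\<close>

context unimodular_measure
begin

definition locally_approximable :: "(hsstar \<Rightarrow> real) \<Rightarrow> bool" where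
  "locally_approximable g \<longleftrightarrow> (\<forall>\<epsilon>>0. \<exists>m f. 1 \<le> m \<and> elocal m f \<and> (\<forall>x. 0 \<le> f x \<and> f x \<le> 1) \<and> (\<integral>x. \<bar>f x - g x\<bar> \<partial>\<nu>) < \<epsilon>)"

lemma integrable_unit:
  fixes f :: "hsstar \<Rightarrow> real"
  assumes "f \<in> borel_measurable borel" "\<And>x. 0 \<le> f x" "\<And>x. f x \<le> 1" shows "integrable \<nu> f"
  by (rule integrable_\<nu>[of _ 1]) (use assms in \<open>auto simp: abs_of_nonneg\<close>)

text \<open>
  The closure property behind complements (\<open>1 - p\<close>), unions (\<open>max p q\<close>) and averages:
  \<open>\<phi>\<close> does not increase the distance in \<open>L\<^sup>1\<close>.
\<close>

lemma locally_approximable_combine: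
  assumes g: "locally_approximable g" "g \<in> borel_measurable borel" "\<And>x. 0 \<le> g x" "\<And>x. g x \<le> 1"
    and h: "locally_approximable h" "h \<in> borel_measurable borel" "\<And>x. 0 \<le> h x" "\<And>x. h x \<le> 1"
    and unit: "\<And>p q. 0 \<le> p \<Longrightarrow> p \<le> 1 \<Longrightarrow> 0 \<le> q \<Longrightarrow> q \<le> 1 \<Longrightarrow> 0 \<le> \<phi> p q \<and> \<phi> p q \<le> 1"
    and lip: "\<And>p q r s. \<bar>\<phi> p q - \<phi> r s\<bar> \<le> \<bar>p - r\<bar> + \<bar>q - s\<bar>"
    and meas: "(\<lambda>x. \<phi> (g x) (h x)) \<in> borel_measurable borel"
  shows "locally_approximable (\<lambda>x. \<phi> (g x) (h x))"
  unfolding locally_approximable_def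
proof (intro allI impI)
  fix \<epsilon> :: real assume "0 < \<epsilon>"
  then have e: "0 < \<epsilon> / 2" by simp
  obtain m f where f: "1 \<le> m" "elocal m f" "\<forall>x. 0 \<le> f x \<and> f x \<le> 1" "(\<integral>x. \<bar>f x - g x\<bar> \<partial>\<nu>) < \<epsilon> / 2"
    using g(1) e unfolding locally_approximable_def by blast
  obtain n k where k: "1 \<le> n" "elocal n k" "\<forall>x. 0 \<le> k x \<and> k x \<le> 1" "(\<integral>x. \<bar>k x - h x\<bar> \<partial>\<nu>) < \<epsilon> / 2"
    using h(1) e unfolding locally_approximable_def by blast
  have loc: "elocal (max m n) (\<lambda>x. \<phi> (f x) (k x))"
    by (intro elocal_comp2[of _ f k \<phi>] elocal_mono[OF f(2)] elocal_mono[OF k(2)]) auto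
  have one: "1 \<le> max m n" using f(1) by simp
  have fk: "f \<in> borel_measurable borel" "k \<in> borel_measurable borel" "(\<lambda>x. \<phi> (f x) (k x)) \<in> borel_measurable borel"
    using elocal_measurable[OF f(2,1)] elocal_measurable[OF k(2,1)] elocal_measurable[OF loc one] by auto
  have u: "0 \<le> \<phi> (f x) (k x)" "\<phi> (f x) (k x) \<le> 1" "0 \<le> \<phi> (g x) (h x)" "\<phi> (g x) (h x) \<le> 1" for x
    using unit f(3) k(3) g(3,4) h(3,4) by auto
  have i: "integrable \<nu> f" "integrable \<nu> k" "integrable \<nu> g" "integrable \<nu> h"
    "integrable \<nu> (\<lambda>x. \<phi> (f x) (k x))" "integrable \<nu> (\<lambda>x. \<phi> (g x) (h x))"
    using f k fk g h u meas by (auto intro!: integrable_unit)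
  have "(\<integral>x. \<bar>\<phi> (f x) (k x) - \<phi> (g x) (h x)\<bar> \<partial>\<nu>) \<le> (\<integral>x. \<bar>f x - g x\<bar> + \<bar>k x - h x\<bar> \<partial>\<nu>)"
    using i lip by (intro integral_mono) auto
  also have "\<dots> < \<epsilon>" using i f(4) k(4) by simp
  finally show "\<exists>m f. 1 \<le> m \<and> elocal m f \<and> (\<forall>x. 0 \<le> f x \<and> f x \<le> 1) \<and> (\<integral>x. \<bar>f x - \<phi> (g x) (h x)\<bar> \<partial>\<nu>) < \<epsilon>"
    using loc one u by blast
qed

lemma locally_approximable_limit:
  assumes g: "\<And>n. locally_approximable (g n)" "\<And>n. g n \<in> borel_measurable borel" "\<And>n x. 0 \<le> g n x" "\<And>n x. g n x \<le> 1"
    and lim: "\<And>x. (\<lambda>n. g n x) \<longlonglongrightarrow> h x"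
  shows "locally_approximable h"
  unfolding locally_approximable_def
proof (intro allI impI)
  fix \<epsilon> :: real assume "0 < \<epsilon>"
  then have e: "0 < \<epsilon> / 2" by simp
  have h: "h \<in> borel_measurable borel" "0 \<le> h x" "h x \<le> 1" for x
    using borel_measurable_LIMSEQ_real[OF lim g(2)] LIMSEQ_le_const[OF lim, of 0] LIMSEQ_le_const2[OF lim, of _ 1] g(3,4) by auto
  have "(\<lambda>n. \<integral>x. \<bar>g n x - h x\<bar> \<partial>\<nu>) \<longlonglongrightarrow> (\<integral>x. 0 \<partial>\<nu>)"
  proof (rule integral_dominated_convergence[where w = "\<lambda>_. 1"])
    show "AE x in \<nu>. (\<lambda>n. \<bar>g n x - h x\<bar>) \<longlonglongrightarrow> 0"
      using tendsto_rabs[OF tendsto_diff[OF lim tendsto_const]] by (intro AE_I2) (metis abs_zero diff_self)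
    have "\<bar>g n x - h x\<bar> \<le> 1" for n x using g(3,4)[of n x] h(2,3)[of x] by (auto simp: abs_le_iff)
    then show "AE x in \<nu>. norm \<bar>g n x - h x\<bar> \<le> 1" for n by simp
    show "(\<lambda>x. \<bar>g n x - h x\<bar>) \<in> borel_measurable \<nu>" for n using g(2)[of n] h(1) by simp
  qed auto
  then have "eventually (\<lambda>n. (\<integral>x. \<bar>g n x - h x\<bar> \<partial>\<nu>) < \<epsilon> / 2) sequentially"
    using e by (intro order_tendstoD(2)) auto
  then obtain n where n: "(\<integral>x. \<bar>g n x - h x\<bar> \<partial>\<nu>) < \<epsilon> / 2" by (auto simp: eventually_sequentially)
  obtain m f where f: "1 \<le> m" "elocal m f" "\<forall>x. 0 \<le> f x \<and> f x \<le> 1" "(\<integral>x. \<bar>f x - g n x\<bar> \<partial>\<nu>) < \<epsilon> / 2"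
    using g(1)[of n] e unfolding locally_approximable_def by blast
  have i: "integrable \<nu> f" "integrable \<nu> (g n)" "integrable \<nu> h"
    using f g h elocal_measurable[OF f(2,1)] by (auto intro!: integrable_unit)
  have "(\<integral>x. \<bar>f x - h x\<bar> \<partial>\<nu>) \<le> (\<integral>x. \<bar>f x - g n x\<bar> + \<bar>g n x - h x\<bar> \<partial>\<nu>)"
    using i by (intro integral_mono) auto
  also have "\<dots> < \<epsilon>" using i f(4) n by simp
  finally show "\<exists>m f. 1 \<le> m \<and> elocal m f \<and> (\<forall>x. 0 \<le> f x \<and> f x \<le> 1) \<and> (\<integral>x. \<bar>f x - h x\<bar> \<partial>\<nu>) < \<epsilon>"
    using f(1-3) by blast
qed

lemma locally_approximable_local:
  assumes "1 \<le> m" "elocal m f" "\<And>x. 0 \<le> f x" "\<And>x. f x \<le> 1" shows "locally_approximable f"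
  unfolding locally_approximable_def using assms by (intro allI impI exI[of _ m] exI[of _ f]) simp

text \<open>
  The sets with approximable indicators form a \<open>\<sigma>\<close>-algebra that contains the balls. The
  measure \<open>\<nu>\<close> is finite, so countable unions are approximated by finite ones.
\<close>

lemma locally_approximable_indicator:
  assumes "A \<in> sets borel" shows "locally_approximable (indicator A)"
proof -
  have "A \<in> sigma_sets UNIV (insert {} eballs)" using assms unfolding sets_borel_eballs .
  then show ?thesis
  proof (induction rule: sigma_sets.induct)
    case (Basic A)
    have "\<exists>m\<ge>1. esat m A" using Basic esat_eball by (auto simp: eballs_def esat_def)
    then obtain m where m: "1 \<le> m" "esat m A" by blast
    from elocal_indicator[OF m] show ?case by (rule locally_approximable_local[OF m(1)]) auto
  next
    case Empty
    show ?case using locally_approximable_local[OF order_refl elocal_const, of 0] by (simp add: indicator_def[abs_def])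
  next
    case (Compl A)
    have A: "A \<in> sets borel" unfolding sets_borel_eballs by (rule Compl.hyps)
    have "indicat_real (UNIV - A) = (\<lambda>x. 1 - indicator A x)" by (auto simp: fun_eq_iff indicator_def)
    then show ?case
      using locally_approximable_combine[OF Compl.IH _ _ _ Compl.IH, of "\<lambda>p q. 1 - p"] A by auto
  next
    case (Union A)
    have A: "A i \<in> sets borel" for i unfolding sets_borel_eballs by (rule Union.hyps)
    have fin: "locally_approximable (indicator (\<Union>i<n. A i))" for n
    proof (induction n)
      case 0
      show ?case using locally_approximable_local[OF order_refl elocal_const, of 0] by (simp add: indicator_def[abs_def])
    next
      case (Suc n)
      have "indicat_real (\<Union>i<Suc n. A i) = (\<lambda>x. max (indicator (\<Union>i<n. A i) x) (indicator (A n) x))"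
        by (auto simp: fun_eq_iff indicator_def less_Suc_eq)
      then show ?case using locally_approximable_combine[OF Suc _ _ _ Union.IH[of n], of max] A by auto
    qed
    show ?case
    proof (rule locally_approximable_limit[OF fin])
      show "(\<lambda>n. indicat_real (\<Union>i<n. A i) x) \<longlonglongrightarrow> indicator (\<Union>i. A i) x" for x
      proof (cases "\<exists>k. x \<in> A k")
        case True
        then obtain k where k: "x \<in> A k" ..
        then have "indicat_real (\<Union>i<n. A i) x = 1" if "n \<ge> Suc k" for n using that by (auto simp: indicator_def)
        then show ?thesis using k by (intro tendsto_eventually) (auto simp: eventually_sequentially indicator_def)
      qed (simp add: indicator_def)
    qed (use A in auto)
  qed
qed

text \<open>
  Peel off binary digits: \<open>g = (1\<^bsub>A\<^esub> + g') / 2\<close> with \<open>A = {g \<ge> 1/2}\<close>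
  and \<open>g'\<close> again with values in \<open>[0, 1]\<close>. After \<open>n\<close> steps the error is at
  most \<open>1 / 2\<^sup>n\<close>.
\<close>

lemma locally_approximable_unit:
  assumes g: "g \<in> borel_measurable borel" "\<And>x. 0 \<le> g x" "\<And>x. g x \<le> 1"
  shows "locally_approximable g"
proof -
  have step: "\<exists>h. locally_approximable h \<and> h \<in> borel_measurable borel \<and> (\<forall>x. 0 \<le> h x \<and> h x \<le> 1 \<and> \<bar>h x - g x\<bar> \<le> 1 / 2 ^ n)"
    if "g \<in> borel_measurable borel" "\<And>x. 0 \<le> g x" "\<And>x. g x \<le> 1" for n and g :: "hsstar \<Rightarrow> real"
    using that
  proof (induction n arbitrary: g)
    case 0
    have "locally_approximable (\<lambda>_. 0)" by (rule locally_approximable_local[of 1]) (auto simp: elocal_const)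
    then show ?case using 0 by (intro exI[of _ "\<lambda>_. 0"]) (auto simp: abs_of_nonneg)
  next
    case (Suc n)
    let ?A = "{x. 1 / 2 \<le> g x}"
    have "{x \<in> space borel. 1 / 2 \<le> g x} \<in> sets borel" using Suc.prems(1) by measurable
    then have A: "?A \<in> sets borel" by simp
    let ?g = "\<lambda>x. 2 * g x - indicator ?A x"
    have "?g \<in> borel_measurable borel" using A Suc.prems(1) by simp
    moreover have "0 \<le> ?g x" "?g x \<le> 1" for x using Suc.prems(2,3)[of x] by (auto simp: indicator_def)
    ultimately obtain h where h: "locally_approximable h" "h \<in> borel_measurable borel"
      "\<forall>x. 0 \<le> h x \<and> h x \<le> 1 \<and> \<bar>h x - ?g x\<bar> \<le> 1 / 2 ^ n" using Suc.IH by blast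
    let ?h = "\<lambda>x. 1 / 2 * indicator ?A x + 1 / 2 * h x"
    have "locally_approximable ?h"
      by (rule locally_approximable_combine[OF locally_approximable_indicator[OF A] _ _ _ h(1,2),
            where \<phi> = "\<lambda>p q. 1 / 2 * p + 1 / 2 * q"]) (use A h(2,3) in \<open>auto simp: abs_if\<close>)
    moreover have "?h \<in> borel_measurable borel" using A h(2) by simp
    moreover have "0 \<le> ?h x" "?h x \<le> 1" for x using h(3)[rule_format, of x] by (auto simp: indicator_def)
    moreover have "\<bar>?h x - g x\<bar> \<le> 1 / 2 ^ Suc n" for x
    proof -
      have eq: "?h x - g x = (h x - ?g x) / 2" by (simp add: field_simps)
      have "\<bar>?h x - g x\<bar> = \<bar>h x - ?g x\<bar> / 2" unfolding eq abs_divide by simp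
      also have "\<dots> \<le> (1 / 2 ^ n) / 2" using h(3) by (intro divide_right_mono) auto
      finally show ?thesis by simp
    qed
    ultimately show ?case by blast
  qed
  obtain h where h: "\<And>n. locally_approximable (h n)" "\<And>n. h n \<in> borel_measurable borel"
    "\<And>n x. 0 \<le> h n x" "\<And>n x. h n x \<le> 1" "\<And>n x. \<bar>h n x - g x\<bar> \<le> 1 / 2 ^ n"
    using step[OF g] by metis
  show ?thesis
  proof (rule locally_approximable_limit[OF h(1-4)])
    fix x
    have "(\<lambda>n. 1 / 2 ^ n :: real) \<longlonglongrightarrow> 0"
      using LIMSEQ_realpow_zero[of "1 / 2"] by (simp add: power_one_over)
    then have "(\<lambda>n. h n x - g x) \<longlonglongrightarrow> 0"
      by (rule Lim_null_comparison[rotated]) (use h(5) in auto)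
    then show "(\<lambda>n. h n x) \<longlonglongrightarrow> g x" by (rule LIM_zero_cancel)
  qed
qed

text \<open>
  Local approximations of \<open>\<Theta>\<close> in \<open>L\<^sup>1(\<nu>)\<close> converge almost everywhere
  along a subsequence, simultaneously at all vertices of almost every edge. They need not sum to 1 over an edge,
  but their sums tend to 1, so normalising preserves the limit. The summand \<open>1 / (n + 1)\<close> keeps the
  sums positive.
\<close>

theorem local_allocations_dense:
  assumes \<Theta>: "borel_allocation \<Theta>"
  obtains \<Phi> where "\<And>n :: nat. borel_allocation (\<Phi> n)" "\<And>n. \<exists>m\<ge>1. elocal m (\<Phi> n)"
    "AE x in \<nu>. (\<lambda>n. \<Phi> n x) \<longlonglongrightarrow> \<Theta> x"
proof -
  have "\<exists>m f. 1 \<le> m \<and> elocal m f \<and> (\<forall>x. 0 \<le> f x \<and> f x \<le> 1) \<and> (\<integral>x. \<bar>f x - \<Theta> x\<bar> \<partial>\<nu>) < 1 / (1 + real n)" for n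
    using locally_approximable_unit[OF borel_allocationD(1-3)[OF \<Theta>]] unfolding locally_approximable_def by simp
  then obtain m f where f: "\<And>n. 1 \<le> m n" "\<And>n. elocal (m n) (f n)" "\<And>n x. 0 \<le> f n x" "\<And>n x. f n x \<le> 1"
    "\<And>n :: nat. (\<integral>x. \<bar>f n x - \<Theta> x\<bar> \<partial>\<nu>) < 1 / (1 + real n)" by metis
  have inv0: "(\<lambda>n. 1 / (1 + real n)) \<longlonglongrightarrow> 0"
    using LIMSEQ_inverse_real_of_nat by (simp add: inverse_eq_divide add.commute)
  have fm: "f n \<in> borel_measurable borel" for n by (rule elocal_measurable[OF f(2,1)])
  have int: "integrable \<nu> (\<lambda>x. f n x - \<Theta> x)" for n
    using integrable_unit[OF fm f(3,4)] integrable_unit[OF borel_allocationD(1-3)[OF \<Theta>]] by simp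
  have "(\<lambda>n. \<integral>x. norm (f n x - \<Theta> x) \<partial>\<nu>) \<longlonglongrightarrow> 0"
    by (rule Lim_null_comparison[OF _ inv0]) (use f(5) less_imp_le in \<open>auto intro!: eventuallyI\<close>)
  then obtain r where r: "strict_mono r" "AE x in \<nu>. (\<lambda>n. f (r n) x - \<Theta> x) \<longlonglongrightarrow> 0"
    using tendsto_L1_AE_subseq[of \<nu> "\<lambda>n x. f n x - \<Theta> x", OF int] by blast
  define w where "w n x = f (r n) x + 1 / (1 + real n)" for n x
  define \<Phi> where "\<Phi> n x = w n x / esum (w n) x" for n x
  have wpos: "0 < w n x" for n x using f(3)[of "r n" x] by (simp add: w_def add_nonneg_pos)
  have wloc: "elocal (m (r n)) (w n)" for n unfolding w_def[abs_def] by (rule elocal_comp[OF f(2)])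
  show ?thesis
  proof (rule that)
    show "borel_allocation (\<Phi> n)" for n
      unfolding \<Phi>_def[abs_def]
    proof (rule borel_allocation_normalise)
      show "w n \<in> borel_measurable borel" by (rule elocal_measurable[OF wloc f(1)])
      show "0 \<le> w n x" "\<exists>y\<in>sibs x. w n y \<noteq> 0" for x
        using wpos sibs_self by (auto intro: less_imp_le simp: less_imp_neq[OF wpos, symmetric])
    qed
    have "elocal (Suc (m (r n))) (\<Phi> n)" for n
      unfolding \<Phi>_def[abs_def]
      by (rule elocal_comp2[OF elocal_mono[OF wloc] elocal_esum[OF wloc f(1)]]) simp
    then show "\<exists>m\<ge>1. elocal m (\<Phi> n)" for n by (intro exI[of _ "Suc (m (r n))"]) simp
    show "AE x in \<nu>. (\<lambda>n. \<Phi> n x) \<longlonglongrightarrow> \<Theta> x"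
      using AE_sibs[OF r(2)]
    proof (rule AE_mp, intro AE_I2 impI)
      fix x assume "\<forall>y\<in>sibs x. (\<lambda>n. f (r n) y - \<Theta> y) \<longlonglongrightarrow> 0"
      then have "(\<lambda>n. w n y) \<longlonglongrightarrow> \<Theta> y" if "y \<in> sibs x" for y
        unfolding w_def using tendsto_add[OF LIM_zero_cancel inv0, of "\<lambda>n. f (r n) y" "\<Theta> y"] that by simp
      then have "(\<lambda>n. \<Phi> n x) \<longlonglongrightarrow> \<Theta> x / esum \<Theta> x"
        unfolding \<Phi>_def using sibs_self borel_allocationD(5)[OF \<Theta>] by (intro tendsto_divide tendsto_esum) auto
      then show "(\<lambda>n. \<Phi> n x) \<longlonglongrightarrow> \<Theta> x" by (simp add: borel_allocationD(5)[OF \<Theta>])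
    qed
  qed
qed

end


section \<open>Finite hypergraphs\<close>

lemma hpath_trans:
  assumes "hpath H n i j" "hpath H m j k" shows "hpath H (n + m) i k"
  using assms(2)
proof (induction m arbitrary: k)
  case 0 then show ?case using assms(1) by (simp add: hpath_0)
next
  case (Suc m)
  then obtain l e where "hpath H m j l" "e \<in> edges H" "l \<in> e" "k \<in> e" by (auto simp: hpath_Suc)
  then show ?case using Suc.IH[of l] by (auto simp: hpath_Suc)
qed

lemma (in hypergraph) hpath_edge: "e \<in> edges H \<Longrightarrow> i \<in> e \<Longrightarrow> j \<in> e \<Longrightarrow> hpath H 1 i j"
  using edge_subset[of e] by (auto simp: hpath_Suc hpath_0)

lemma (in hypergraph) hpath_sym: "hpath H n i j \<Longrightarrow> hpath H n j i"
proof (induction n arbitrary: j)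
  case 0 then show ?case by (auto simp: hpath_0)
next
  case (Suc n)
  then obtain k e where k: "hpath H n i k" "e \<in> edges H" "k \<in> e" "j \<in> e" by (auto simp: hpath_Suc)
  then have "hpath H (1 + n) j i" by (intro hpath_trans[OF hpath_edge[OF k(2,4,3)]] Suc.IH)
  then show ?case by simp
qed

lemma verts_component [simp]: "verts (component H i) = {j \<in> verts H. \<exists>n. hpath H n i j}"
  and edges_component [simp]: "edges (component H i) = {e \<in> edges H. e \<subseteq> {j \<in> verts H. \<exists>n. hpath H n i j}}"
  by (simp_all add: component_def hrestrict_def)

context hypergraph
begin

lemma edge_in_component:
  assumes "e \<in> edges H" "j \<in> e" "hpath H n i j" shows "e \<in> edges (component H i)"
proof -
  have "hpath H (n + 1) i k" if "k \<in> e" for k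
    using hpath_trans[OF assms(3) hpath_edge[OF assms(1,2) that]] .
  then show ?thesis using assms(1) edge_subset[of e] by auto
qed

lemma component_incident:
  assumes "i \<in> verts H" shows "{e \<in> edges (component H i). i \<in> e} = {e \<in> edges H. i \<in> e}"
proof -
  have "hpath H 0 i i" using assms by (simp add: hpath_0)
  then show ?thesis using edge_in_component[of _ i 0 i] by auto
qed

lemma vrooted_component:
  assumes i: "i \<in> verts H" shows "vrooted (component H i, i)"
proof -
  let ?C = "component H i"
  have H: "hypergraph ?C"
  proof
    show "countable (verts ?C)" by (rule countable_subset[OF _ countable_verts]) auto
    show "finite {e \<in> edges ?C. j \<in> e}" if "j \<in> verts ?C" for j
      by (rule finite_subset[OF _ locally_finite[of j]]) (use that in auto)
  qed (use edge_finite edge_nonempty in auto)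
  have i0: "hpath H 0 i i" using i by (simp add: hpath_0)
  have path: "hpath ?C n i j" if "hpath H n i j" for n j
    using that
  proof (induction n arbitrary: j)
    case 0
    have "\<exists>n. hpath H n i i" using i0 by blast
    with 0 show ?case by (auto simp: hpath_0)
  next
    case (Suc n)
    then obtain k e where k: "hpath H n i k" "e \<in> edges H" "k \<in> e" "j \<in> e" by (auto simp: hpath_Suc)
    then show ?case using Suc.IH[OF k(1)] edge_in_component[OF k(2,3,1)] unfolding hpath_Suc by blast
  qed
  have "\<exists>n. hpath ?C n j k" if "j \<in> verts ?C" "k \<in> verts ?C" for j k
  proof -
    obtain n m where "hpath H n i j" "hpath H m i k" using \<open>j \<in> verts ?C\<close> \<open>k \<in> verts ?C\<close> by auto
    then show ?thesis using hpath_trans[OF hypergraph.hpath_sym[OF H path] path] by blast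
  qed
  then have "hconnected ?C" unfolding hconnected_def by blast
  then show ?thesis using H i i0 by auto
qed

lemma component_eq:
  assumes "e \<in> edges H" "i \<in> e" "j \<in> e" shows "component H i = component H j"
proof -
  have "(\<exists>n. hpath H n i k) \<longleftrightarrow> (\<exists>n. hpath H n j k)" for k
    using hpath_trans[OF hpath_edge[OF assms(1,2,3)]] hpath_trans[OF hpath_edge[OF assms(1,3,2)]] by blast
  then show ?thesis by (simp add: component_def)
qed

lemma erooted_component:
  assumes "e \<in> edges H" "i \<in> e" "j \<in> e" shows "erooted (component H i, e, j)"
proof -
  have i: "i \<in> verts H" using assms edge_subset by auto
  then have "hpath H 0 i i" by (simp add: hpath_0)
  then have "e \<in> edges (component H i)" using assms by (intro edge_in_component)
  then show ?thesis using vrooted_component[OF i] assms by simp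
qed

text \<open>
  The classes that a finite hypergraph presents to functions on \<open>\<H>\<^sub>*\<close> and
  \<open>\<H>\<^sub>*\<^sub>*\<close>. A class determines a connected hypergraph, so the root has to be seen
  from its own component; all vertices of an edge see the same one.
\<close>

definition rooted_at :: "'v \<Rightarrow> hstar" where
  "rooted_at i = vclass (component H i) i"

definition flag_at :: "'v set \<Rightarrow> 'v \<Rightarrow> hsstar" where
  "flag_at e i = eclass (component H i) e i"

lemma flag_at_eq: "e \<in> edges H \<Longrightarrow> i \<in> e \<Longrightarrow> j \<in> e \<Longrightarrow> flag_at e j = eclass (component H i) e j"
  unfolding flag_at_def by (simp only: component_eq[of e i j])

lemma sibs_flag:
  assumes "e \<in> edges H" "i \<in> e" shows "sibs (flag_at e i) = flag_at e ` e"
proof -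
  have "sibs (flag_at e i) = eclass (component H i) e ` e"
    unfolding flag_at_def by (rule sibs_eclass[OF erooted_component[OF assms assms(2)]])
  also have "\<dots> = flag_at e ` e" by (rule image_cong[OF refl flag_at_eq[OF assms, symmetric]])
  finally show ?thesis .
qed

lemma esum_flag:
  assumes "e \<in> edges H" "i \<in> e" shows "esum f (flag_at e i) = (\<Sum>j\<in>e. f (flag_at e j))"
proof -
  have "esum f (flag_at e i) = (\<Sum>j\<in>e. f (eclass (component H i) e j))"
    unfolding flag_at_def by (rule esum_eclass[OF erooted_component[OF assms assms(2)]])
  also have "\<dots> = (\<Sum>j\<in>e. f (flag_at e j))" by (rule sum.cong[OF refl]) (simp only: flag_at_eq[OF assms])
  finally show ?thesis .
qed

lemma vroot_flag: "e \<in> edges H \<Longrightarrow> i \<in> e \<Longrightarrow> vroot (flag_at e i) = rooted_at i"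
  using vroot_eclass[OF erooted_component, of e i i] by (simp add: flag_at_def rooted_at_def)

lemma ecard_flag: "e \<in> edges H \<Longrightarrow> i \<in> e \<Longrightarrow> ecard (flag_at e i) = real (card e)"
  by (simp add: ecard_def esum_flag)

lemma del_rooted_at: "i \<in> verts H \<Longrightarrow> del f (rooted_at i) = (\<Sum>e\<in>{e \<in> edges H. i \<in> e}. f (flag_at e i))"
  unfolding rooted_at_def flag_at_def by (simp only: del_vclass[OF vrooted_component] component_incident)

lemma fmin_flag:
  assumes "e \<in> edges H" "i \<in> e" shows "fmin g (flag_at e i) = (MIN j\<in>e. g (rooted_at j)) / real (card e)"
proof -
  have "(\<lambda>y. g (vroot y)) ` flag_at e ` e = (\<lambda>j. g (rooted_at j)) ` e"
    using vroot_flag[OF assms(1)] by (auto simp: image_image)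
  then show ?thesis using assms by (simp add: fmin_emin emin_def sibs_flag ecard_flag)
qed

text \<open>
  The finite counterpart of mass transport.
\<close>

lemma double_count:
  fixes F :: "'v set \<Rightarrow> 'v \<Rightarrow> real"
  assumes "finite (verts H)"
  shows "(\<Sum>i\<in>verts H. \<Sum>e\<in>{e \<in> edges H. i \<in> e}. F e i) = (\<Sum>e\<in>edges H. \<Sum>i\<in>e. F e i)"
proof -
  have "edges H \<subseteq> Pow (verts H)" using edge_subset by auto
  then have fin: "finite (edges H)" by (rule finite_subset) (simp add: assms)
  have "(\<Sum>i\<in>verts H. \<Sum>e\<in>{e \<in> edges H. i \<in> e}. F e i) = (\<Sum>e\<in>edges H. \<Sum>i\<in>{i \<in> verts H. i \<in> e}. F e i)"
    by (rule sum.swap_restrict[OF assms fin])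
  also have "\<dots> = (\<Sum>e\<in>edges H. \<Sum>i\<in>e. F e i)"
    using edge_subset by (intro sum.cong refl) (auto simp: Int_def[symmetric])
  finally show ?thesis .
qed

lemma Min_le_weighted_sum:
  fixes g :: "'v \<Rightarrow> real"
  assumes e: "e \<in> edges H" and p: "\<And>j. j \<in> e \<Longrightarrow> 0 \<le> p j" "(\<Sum>j\<in>e. p j) = 1"
  shows "(MIN j\<in>e. g j) \<le> (\<Sum>j\<in>e. g j * p j)"
proof -
  have "(MIN j\<in>e. g j) = (\<Sum>j\<in>e. (MIN j\<in>e. g j) * p j)" using p(2) by (simp add: sum_distrib_left[symmetric])
  also have "\<dots> \<le> (\<Sum>j\<in>e. g j * p j)"
    using p(1) edge_finite[OF e] by (intro sum_mono mult_right_mono) auto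
  finally show ?thesis .
qed

lemma balanced_weighted_sum:
  assumes \<theta>: "balanced_allocation H \<theta>" and e: "e \<in> edges H" and \<gamma>: "\<And>x y. x \<le> y \<Longrightarrow> \<gamma> x \<le> (\<gamma> y :: real)"
  shows "(\<Sum>j\<in>e. \<gamma> (load H \<theta> j) * \<theta> e j) = (MIN j\<in>e. \<gamma> (load H \<theta> j))"
proof -
  let ?m = "MIN j\<in>e. \<gamma> (load H \<theta> j)"
  have fin: "finite e" "e \<noteq> {}" using edge_finite edge_nonempty e by auto
  have "\<gamma> (load H \<theta> j) * \<theta> e j = ?m * \<theta> e j" if j: "j \<in> e" for j
  proof (cases "\<theta> e j = 0")
    case False
    have "load H \<theta> j \<le> load H \<theta> k" if "k \<in> e" for k
      using \<theta> e j that False unfolding balanced_allocation_def by (meson not_le)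
    then have "?m = \<gamma> (load H \<theta> j)" using fin j \<gamma> by (intro Min_eqI) auto
    then show ?thesis by simp
  qed simp
  then have "(\<Sum>j\<in>e. \<gamma> (load H \<theta> j) * \<theta> e j) = (\<Sum>j\<in>e. ?m * \<theta> e j)" by (rule sum.cong[OF refl])
  also have "\<dots> = ?m * (\<Sum>j\<in>e. \<theta> e j)" by (rule sum_distrib_left[symmetric])
  also have "\<dots> = ?m" using \<theta> e by (simp add: balanced_allocation_def allocation_def)
  finally show ?thesis .
qed

lemma sum_load:
  assumes "finite (verts H)"
  shows "(\<Sum>i\<in>verts H. g i * load H \<theta> i) = (\<Sum>e\<in>edges H. \<Sum>j\<in>e. g j * \<theta> e j)"
  by (simp add: load_def sum_distrib_left double_count[OF assms, symmetric])

text \<open>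
  A Borel allocation induces an allocation on each finite hypergraph, and the balanced one minimises the convex
  cost \<open>(t - x)\<^sup>+\<close>. The function \<open>\<gamma>\<close> is the slope of this cost.
\<close>

lemma finite_deficit_upper:
  assumes fin: "finite (verts H)" and \<theta>: "balanced_allocation H \<theta>" and \<Theta>: "borel_allocation \<Theta>"
  shows "(\<Sum>i\<in>verts H. max 0 (t - load H \<theta> i)) \<le> (\<Sum>i\<in>verts H. max 0 (t - del \<Theta> (rooted_at i)))"
proof -
  define \<gamma> where "\<gamma> x = (if x < t then - 1 else 0 :: real)" for x
  have "(\<Sum>i\<in>verts H. \<gamma> (load H \<theta> i) * load H \<theta> i) = (\<Sum>e\<in>edges H. MIN j\<in>e. \<gamma> (load H \<theta> j))"
    unfolding sum_load[OF fin] by (intro sum.cong refl balanced_weighted_sum[OF \<theta>]) (auto simp: \<gamma>_def)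
  also have "\<dots> \<le> (\<Sum>e\<in>edges H. \<Sum>j\<in>e. \<gamma> (load H \<theta> j) * \<Theta> (flag_at e j))"
  proof (intro sum_mono Min_le_weighted_sum)
    fix e assume e: "e \<in> edges H"
    show "e \<in> edges H" by fact
    obtain i where i: "i \<in> e" using edge_nonempty[OF e] by blast
    show "(\<Sum>j\<in>e. \<Theta> (flag_at e j)) = 1"
      using esum_flag[OF e i, of \<Theta>] borel_allocationD(5)[OF \<Theta>] by simp
  qed (rule borel_allocationD(2)[OF \<Theta>])
  also have "\<dots> = (\<Sum>i\<in>verts H. \<gamma> (load H \<theta> i) * del \<Theta> (rooted_at i))"
    by (simp add: double_count[OF fin, symmetric] del_rooted_at sum_distrib_left)
  finally have le: "(\<Sum>i\<in>verts H. \<gamma> (load H \<theta> i) * load H \<theta> i) \<le> (\<Sum>i\<in>verts H. \<gamma> (load H \<theta> i) * del \<Theta> (rooted_at i))" .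
  have "(\<Sum>i\<in>verts H. max 0 (t - load H \<theta> i)) \<le>
      (\<Sum>i\<in>verts H. max 0 (t - del \<Theta> (rooted_at i)) + (\<gamma> (load H \<theta> i) * load H \<theta> i - \<gamma> (load H \<theta> i) * del \<Theta> (rooted_at i)))"
    by (intro sum_mono) (auto simp: \<gamma>_def)
  then show ?thesis using le by (simp add: sum.distrib sum_subtractf)
qed

text \<open>
  Weak duality for \<open>- h\<close>, as \<open>(t - x)\<^sup>+ \<ge> h * (t - x)\<close> for \<open>0 \<le> h
  \<le> 1\<close>. The dual functional is an integral over the uniformly rooted hypergraph.
\<close>

lemma finite_deficit_lower:
  assumes fin: "finite (verts H)" and \<theta>: "allocation H \<theta>" and h: "\<And>v. 0 \<le> h v" "\<And>v. h v \<le> 1"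
  shows "(\<Sum>i\<in>verts H. t * h (rooted_at i) + del (fmin (\<lambda>v. - h v)) (rooted_at i)) \<le> (\<Sum>i\<in>verts H. max 0 (t - load H \<theta> i))"
proof -
  have "(\<Sum>i\<in>verts H. del (fmin (\<lambda>v. - h v)) (rooted_at i)) = (\<Sum>e\<in>edges H. \<Sum>i\<in>e. fmin (\<lambda>v. - h v) (flag_at e i))"
    by (simp add: double_count[OF fin, symmetric] del_rooted_at)
  also have "\<dots> = (\<Sum>e\<in>edges H. MIN j\<in>e. - h (rooted_at j))"
  proof (rule sum.cong[OF refl])
    fix e assume e: "e \<in> edges H"
    have "card e \<noteq> 0" using edge_finite[OF e] edge_nonempty[OF e] by simp
    then show "(\<Sum>i\<in>e. fmin (\<lambda>v. - h v) (flag_at e i)) = (MIN j\<in>e. - h (rooted_at j))"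
      by (simp add: fmin_flag[OF e])
  qed
  also have "\<dots> \<le> (\<Sum>e\<in>edges H. \<Sum>j\<in>e. - h (rooted_at j) * \<theta> e j)"
    using \<theta> by (intro sum_mono Min_le_weighted_sum) (auto simp: allocation_def)
  also have "\<dots> = (\<Sum>i\<in>verts H. - h (rooted_at i) * load H \<theta> i)" by (rule sum_load[OF fin, symmetric])
  finally have "(\<Sum>i\<in>verts H. t * h (rooted_at i) + del (fmin (\<lambda>v. - h v)) (rooted_at i)) \<le>
      (\<Sum>i\<in>verts H. t * h (rooted_at i) + - h (rooted_at i) * load H \<theta> i)"
    unfolding sum.distrib by (rule add_left_mono)
  also have "\<dots> \<le> (\<Sum>i\<in>verts H. max 0 (t - load H \<theta> i))"
  proof (rule sum_mono)
    fix i
    have "h (rooted_at i) * (t - load H \<theta> i) \<le> h (rooted_at i) * max 0 (t - load H \<theta> i)"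
      using h by (intro mult_left_mono) auto
    also have "\<dots> \<le> 1 * max 0 (t - load H \<theta> i)" using h by (intro mult_right_mono) auto
    finally show "t * h (rooted_at i) + - h (rooted_at i) * load H \<theta> i \<le> max 0 (t - load H \<theta> i)"
      by (simp add: algebra_simps)
  qed
  finally show ?thesis .
qed

end

lemma integral_rooted_law:
  assumes "finite_hypergraph H" "F \<in> borel_measurable borel"
  shows "integral\<^sup>L (rooted_law H) F = (\<Sum>i\<in>verts H. F (hypergraph.rooted_at H i)) / real (card (verts H))"
proof -
  have "integral\<^sup>L (rooted_law H) F = (\<integral>i. F (vclass (component H i) i) \<partial>uniform_count_measure (verts H))"
    unfolding rooted_law_def using assms(2)
    by (intro integral_distr) (auto simp: measurable_def space_uniform_count_measure sets_uniform_count_measure)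
  then show ?thesis
    using assms(1) by (simp add: integral_uniform_count_measure finite_hypergraph_def hypergraph.rooted_at_def)
qed

lemma integral_load_law:
  assumes "finite_hypergraph H" "F \<in> borel_measurable borel"
  shows "integral\<^sup>L (load_law H \<theta>) F = (\<Sum>i\<in>verts H. F (load H \<theta> i)) / real (card (verts H))"
proof -
  have "integral\<^sup>L (load_law H \<theta>) F = (\<integral>i. F (load H \<theta> i) \<partial>uniform_count_measure (verts H))"
    unfolding load_law_def using assms(2)
    by (intro integral_distr) (auto simp: measurable_def space_uniform_count_measure sets_uniform_count_measure)
  then show ?thesis
    using assms(1) by (simp add: integral_uniform_count_measure finite_hypergraph_def)
qed

lemma real_distribution_load_law:
  assumes "finite_hypergraph H" shows "real_distribution (load_law H \<theta>)"
proof -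
  interpret prob_space "uniform_count_measure (verts H)"
    using assms by (intro prob_space_uniform_count_measure) (auto simp: finite_hypergraph_def)
  show ?thesis unfolding load_law_def
    by (rule real_distribution_distr) (auto simp: measurable_def space_uniform_count_measure sets_uniform_count_measure)
qed


section \<open>Cutting off large degrees\<close>

text \<open>
  Switches off the vertices that share an edge with a vertex of degree above \<open>k\<close>. Written with
  \<open>\<partial>\<close> and \<open>esum\<close> it is evidently local; \<open>cutoff_alt\<close> is the form
  for estimates.
\<close>

definition cutoff :: "nat \<Rightarrow> hstar \<Rightarrow> real" where
  "cutoff k v = of_bool (del (esum (\<lambda>z. of_bool (k < hdeg (vroot z)))) v = 0)"

lemma cutoff_alt: "cutoff k v = of_bool (\<forall>y\<in>star v. \<forall>z\<in>sibs y. hdeg (vroot z) \<le> k)"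
proof -
  have "0 \<le> esum (\<lambda>z. of_bool (k < hdeg (vroot z))) y" for y by (rule esum_nonneg) simp
  then have "del (esum (\<lambda>z. of_bool (k < hdeg (vroot z)))) v = 0 \<longleftrightarrow>
      (\<forall>y\<in>star v. esum (\<lambda>z. of_bool (k < hdeg (vroot z))) y = 0)" by (rule del_eq_0_iff)
  also have "\<dots> \<longleftrightarrow> (\<forall>y\<in>star v. \<forall>z\<in>sibs y. hdeg (vroot z) \<le> k)"
    by (subst esum_eq_0_iff) (auto simp: not_less)
  finally show ?thesis by (simp add: cutoff_def)
qed

lemma cutoff_bounds: "0 \<le> cutoff k v" "cutoff k v \<le> 1"
  by (simp_all add: cutoff_def)

lemma vlocal_cutoff: "vlocal 2 (cutoff k)"
proof -
  have "elocal 1 (\<lambda>z. of_bool (k < hdeg (vroot z)) :: real)"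
    using elocal_comp[OF elocal_vroot[OF vlocal_hdeg], of 1 "\<lambda>d. of_bool (k < d)"] by simp
  then have "elocal (Suc 1) (esum (\<lambda>z. of_bool (k < hdeg (vroot z))))" by (rule elocal_esum) simp
  then have "vlocal (Suc 1) (del (esum (\<lambda>z. of_bool (k < hdeg (vroot z)))))" by (rule vlocal_del) simp
  then have "vlocal (Suc 1) (cutoff k)" unfolding cutoff_def[abs_def] by (rule vlocal_comp)
  then show ?thesis by (simp add: numeral_2_eq_2)
qed

lemma tendsto_cutoff: "(\<lambda>k. cutoff k v) \<longlonglongrightarrow> 1"
proof -
  define B where "B = Max (insert 0 ((\<lambda>z. hdeg (vroot z)) ` (\<Union>y\<in>star v. sibs y)))"
  have "hdeg (vroot z) \<le> B" if "y \<in> star v" "z \<in> sibs y" for y z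
    unfolding B_def by (rule Max_ge) (use that in auto)
  then have "cutoff k v = 1" if "k \<ge> B" for k using that unfolding cutoff_alt by (auto intro: order_trans)
  then show ?thesis by (intro tendsto_eventually) (auto simp: eventually_sequentially)
qed

text \<open>
  A vertex of degree above \<open>k\<close> switches off all vertices of all its edges. Hence \<open>\<partial>
  (fmin (- cutoff k * h))\<close> vanishes where the degree exceeds \<open>k\<close>, and it is bounded by
  \<open>k\<close> elsewhere.
\<close>

lemma fmin_cutoff_eq_0:
  assumes "k < hdeg (vroot y)" shows "fmin (\<lambda>v. - (cutoff k v * h v)) y = 0"
proof -
  have "cutoff k (vroot z) = 0" if z: "z \<in> sibs y" for z
  proof -
    have "y \<in> sibs z" using sibs_sibs[OF z] sibs_self[of y] by simp
    then have "\<not> (\<forall>y\<in>star (vroot z). \<forall>w\<in>sibs y. hdeg (vroot w) \<le> k)"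
      using assms star_vroot[of z] by (meson not_le)
    then show ?thesis by (simp add: cutoff_alt)
  qed
  then have "emin (\<lambda>z. - (cutoff k (vroot z) * h (vroot z))) y = emin (\<lambda>_. 0) y" by (intro emin_cong) simp
  also have "\<dots> = 0" by (simp add: emin_def image_constant_conv)
  finally show ?thesis by (simp add: fmin_emin)
qed

lemma elocal_fmin:
  assumes g: "vlocal m g" and m: "1 \<le> m" shows "elocal (Suc m) (fmin g)"
proof -
  have "elocal (Suc m) (\<lambda>x. (\<lambda>y. g (vroot y)) ` sibs x)" by (rule elocal_sibs[OF elocal_vroot[OF g m] m])
  moreover have "elocal (Suc m) ecard" unfolding ecard_def by (rule elocal_esum[OF elocal_const m])
  ultimately show ?thesis
    unfolding fmin_emin[abs_def] emin_def by (rule elocal_comp2[of _ _ _ "\<lambda>S c. Min S / c"])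
qed

section \<open>Local weak limits\<close>

context unimodular_measure
begin

lemma local_weak_convergence:
  fixes F :: "hstar \<Rightarrow> real"
  assumes "converges_weakly (\<lambda>n. rooted_law (H n)) \<mu>" "vlocal m F" "1 \<le> m" "\<And>v. \<bar>F v\<bar> \<le> B"
  shows "(\<lambda>n. integral\<^sup>L (rooted_law (H n)) F) \<longlonglongrightarrow> integral\<^sup>L \<mu> F"
  using assms(1)[unfolded converges_weakly_def] vlocal_continuous[OF assms(2,3)] assms(4)
  by (auto simp: bounded_iff)

lemma deficit_bound: "0 \<le> x \<Longrightarrow> \<bar>max 0 (t - x)\<bar> \<le> \<bar>t\<bar>" for x t :: real
  by (cases "t \<le> x") (auto simp: max_def)

lemma deficit_tendsto:
  assumes \<Theta>: "AE x in \<nu>. (\<lambda>n :: nat. \<Phi> n x) \<longlonglongrightarrow> \<Theta> x" "borel_allocation \<Theta>" and \<Phi>: "\<And>n. borel_allocation (\<Phi> n)"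
  shows "(\<lambda>n. \<integral>v. max 0 (t - del (\<Phi> n) v) \<partial>\<mu>) \<longlonglongrightarrow> (\<integral>v. max 0 (t - del \<Theta> v) \<partial>\<mu>)"
proof (rule integral_dominated_convergence[where w = "\<lambda>_. \<bar>t\<bar>"])
  have [measurable]: "\<Theta> \<in> borel_measurable borel" "\<Phi> n \<in> borel_measurable borel" for n
    using \<Theta> \<Phi> borel_allocationD(1) by blast+
  show "(\<lambda>v. max 0 (t - del \<Theta> v)) \<in> borel_measurable \<mu>" "(\<lambda>v. max 0 (t - del (\<Phi> n) v)) \<in> borel_measurable \<mu>" for n
    by measurable
  show "AE v in \<mu>. (\<lambda>n. max 0 (t - del (\<Phi> n) v)) \<longlonglongrightarrow> max 0 (t - del \<Theta> v)"
    using AE_tendsto_del[OF \<Theta>(1)] by (rule AE_mp) (auto intro!: AE_I2 tendsto_intros)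
  have "0 \<le> del (\<Phi> n) v" for n v by (rule del_allocation_nonneg[OF \<Phi>])
  then show "AE v in \<mu>. norm (max 0 (t - del (\<Phi> n) v)) \<le> \<bar>t\<bar>" for n
    unfolding real_norm_def by (intro AE_I2 deficit_bound)
qed simp

context
  fixes H :: "nat \<Rightarrow> 'v pre_hypergraph" and \<theta> :: "nat \<Rightarrow> 'v set \<Rightarrow> 'v \<Rightarrow> real" and \<Theta> :: "hsstar \<Rightarrow> real"
  assumes H: "\<And>n. finite_hypergraph (H n)" and lim: "converges_weakly (\<lambda>n. rooted_law (H n)) \<mu>"
    and \<theta>: "\<And>n. balanced_allocation (H n) (\<theta> n)" and \<Theta>: "borel_allocation \<Theta>" "balanced_wrt \<Theta> \<mu>"
begin

text \<open>
  Local weak convergence applies to the competitor \<open>\<Phi> k\<close> since its deficit is local and, loads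
  being nonnegative, bounded.
\<close>

lemma deficit_upper:
  assumes a: "(\<integral>v. max 0 (t - del \<Theta> v) \<partial>\<mu>) < a"
  shows "eventually (\<lambda>n. (\<integral>x. max 0 (t - x) \<partial>load_law (H n) (\<theta> n)) < a) sequentially"
proof -
  obtain \<Phi> where \<Phi>: "\<And>n :: nat. borel_allocation (\<Phi> n)" "\<And>n. \<exists>m\<ge>1. elocal m (\<Phi> n)"
    "AE x in \<nu>. (\<lambda>n. \<Phi> n x) \<longlonglongrightarrow> \<Theta> x" using local_allocations_dense[OF \<Theta>(1)] by blast
  obtain k where k: "(\<integral>v. max 0 (t - del (\<Phi> k) v) \<partial>\<mu>) < a"
    using order_tendstoD(2)[OF deficit_tendsto[OF \<Phi>(3) \<Theta>(1) \<Phi>(1)] a] by (auto simp: eventually_sequentially)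
  obtain m where m: "1 \<le> m" "elocal m (\<Phi> k)" using \<Phi>(2) by blast
  let ?F = "\<lambda>v. max 0 (t - del (\<Phi> k) v)"
  have F: "vlocal m ?F" by (rule vlocal_comp[OF vlocal_del[OF m(2,1)]])
  have nn: "0 \<le> del (\<Phi> k) v" for v by (rule del_allocation_nonneg[OF \<Phi>(1)])
  have "\<bar>?F v\<bar> \<le> \<bar>t\<bar>" for v by (rule deficit_bound[OF nn])
  then have "(\<lambda>n. integral\<^sup>L (rooted_law (H n)) ?F) \<longlonglongrightarrow> integral\<^sup>L \<mu> ?F"
    by (rule local_weak_convergence[OF lim F m(1)])
  then have "eventually (\<lambda>n. integral\<^sup>L (rooted_law (H n)) ?F < a) sequentially"
    using k by (rule order_tendstoD(2))
  then show ?thesis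
  proof (rule eventually_mono)
    fix n assume less: "integral\<^sup>L (rooted_law (H n)) ?F < a"
    interpret hypergraph "H n" using H by (simp add: finite_hypergraph_def)
    have fin: "finite (verts (H n))" using H by (simp add: finite_hypergraph_def)
    have "(\<integral>x. max 0 (t - x) \<partial>load_law (H n) (\<theta> n)) \<le> integral\<^sup>L (rooted_law (H n)) ?F"
      unfolding integral_rooted_law[OF H vlocal_measurable[OF F m(1)]]
      using finite_deficit_upper[OF fin \<theta> \<Phi>(1), of t k]
      by (subst integral_load_law[OF H]) (auto intro: divide_right_mono)
    then show "(\<integral>x. max 0 (t - x) \<partial>load_law (H n) (\<theta> n)) < a" using less by linarith
  qed
qed

text \<open>
  By strong duality the deficit \<open>\<integral> (t - \<partial>\<Theta>)\<^sup>+ d\<mu>\<close> is, up to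
  \<open>s\<close>, the value of the dual functional at \<open>\<psi> \<circ> \<partial>\<Theta>\<close>, where
  \<open>\<psi>\<close> is a continuous version of the indicator of \<open>x < t\<close>. Continuity is needed
  to replace \<open>\<Theta>\<close> by local allocations \<open>\<Phi> k\<close>. With the degree cutoff the
  dual functional becomes the integral of a bounded local function \<open>R k\<close>, to which local weak
  convergence applies.
\<close>

lemma deficit_lower:
  assumes a: "a < (\<integral>v. max 0 (t - del \<Theta> v) \<partial>\<mu>)"
  shows "eventually (\<lambda>n. a < (\<integral>x. max 0 (t - x) \<partial>load_law (H n) (\<theta> n))) sequentially"
proof -
  let ?C = "\<integral>v. max 0 (t - del \<Theta> v) \<partial>\<mu>"
  \<comment> \<open>Half of the gap is given away in replacing the indicator by \<open>\<psi>\<close>.\<close>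
  define s where "s = (?C - a) / 2"
  have s: "0 < s" using a by (simp add: s_def)
  define \<psi> where "\<psi> x = min 1 (max 0 ((t - x) / s))" for x
  have \<psi>: "0 \<le> \<psi> x" "\<psi> x \<le> 1" "\<bar>\<psi> x\<bar> \<le> 1" for x by (auto simp: \<psi>_def)
  have \<psi>_anti: "\<psi> y \<le> \<psi> x" if "x \<le> y" for x y
    unfolding \<psi>_def using that s by (intro min.mono max.mono divide_right_mono) auto
  have [measurable]: "\<psi> \<in> borel_measurable borel" unfolding \<psi>_def[abs_def] by measurable
  have \<psi>_cont: "isCont \<psi> x" for x unfolding \<psi>_def[abs_def] using s by (intro continuous_intros) auto
  have \<psi>_approx: "max 0 (t - x) - s \<le> t * \<psi> x - \<psi> x * x" for x
  proof -
    have eq: "t * \<psi> x - \<psi> x * x = \<psi> x * (t - x)" by (simp add: algebra_simps)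
    consider "t - x \<le> 0" | "0 < t - x" "t - x \<le> s" | "s < t - x" by linarith
    then show ?thesis
    proof cases
      case 1
      then have "\<psi> x = 0" using s by (simp add: \<psi>_def divide_nonpos_pos)
      then show ?thesis using 1 s by simp
    next
      case 2
      then have "0 \<le> \<psi> x * (t - x)" using \<psi>(1) by simp
      then show ?thesis using 2 unfolding eq by simp
    next
      case 3
      then have "\<psi> x = 1" using s by (simp add: \<psi>_def)
      then show ?thesis using s 3 by simp
    qed
  qed
  have [measurable]: "\<Theta> \<in> borel_measurable borel" by (rule borel_allocationD(1)[OF \<Theta>(1)])
  obtain \<Phi> where \<Phi>: "\<And>n :: nat. borel_allocation (\<Phi> n)" "\<And>n. \<exists>m\<ge>1. elocal m (\<Phi> n)"
    "AE x in \<nu>. (\<lambda>n. \<Phi> n x) \<longlonglongrightarrow> \<Theta> x" using local_allocations_dense[OF \<Theta>(1)] by blast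
  define h where "h k v = cutoff k v * \<psi> (del (\<Phi> k) v)" for k v
  have h: "0 \<le> h k v" "h k v \<le> 1" for k v
    using cutoff_bounds[of k v] \<psi>(1,2) by (auto simp: h_def intro: mult_le_one)
  have h_local: "\<exists>m\<ge>1. vlocal m (h k)" for k
  proof -
    obtain m where m: "1 \<le> m" "elocal m (\<Phi> k)" using \<Phi>(2) by blast
    have "vlocal (max 2 m) (h k)"
      unfolding h_def[abs_def]
      by (rule vlocal_comp2[OF vlocal_mono[OF vlocal_cutoff] vlocal_mono[OF vlocal_del[OF m(2,1)]],
            where h = "\<lambda>p q. p * \<psi> q"]) auto
    then show ?thesis by (intro exI[of _ "max 2 m"]) simp
  qed
  have hm[measurable]: "h k \<in> borel_measurable borel" for k using h_local[of k] vlocal_measurable by blast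
  define R where "R k v = t * h k v + del (fmin (\<lambda>v. - h k v)) v" for k v
  have fm: "fmin (\<lambda>v. - h k v) \<in> borel_measurable borel" for k by (rule fmin_measurable) measurable
  have fb: "\<bar>fmin (\<lambda>v. - h k v) x\<bar> \<le> 1" for k x
    by (rule fmin_bound) (use h in \<open>simp add: abs_of_nonneg\<close>)
  have R_local: "\<exists>m\<ge>1. vlocal m (R k)" for k
  proof -
    obtain m where m: "1 \<le> m" "vlocal m (h k)" using h_local by blast
    have "vlocal m (\<lambda>v. - h k v)" by (rule vlocal_comp[OF m(2)])
    then have "vlocal (Suc m) (del (fmin (\<lambda>v. - h k v)))" by (intro vlocal_del elocal_fmin m(1)) simp_all
    then have "vlocal (Suc m) (R k)"
      unfolding R_def[abs_def] by (intro vlocal_comp2[OF vlocal_mono[OF m(2)], where h = "\<lambda>p q. t * p + q"]) simp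
    then show ?thesis by (intro exI[of _ "Suc m"]) simp
  qed
  have R_bound: "\<bar>R k v\<bar> \<le> \<bar>t\<bar> + real k" for k v
  proof -
    have "\<bar>del (fmin (\<lambda>v. - h k v)) v\<bar> \<le> real k"
    proof (cases "hdeg v \<le> k")
      case True
      then show ?thesis using del_bound[of "fmin (\<lambda>v. - h k v)" 1 v] fb by simp
    next
      case False
      have "fmin (\<lambda>v. - h k v) y = 0" if "y \<in> star v" for y
        unfolding h_def using False vroot_star[OF that] by (intro fmin_cutoff_eq_0) simp
      then have "del (fmin (\<lambda>v. - h k v)) v = del (\<lambda>_. 0) v" by (rule del_cong)
      then show ?thesis by simp
    qed
    moreover have "\<bar>t * h k v\<bar> \<le> \<bar>t\<bar>" using h[of k v] by (simp add: abs_mult mult_left_le)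
    ultimately show ?thesis unfolding R_def by linarith
  qed
  have int_h: "integrable \<mu> (h k)" for k by (rule integrable_const_bound[of _ 1]) (use h in \<open>auto simp: abs_of_nonneg\<close>)
  have R_int: "integral\<^sup>L \<mu> (R k) = t * integral\<^sup>L \<mu> (h k) + integral\<^sup>L \<nu> (fmin (\<lambda>v. - h k v))" for k
    unfolding R_def using int_h integrable_del[OF fm fb] by (simp add: integral_\<nu>[OF fm fb])
  have h_lim: "AE v in \<mu>. (\<lambda>k. h k v) \<longlonglongrightarrow> \<psi> (del \<Theta> v)"
    using AE_tendsto_del[OF \<Phi>(3)]
  proof (rule AE_mp, intro AE_I2 impI)
    fix v assume "(\<lambda>k. del (\<Phi> k) v) \<longlonglongrightarrow> del \<Theta> v"
    then have "(\<lambda>k. cutoff k v * \<psi> (del (\<Phi> k) v)) \<longlonglongrightarrow> 1 * \<psi> (del \<Theta> v)"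
      by (intro tendsto_mult tendsto_cutoff isCont_tendsto_compose[OF \<psi>_cont])
    then show "(\<lambda>k. h k v) \<longlonglongrightarrow> \<psi> (del \<Theta> v)" by (simp add: h_def)
  qed
  have lim1: "(\<lambda>k. integral\<^sup>L \<mu> (h k)) \<longlonglongrightarrow> (\<integral>v. \<psi> (del \<Theta> v) \<partial>\<mu>)"
    by (rule integral_dominated_convergence[where w = "\<lambda>_. 1"]) (use h h_lim in \<open>auto simp: abs_of_nonneg\<close>)
  have lim2: "(\<lambda>k. integral\<^sup>L \<nu> (fmin (\<lambda>v. - h k v))) \<longlonglongrightarrow> integral\<^sup>L \<nu> (fmin (\<lambda>v. - \<psi> (del \<Theta> v)))"
  proof (rule integral_dominated_convergence[where w = "\<lambda>_. 1"])
    show "AE x in \<nu>. (\<lambda>k. fmin (\<lambda>v. - h k v) x) \<longlonglongrightarrow> fmin (\<lambda>v. - \<psi> (del \<Theta> v)) x"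
      using AE_sibs[OF AE_vroot[OF h_lim]] unfolding fmin_emin
      by (rule AE_mp) (auto intro!: AE_I2 tendsto_divide tendsto_emin tendsto_minus simp: less_imp_neq[OF ecard_pos, symmetric])
    show "fmin (\<lambda>v. - \<psi> (del \<Theta> v)) \<in> borel_measurable \<nu>" using fmin_measurable[of "\<lambda>v. - \<psi> (del \<Theta> v)"] by simp
    show "fmin (\<lambda>v. - h k v) \<in> borel_measurable \<nu>" for k using fm[of k] by simp
    show "AE x in \<nu>. norm (fmin (\<lambda>v. - h k v) x) \<le> 1" for k using fb by simp
  qed simp
  have R_lim: "(\<lambda>k. integral\<^sup>L \<mu> (R k)) \<longlonglongrightarrow> t * (\<integral>v. \<psi> (del \<Theta> v) \<partial>\<mu>) + integral\<^sup>L \<nu> (fmin (\<lambda>v. - \<psi> (del \<Theta> v)))"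
    unfolding R_int by (intro tendsto_add tendsto_mult tendsto_const lim1 lim2)
  have "integral\<^sup>L \<nu> (fmin (\<lambda>v. - \<psi> (del \<Theta> v))) = (\<integral>v. - \<psi> (del \<Theta> v) * del \<Theta> v \<partial>\<mu>)"
    by (rule balanced_duality[OF \<Theta>, of "\<lambda>x. - \<psi> x" 1]) (use \<psi> \<psi>_anti in auto)
  moreover have "?C - s \<le> t * (\<integral>v. \<psi> (del \<Theta> v) \<partial>\<mu>) + (\<integral>v. - \<psi> (del \<Theta> v) * del \<Theta> v \<partial>\<mu>)"
  proof -
    have nn: "0 \<le> del \<Theta> v" for v by (rule del_allocation_nonneg[OF \<Theta>(1)])
    have i1: "integrable \<mu> (\<lambda>v. \<psi> (del \<Theta> v))" by (rule integrable_const_bound[of _ 1]) (use \<psi> in auto)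
    have i2: "integrable \<mu> (\<lambda>v. \<psi> (del \<Theta> v) * del \<Theta> v)" by (rule integrable_mult_del[OF \<Theta>(1), of _ 1]) (use \<psi> in auto)
    have i3: "integrable \<mu> (\<lambda>v. max 0 (t - del \<Theta> v))" using integrable_del_alloc[OF \<Theta>(1)] by simp
    have "(\<integral>v. max 0 (t - del \<Theta> v) - s \<partial>\<mu>) \<le> (\<integral>v. t * \<psi> (del \<Theta> v) - \<psi> (del \<Theta> v) * del \<Theta> v \<partial>\<mu>)"
      by (rule integral_mono) (use i1 i2 i3 \<psi>_approx in auto)
    then show ?thesis using i1 i2 i3 prob_space by simp
  qed
  moreover have "a < ?C - s" using a by (simp add: s_def field_simps)
  ultimately have "eventually (\<lambda>k. a < integral\<^sup>L \<mu> (R k)) sequentially"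
    by (intro order_tendstoD(1)[OF R_lim]) linarith
  then obtain k where k: "a < integral\<^sup>L \<mu> (R k)" by (auto simp: eventually_sequentially)
  obtain m where m: "1 \<le> m" "vlocal m (R k)" using R_local by blast
  have "(\<lambda>n. integral\<^sup>L (rooted_law (H n)) (R k)) \<longlonglongrightarrow> integral\<^sup>L \<mu> (R k)"
    by (rule local_weak_convergence[OF lim m(2,1) R_bound])
  then have "eventually (\<lambda>n. a < integral\<^sup>L (rooted_law (H n)) (R k)) sequentially"
    using k by (rule order_tendstoD(1))
  then show ?thesis
  proof (rule eventually_mono)
    fix n assume less: "a < integral\<^sup>L (rooted_law (H n)) (R k)"
    interpret hypergraph "H n" using H by (simp add: finite_hypergraph_def)
    have fin: "finite (verts (H n))" using H by (simp add: finite_hypergraph_def)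
    have al: "allocation (H n) (\<theta> n)" using \<theta> by (simp add: balanced_allocation_def)
    have "integral\<^sup>L (rooted_law (H n)) (R k) \<le> (\<integral>x. max 0 (t - x) \<partial>load_law (H n) (\<theta> n))"
      unfolding integral_rooted_law[OF H vlocal_measurable[OF m(2,1)]]
      using finite_deficit_lower[OF fin al, of "h k" t] h
      by (subst integral_load_law[OF H]) (auto simp: R_def intro: divide_right_mono)
    then show "a < (\<integral>x. max 0 (t - x) \<partial>load_law (H n) (\<theta> n))" using less by linarith
  qed
qed

lemma deficit_convergence:
  "(\<lambda>n. \<integral>x. max 0 (t - x) \<partial>load_law (H n) (\<theta> n)) \<longlonglongrightarrow> (\<integral>v. max 0 (t - del \<Theta> v) \<partial>\<mu>)"
  by (rule order_tendstoI) (rule deficit_lower deficit_upper, assumption)+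

text \<open>
  The piecewise linear approximations of indicators of half-lines are differences of hinge functions.
\<close>

theorem load_law_convergence: "weak_conv_m (\<lambda>n. load_law (H n) (\<theta> n)) (distr \<mu> borel (del \<Theta>))"
proof (rule integral_cts_step_conv_imp_weak_conv)
  have m: "del \<Theta> \<in> borel_measurable \<mu>" using del_measurable[OF borel_allocationD(1)[OF \<Theta>(1)]] by simp
  show "real_distribution (load_law (H n) (\<theta> n))" for n by (rule real_distribution_load_law[OF H])
  show "real_distribution (distr \<mu> borel (del \<Theta>))" by (rule real_distribution_distr[OF m])
  fix a b :: real assume ab: "a < b"
  have step: "cts_step a b x = (max 0 (b - x) - max 0 (a - x)) / (b - a)" for x
    using ab by (auto simp: cts_step_def max_def field_simps)
  have fin: "(\<integral>x. cts_step a b x \<partial>load_law (H n) (\<theta> n)) =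
      ((\<integral>x. max 0 (b - x) \<partial>load_law (H n) (\<theta> n)) - (\<integral>x. max 0 (a - x) \<partial>load_law (H n) (\<theta> n))) / (b - a)" for n
    unfolding step
    by (simp add: integral_load_law[OF H] sum_subtractf diff_divide_distrib sum_divide_distrib[symmetric] mult.commute)
  have i: "integrable \<mu> (\<lambda>v. max 0 (t - del \<Theta> v))" for t using integrable_del_alloc[OF \<Theta>(1)] by simp
  have "(\<integral>x. cts_step a b x \<partial>distr \<mu> borel (del \<Theta>)) = (\<integral>v. cts_step a b (del \<Theta> v) \<partial>\<mu>)"
    by (rule integral_distr[OF m]) (simp add: step[abs_def])
  also have "\<dots> = ((\<integral>v. max 0 (b - del \<Theta> v) \<partial>\<mu>) - (\<integral>v. max 0 (a - del \<Theta> v) \<partial>\<mu>)) / (b - a)"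
    unfolding step using i by simp
  finally show "(\<lambda>n. integral\<^sup>L (load_law (H n) (\<theta> n)) (cts_step a b)) \<longlonglongrightarrow> integral\<^sup>L (distr \<mu> borel (del \<Theta>)) (cts_step a b)"
    unfolding fin using ab by (auto intro!: tendsto_intros deficit_convergence)
qed

end

end

theorem theorem1:
  fixes \<mu> :: "hstar measure"
  assumes "sets \<mu> = sets borel"
    and "prob_space \<mu>"
    and "unimodular \<mu>"
    and "mean_deg \<mu> < \<infinity>"
  shows
    "(\<exists>\<Theta>. borel_allocation \<Theta> \<and> balanced_wrt \<Theta> \<mu>)
   \<and> (\<forall>\<Theta>. borel_allocation \<Theta> \<longrightarrow> balanced_wrt \<Theta> \<mu> \<longrightarrow>
        (\<forall>t :: real.
          (\<exists>f. f \<in> borel_measurable borel \<and> (\<forall>x. 0 \<le> f x \<and> f x \<le> 1) \<and>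
             (\<integral>x. max (del \<Theta> x - t) 0 \<partial>\<mu>) = (\<integral>x. fmin f x \<partial>vec_measure \<mu>) - t * (\<integral>x. f x \<partial>\<mu>)) \<and>
          (\<forall>f. f \<in> borel_measurable borel \<and> (\<forall>x. 0 \<le> f x \<and> f x \<le> 1) \<longrightarrow>
             (\<integral>x. fmin f x \<partial>vec_measure \<mu>) - t * (\<integral>x. f x \<partial>\<mu>) \<le> (\<integral>x. max (del \<Theta> x - t) 0 \<partial>\<mu>))))
   \<and> (\<forall>\<Theta>. borel_allocation \<Theta> \<longrightarrow>
        (balanced_wrt \<Theta> \<mu> \<longleftrightarrow>
          (\<exists>f. strictly_convex_on {0..} f \<and> (\<forall>x\<ge>0. 0 \<le> f x) \<and> load_cost \<mu> f \<Theta> < \<infinity> \<and>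
             (\<forall>\<Theta>'. borel_allocation \<Theta>' \<longrightarrow> load_cost \<mu> f \<Theta> \<le> load_cost \<mu> f \<Theta>'))) \<and>
        (balanced_wrt \<Theta> \<mu> \<longleftrightarrow>
          (\<forall>f. convex_on {0..} f \<and> (\<forall>x\<ge>0. 0 \<le> f x) \<longrightarrow>
             (\<forall>\<Theta>'. borel_allocation \<Theta>' \<longrightarrow> load_cost \<mu> f \<Theta> \<le> load_cost \<mu> f \<Theta>'))))
   \<and> (\<forall>\<Theta>\<^sub>0 \<Theta>. borel_allocation \<Theta>\<^sub>0 \<longrightarrow> balanced_wrt \<Theta>\<^sub>0 \<mu> \<longrightarrow> borel_allocation \<Theta> \<longrightarrow>
        (balanced_wrt \<Theta> \<mu> \<longleftrightarrow> (AE x in \<mu>. del \<Theta>\<^sub>0 x = del \<Theta> x)))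
   \<and> (\<forall>(H :: nat \<Rightarrow> 'v pre_hypergraph) \<theta> \<Theta>.
        (\<forall>n. finite_hypergraph (H n)) \<longrightarrow>
        converges_weakly (\<lambda>n. rooted_law (H n)) \<mu> \<longrightarrow>
        (\<forall>n. balanced_allocation (H n) (\<theta> n)) \<longrightarrow>
        borel_allocation \<Theta> \<longrightarrow> balanced_wrt \<Theta> \<mu> \<longrightarrow>
        weak_conv_m (\<lambda>n. load_law (H n) (\<theta> n)) (distr \<mu> borel (del \<Theta>)))"
proof -
  interpret unimodular_measure \<mu> by (rule unimodular_measure.intro; fact)
  show ?thesis
  proof (intro conjI allI impI)
    show "\<exists>\<Theta>. borel_allocation \<Theta> \<and> balanced_wrt \<Theta> \<mu>" using balanced_exists by blast
    show "\<exists>f. f \<in> borel_measurable borel \<and> (\<forall>x. 0 \<le> f x \<and> f x \<le> 1) \<and>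
        (\<integral>x. max (del \<Theta> x - t) 0 \<partial>\<mu>) = (\<integral>x. fmin f x \<partial>\<nu>) - t * (\<integral>x. f x \<partial>\<mu>)"
      if "borel_allocation \<Theta>" "balanced_wrt \<Theta> \<mu>" for \<Theta> t
      by (rule balanced_excess_duality(1)[OF that])
    show "(\<integral>x. fmin f x \<partial>\<nu>) - t * (\<integral>x. f x \<partial>\<mu>) \<le> (\<integral>x. max (del \<Theta> x - t) 0 \<partial>\<mu>)"
      if "borel_allocation \<Theta>" "balanced_wrt \<Theta> \<mu>" "f \<in> borel_measurable borel \<and> (\<forall>x. 0 \<le> f x \<and> f x \<le> 1)" for \<Theta> t f
      using balanced_excess_duality(2)[OF that(1,2)] that(3) by blast
    show "weak_conv_m (\<lambda>n. load_law (H n) (\<theta> n)) (distr \<mu> borel (del \<Theta>))"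
      if "\<forall>n. finite_hypergraph (H n)" "converges_weakly (\<lambda>n. rooted_law (H n)) \<mu>"
        "\<forall>n. balanced_allocation (H n) (\<theta> n)" "borel_allocation \<Theta>" "balanced_wrt \<Theta> \<mu>"
      for H :: "nat \<Rightarrow> 'v pre_hypergraph" and \<theta> \<Theta>
      by (rule load_law_convergence) (use that in auto)
  qed (rule balanced_iff_strictly_convex balanced_iff_all_convex balanced_loads_agree; assumption)+
qed

end
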